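(* Let $L>0$ and let $\rho,a\in BV(0,L)$ satisfy $0<\rho_0\le\rho(x)\le\rho_1$ and $0<a_0\le a(x)\le a_1$ for a.e. $x\in(0,L)$, where $\rho_0,\rho_1,a_0,a_1$ are constants. Set $\beta=\operatorname{ess\,sup}_{x\in[0,L]}\sqrt{\rho(x)/a(x)}$ and let $L\beta<T<\infty$. Then there exists a constant $C_1>0$ such that, for every $s_0\in H^1(L\beta,T)$ with $s_0(L\beta)=0$ and every finite-energy solution $\psi$ of $$\begin{cases}\rho(x)\psi_{tt}-(a(x)\psi_x)_x=0, & 0<x<L,\ 0<t<T,\\ \psi(x,T)=0,\ \psi_t(x,T)=0, & 0<x<L,\\ \psi(0,t)=0,\ \psi(L,t)=s(t), & 0<t<T,\end{cases}\qquad s(t)=\begin{cases}s_0(t), & L\beta\le t\le T,\\ 0, & 0\le t\le L\beta,\end{cases}$$ one has $$\|s_0\|_{H^1(L\beta,T)}\le C_1\,\|\psi_x(0,\cdot)\|_{L^2(0,T)}.$$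
   Context: A finite-energy solution is a weak solution $\psi$ of the system with $(\psi,\psi_t)\in C([0,T];H^1(0,L)\times L^2(0,L))$; its boundary trace $\psi_x(0,\cdot)$ is understood through the flux, $\psi_x(0,t)=(a\psi_x)(0,t)/a(0)$, and belongs to $L^2(0,T)$. The values of the $BV$ functions $a,\rho$ at the endpoints $0$ and $L$ are one-sided limits. The constant $C_1$ does not depend on $s_0$ or $\psi$ (it may depend on $\rho,a,L,T$). *)

theory Defs
  imports "HOL-Analysis.Analysis" "HOL-Probability.Essential_Supremum"
begin

section \<open>The spaces \<open>L\<^sup>2\<close> and \<open>H\<^sup>1\<close> on a bounded open interval\<close>

definition L2_fun :: "real \<Rightarrow> real \<Rightarrow> (real \<Rightarrow> real) \<Rightarrow> bool" where
  "L2_fun a b f \<longleftrightarrow>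
     f \<in> borel_measurable (lebesgue_on {a<..<b}) \<and>
     integrable (lebesgue_on {a<..<b}) (\<lambda>x. (f x)\<^sup>2)"

definition L2_norm :: "real \<Rightarrow> real \<Rightarrow> (real \<Rightarrow> real) \<Rightarrow> real" where
  "L2_norm a b f = sqrt (\<integral>x. (f x)\<^sup>2 \<partial>lebesgue_on {a<..<b})"

text \<open>\<open>p\<close> is a \<open>C\<^sup>1\<close> function with compact support in \<open>(a, b)\<close>, and \<open>p'\<close> is its derivative.\<close>

definition C1c_fun :: "real \<Rightarrow> real \<Rightarrow> (real \<Rightarrow> real) \<Rightarrow> (real \<Rightarrow> real) \<Rightarrow> bool" where
  "C1c_fun a b p p' \<longleftrightarrow>
     (\<forall>x. (p has_real_derivative p' x) (at x)) \<and> continuous_on UNIV p' \<and>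
     (\<exists>c d. a < c \<and> d < b \<and> (\<forall>x. x \<notin> {c..d} \<longrightarrow> p x = 0))"

definition has_weak_deriv :: "real \<Rightarrow> real \<Rightarrow> (real \<Rightarrow> real) \<Rightarrow> (real \<Rightarrow> real) \<Rightarrow> bool" where
  "has_weak_deriv a b f g \<longleftrightarrow>
     (\<forall>p p'. C1c_fun a b p p' \<longrightarrow>
        (\<integral>x. f x * p' x \<partial>lebesgue_on {a<..<b}) = - (\<integral>x. g x * p x \<partial>lebesgue_on {a<..<b}))"

text \<open>An element of \<open>H\<^sup>1(a,b)\<close> is given by its continuous representative on \<open>[a,b]\<close>, so that
  its values at points, the endpoints included, have their usual meaning.\<close>

definition H1_fun :: "real \<Rightarrow> real \<Rightarrow> (real \<Rightarrow> real) \<Rightarrow> bool" where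
  "H1_fun a b f \<longleftrightarrow>
     continuous_on {a..b} f \<and> L2_fun a b f \<and> (\<exists>g. L2_fun a b g \<and> has_weak_deriv a b f g)"

definition weak_deriv :: "real \<Rightarrow> real \<Rightarrow> (real \<Rightarrow> real) \<Rightarrow> real \<Rightarrow> real" where
  "weak_deriv a b f = (SOME g. L2_fun a b g \<and> has_weak_deriv a b f g)"

definition H1_norm :: "real \<Rightarrow> real \<Rightarrow> (real \<Rightarrow> real) \<Rightarrow> real" where
  "H1_norm a b f = sqrt ((L2_norm a b f)\<^sup>2 + (L2_norm a b (weak_deriv a b f))\<^sup>2)"


section \<open>Functions of bounded variation\<close>

definition bounded_variation_on :: "real set \<Rightarrow> (real \<Rightarrow> real) \<Rightarrow> bool" where
  "bounded_variation_on I f \<longleftrightarrow>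
     (\<exists>M. \<forall>(x :: nat \<Rightarrow> real) n.
        (\<forall>i\<le>n. x i \<in> I) \<and> (\<forall>i<n. x i < x (Suc i)) \<longrightarrow>
        (\<Sum>i<n. \<bar>f (x (Suc i)) - f (x i)\<bar>) \<le> M)"

text \<open>\<open>BV(a,b)\<close> consists of classes modulo null sets: \<open>f\<close> has finite essential variation, that is,
  some representative has finite pointwise variation. (Such a representative is bounded, so
  integrability on the bounded interval is automatic.)\<close>

definition BV_fun :: "real \<Rightarrow> real \<Rightarrow> (real \<Rightarrow> real) \<Rightarrow> bool" where
  "BV_fun a b f \<longleftrightarrow>
     (\<exists>g. bounded_variation_on {a<..<b} g \<and> (AE x in lebesgue_on {a<..<b}. f x = g x))"

text \<open>The value of a \<open>BV\<close> function at the left endpoint \<open>c\<close> is its one-sided limit from the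
  right. Since the function is only given almost everywhere, this is the essential limit; it
  is the ordinary one-sided limit of any representative of finite pointwise variation.\<close>

definition left_endpoint_value :: "real \<Rightarrow> (real \<Rightarrow> real) \<Rightarrow> real" where
  "left_endpoint_value c f =
     (THE l. \<forall>e>0. \<exists>d>0. AE x in lebesgue. c < x \<and> x < c + d \<longrightarrow> \<bar>f x - l\<bar> < e)"


section \<open>Finite-energy solutions of the wave equation\<close>

text \<open>A function \<open>\<psi>(x,t)\<close> is represented by the curve \<open>\<psi> :: t \<mapsto> \<psi>(\<cdot>,t)\<close>, so its time argument
  comes first.\<close>

definition has_time_deriv ::
  "real \<Rightarrow> real \<Rightarrow> (real \<Rightarrow> real \<Rightarrow> real) \<Rightarrow> real \<Rightarrow> (real \<Rightarrow> real) \<Rightarrow> bool" where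
  "has_time_deriv L T \<psi> t v \<longleftrightarrow>
     L2_fun 0 L v \<and>
     ((\<lambda>r. L2_norm 0 L (\<lambda>x. (\<psi> r x - \<psi> t x) / (r - t) - v x)) \<longlongrightarrow> 0) (at t within {0..T})"

definition time_deriv ::
  "real \<Rightarrow> real \<Rightarrow> (real \<Rightarrow> real \<Rightarrow> real) \<Rightarrow> real \<Rightarrow> real \<Rightarrow> real" where
  "time_deriv L T \<psi> t = (SOME v. has_time_deriv L T \<psi> t v)"

text \<open>\<open>(\<psi>, \<psi>\<^sub>t) \<in> C([0,T]; H\<^sup>1(0,L) \<times> L\<^sup>2(0,L))\<close>, where \<open>\<psi>\<^sub>t\<close> is the derivative of \<open>\<psi>\<close> as an
  \<open>L\<^sup>2(0,L)\<close>-valued function.\<close>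

definition finite_energy :: "real \<Rightarrow> real \<Rightarrow> (real \<Rightarrow> real \<Rightarrow> real) \<Rightarrow> bool" where
  "finite_energy L T \<psi> \<longleftrightarrow>
     (\<forall>t\<in>{0..T}. H1_fun 0 L (\<psi> t)) \<and>
     (\<forall>t\<in>{0..T}. ((\<lambda>r. H1_norm 0 L (\<lambda>x. \<psi> r x - \<psi> t x)) \<longlongrightarrow> 0) (at t within {0..T})) \<and>
     (\<forall>t\<in>{0..T}. has_time_deriv L T \<psi> t (time_deriv L T \<psi> t)) \<and>
     (\<forall>t\<in>{0..T}. ((\<lambda>r. L2_norm 0 L (\<lambda>x. time_deriv L T \<psi> r x - time_deriv L T \<psi> t x))
                    \<longlongrightarrow> 0) (at t within {0..T}))"

text \<open>The bilinear form obtained from \<open>\<rho> \<psi>\<^sub>t\<^sub>t - (a \<psi>\<^sub>x)\<^sub>x\<close> tested against \<open>w(x) \<theta>(t)\<close>, with one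
  integration by parts in each variable and no boundary terms:
  \<open>\<integral>\<^sub>0\<^sup>T \<integral>\<^sub>0\<^sup>L (a \<psi>\<^sub>x w\<^sub>x \<theta> - \<rho> \<psi>\<^sub>t w \<theta>') dx dt\<close>.\<close>

definition wave_form ::
  "real \<Rightarrow> real \<Rightarrow> (real \<Rightarrow> real) \<Rightarrow> (real \<Rightarrow> real) \<Rightarrow> (real \<Rightarrow> real \<Rightarrow> real) \<Rightarrow>
   (real \<Rightarrow> real) \<Rightarrow> (real \<Rightarrow> real) \<Rightarrow> (real \<Rightarrow> real) \<Rightarrow> real" where
  "wave_form L T \<rho> a \<psi> w \<theta> \<theta>' =
     (\<integral>t. (\<integral>x. a x * weak_deriv 0 L (\<psi> t) x * weak_deriv 0 L w x \<partial>lebesgue_on {0<..<L}) * \<theta> t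
        - (\<integral>x. \<rho> x * time_deriv L T \<psi> t x * w x \<partial>lebesgue_on {0<..<L}) * \<theta>' t
      \<partial>lebesgue_on {0<..<T})"

text \<open>\<open>\<rho> \<psi>\<^sub>t\<^sub>t - (a \<psi>\<^sub>x)\<^sub>x = 0\<close> weakly: for every \<open>w \<in> H\<^sup>1\<^sub>0(0,L)\<close>,
  \<open>d/dt (\<rho> \<psi>\<^sub>t, w) + (a \<psi>\<^sub>x, w\<^sub>x) = 0\<close> in the sense of distributions on \<open>(0,T)\<close>.\<close>

definition weak_wave_equation ::
  "real \<Rightarrow> real \<Rightarrow> (real \<Rightarrow> real) \<Rightarrow> (real \<Rightarrow> real) \<Rightarrow> (real \<Rightarrow> real \<Rightarrow> real) \<Rightarrow> bool" where
  "weak_wave_equation L T \<rho> a \<psi> \<longleftrightarrow>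
     (\<forall>w \<theta> \<theta>'. H1_fun 0 L w \<and> w 0 = 0 \<and> w L = 0 \<and> C1c_fun 0 T \<theta> \<theta>' \<longrightarrow>
        wave_form L T \<rho> a \<psi> w \<theta> \<theta>' = 0)"

definition finite_energy_solution ::
  "real \<Rightarrow> real \<Rightarrow> (real \<Rightarrow> real) \<Rightarrow> (real \<Rightarrow> real) \<Rightarrow> (real \<Rightarrow> real) \<Rightarrow>
   (real \<Rightarrow> real \<Rightarrow> real) \<Rightarrow> bool" where
  "finite_energy_solution L T \<rho> a s \<psi> \<longleftrightarrow>
     finite_energy L T \<psi> \<and>
     weak_wave_equation L T \<rho> a \<psi> \<and>
     (\<forall>x\<in>{0<..<L}. \<psi> T x = 0) \<and>
     (AE x in lebesgue_on {0<..<L}. time_deriv L T \<psi> T x = 0) \<and>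
     (\<forall>t\<in>{0<..<T}. \<psi> t 0 = 0 \<and> \<psi> t L = s t)"

text \<open>\<open>q \<in> L\<^sup>2(0,T)\<close> is the trace \<open>(a \<psi>\<^sub>x)(0,\<cdot>)\<close> of the flux of a weak solution. As \<open>a \<psi>\<^sub>x\<close> has
  no pointwise values, the trace is defined by Green's formula: test functions \<open>w \<theta>\<close> with
  \<open>w(L) = 0\<close> but \<open>w(0)\<close> arbitrary leave the boundary term \<open>- \<integral>\<^sub>0\<^sup>T (a \<psi>\<^sub>x)(0,t) w(0) \<theta>(t) dt\<close>.
  This determines \<open>q\<close> almost everywhere.\<close>

definition is_flux_trace ::
  "real \<Rightarrow> real \<Rightarrow> (real \<Rightarrow> real) \<Rightarrow> (real \<Rightarrow> real) \<Rightarrow> (real \<Rightarrow> real \<Rightarrow> real) \<Rightarrow>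
   (real \<Rightarrow> real) \<Rightarrow> bool" where
  "is_flux_trace L T \<rho> a \<psi> q \<longleftrightarrow>
     L2_fun 0 T q \<and>
     (\<forall>w \<theta> \<theta>'. H1_fun 0 L w \<and> w L = 0 \<and> C1c_fun 0 T \<theta> \<theta>' \<longrightarrow>
        wave_form L T \<rho> a \<psi> w \<theta> \<theta>' = - w 0 * (\<integral>t. q t * \<theta> t \<partial>lebesgue_on {0<..<T}))"

text \<open>\<open>g\<close> is the boundary trace \<open>\<psi>\<^sub>x(0,\<cdot>) = (a \<psi>\<^sub>x)(0,\<cdot>) / a(0)\<close>.\<close>

definition is_boundary_trace ::
  "real \<Rightarrow> real \<Rightarrow> (real \<Rightarrow> real) \<Rightarrow> (real \<Rightarrow> real) \<Rightarrow> (real \<Rightarrow> real \<Rightarrow> real) \<Rightarrow>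
   (real \<Rightarrow> real) \<Rightarrow> bool" where
  "is_boundary_trace L T \<rho> a \<psi> g \<longleftrightarrow>
     (\<exists>q. is_flux_trace L T \<rho> a \<psi> q \<and> g = (\<lambda>t. q t / left_endpoint_value 0 a))"

definition max_slowness :: "real \<Rightarrow> (real \<Rightarrow> real) \<Rightarrow> (real \<Rightarrow> real) \<Rightarrow> real" where
  "max_slowness L \<rho> a =
     real_of_ereal (esssup (lebesgue_on {0..L}) (\<lambda>x. ereal (sqrt (\<rho> x / a x))))"

end

theory Submission
  imports Defs
begin

text \<open>Read the equation as an evolution in \<open>x\<close>. With \<open>\<alpha> = 1 / a\<close>, velocity \<open>v = \<psi>\<^sub>t\<close> and flux
  \<open>p = a \<psi>\<^sub>x\<close> it becomes \<open>v\<^sub>x = \<alpha> p\<^sub>t\<close>, \<open>p\<^sub>x = \<rho> v\<^sub>t\<close>. The energy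
  \<open>E(x) = \<integral> (\<rho> v\<^sup>2 + \<alpha> p\<^sup>2) / 2 dt\<close> over \<open>t \<ge> \<beta> x\<close> gets nonpositive boundary terms, since the
  solution vanishes at time \<open>T\<close> and \<open>\<rho> \<alpha> \<le> \<beta>\<^sup>2\<close>; the variation of the coefficients only costs
  a Gronwall factor, so \<open>E(L) \<le> K E(0)\<close>. As \<open>v = 0\<close> at \<open>x = 0\<close> and \<open>v = s'\<close> at \<open>x = L\<close>, this is
  the claim up to a Poincare inequality for \<open>s\<^sub>0\<close>.

  The regularity needed is gained by integrating in time: antiderivatives of a finite-energy
  solution solve the system classically, with continuous fields. The estimate is applied to
  their iterated difference quotients, which are averages of the original data, and Fatou's lemma
  removes the increments. Since \<open>\<rho>\<close> and \<open>\<alpha>\<close> only have bounded variation, the Gronwall argument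
  runs over finite partitions of \<open>[0, L]\<close> instead of differentiating \<open>E\<close>.\<close>

text \<open>The fields of the classical system are integrated twice: v becomes a primitive of \<psi>
  in time, p a double primitive of a \<psi>_x. Two integrations are what it takes: v_t is then
  \<psi> itself, continuous by Sobolev embedding, and p_t at x is the integral of \<rho> \<psi>_t
  over [0, x] plus a primitive of the boundary flux. Accordingly two increments, h and k, lead back.
  At x = 0 both are absorbed at once, since p there is a double primitive of the flux trace. At x =
  L the limit in h is classical, as v has the time derivative \<psi>, while the limit in k holds
  only almost everywhere, as s_0 is merely in H1.

  Since the final state is zero, everything extends by zero to t \<ge> T; this makes room for the
  forward shifts by h, k and \<beta> x.

  The energy is compared at single points x, where an almost everywhere inequality says nothing. The
  coefficients are therefore replaced by representatives that obey all bounds, the one on \<rho>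
  \<alpha> included, at every point.\<close>

section \<open>Gronwall steps over partitions\<close>

text \<open>The error of one step is its length times \<open>C\<close> times the increment of
  \<open>W\<close>, plus its length times \<open>e\<close>. On a uniform partition of mesh h the
  first kind adds up to h C (W b - W a), apart from the exponential factor, and this tends to 0 with
  h however \<open>W\<close> jumps.\<close>

lemma discrete_gronwall:
  fixes E W :: "real \<Rightarrow> real"
  assumes ab: "a \<le> b" and W: "mono W" and "0 \<le> \<kappa>" "0 \<le> C"
    and E0: "\<And>x. x \<in> {a..b} \<Longrightarrow> 0 \<le> E x"
    and step: "\<And>e. 0 < e \<Longrightarrow> \<exists>d>0. \<forall>x y. a \<le> x \<longrightarrow> x < y \<longrightarrow> y \<le> b \<longrightarrow> y - x < d \<longrightarrow>
                 E y \<le> (1 + \<kappa> * (W y - W x)) * E x + (y - x) * (C * (W y - W x) + e)"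
  shows "E b \<le> exp (\<kappa> * (W b - W a)) * E a"
proof (cases "a = b")
  case False
  then have ab': "a < b" using ab by simp
  define X where "X = exp (\<kappa> * (W b - W a))"
  have "E b \<le> X * E a + \<epsilon>" if "0 < \<epsilon>" for \<epsilon>
  proof -
    \<comment> \<open>Chosen so that the \<open>e\<close> terms, amplified by \<open>X\<close>, add
      up to exactly \<epsilon> / 2.\<close>
    define e where "e = \<epsilon> / 2 / (X * (b - a))"
    have Xpos: "X > 0" by (simp add: X_def)
    have e: "e > 0" using that ab' Xpos by (simp add: e_def)
    obtain d where d: "d > 0" "\<And>x y. \<lbrakk>a \<le> x; x < y; y \<le> b; y - x < d\<rbrakk> \<Longrightarrow>
                 E y \<le> (1 + \<kappa> * (W y - W x)) * E x + (y - x) * (C * (W y - W x) + e)"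
      using step[OF e] by blast
    \<comment> \<open>With this \<open>Z\<close>, a mesh with \<open>h * Z \<le> 1\<close> keeps the
      amplified jump terms below \<epsilon> / 2.\<close>
    define Z where "Z = 2 * X * C * (W b - W a) / \<epsilon>"
    have Wab: "W a \<le> W b" using W ab by (simp add: mono_def)
    have Z0: "Z \<ge> 0" using Wab Xpos that \<open>0 \<le> C\<close> by (simp add: Z_def)
    obtain n :: nat where n: "real n > (b - a) / d + Z * (b - a) + 1"
      using reals_Archimedean2 by blast
    have n0: "real n > 0"
      using n Z0 ab' d(1) by (smt (verit) divide_nonneg_pos mult_nonneg_nonneg)
    define h where "h = (b - a) / n"
    have h: "h > 0" using n0 ab' by (simp add: h_def)
    have hd: "h < d"
    proof -
      have "(b - a) / d < n" using n Z0 ab' by (smt (verit) mult_nonneg_nonneg)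
      then show ?thesis using n0 d(1) by (simp add: h_def field_simps)
    qed
    have hZ: "h * Z \<le> 1"
    proof -
      have "Z * (b - a) < n" using n d(1) ab' by (smt (verit) divide_nonneg_pos)
      then show ?thesis using n0 by (simp add: h_def field_simps)
    qed
    define x where "x i = a + real i * h" for i
    have xn: "x n = b" using n0 by (simp add: x_def h_def)
    have xb: "x i \<in> {a..b}" if "i \<le> n" for i
    proof -
      have "real i * h \<le> real n * h" using that h by (intro mult_right_mono) auto
      then have "x i \<le> x n" by (simp add: x_def)
      moreover have "a \<le> x i" using h by (simp add: x_def)
      ultimately show ?thesis using xn by simp
    qed
    \<comment> \<open>The exponential is pulled in front of all accumulated errors; this is harmless
      because it is at least 1.\<close>
    have main: "E (x i) \<le> exp (\<kappa> * (W (x i) - W a)) * (E a + h * C * (W (x i) - W a) + real i * h * e)"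
      if "i \<le> n" for i using that
    proof (induction i)
      case 0
      then show ?case by (simp add: x_def)
    next
      case (Suc i)
      define w where "w = W (x (Suc i)) - W (x i)"
      define u where "u = W (x i) - W a"
      define R where "R = E a + h * C * u + real i * h * e"
      have w0: "w \<ge> 0" using W h by (simp add: w_def mono_def x_def algebra_simps)
      have u0: "u \<ge> 0" using W h by (simp add: u_def mono_def x_def)
      have R0: "R \<ge> 0" using E0[of a] ab h u0 \<open>0 \<le> C\<close> e by (simp add: R_def)
      have IH: "E (x i) \<le> exp (\<kappa> * u) * R" using Suc by (simp add: u_def R_def)
      have diff: "x (Suc i) - x i = h" by (simp add: x_def algebra_simps)
      have "E (x (Suc i)) \<le> (1 + \<kappa> * w) * E (x i) + h * (C * w + e)"
        using d(2)[of "x i" "x (Suc i)"] xb[of i] xb[of "Suc i"] Suc.prems diff h hd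
        by (simp add: w_def)
      also have "\<dots> \<le> exp (\<kappa> * w) * (exp (\<kappa> * u) * R) + h * (C * w + e)"
        using IH exp_ge_add_one_self[of "\<kappa> * w"] E0[of "x i"] xb[of i] Suc.prems
        by (intro add_mono mult_mono order_refl) auto
      also have "h * (C * w + e) \<le> exp (\<kappa> * (w + u)) * (h * (C * w + e))"
      proof -
        have "1 \<le> exp (\<kappa> * (w + u))" using w0 u0 \<open>0 \<le> \<kappa>\<close> by simp
        moreover have "0 \<le> h * (C * w + e)" using h w0 \<open>0 \<le> C\<close> e by simp
        ultimately show ?thesis by (metis mult_1 mult_right_mono)
      qed
      finally have "E (x (Suc i)) \<le> exp (\<kappa> * (w + u)) * (R + h * (C * w + e))"
        by (simp add: algebra_simps exp_add)
      then show ?case by (simp add: R_def w_def u_def algebra_simps)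
    qed
    have "E b \<le> X * (E a + h * C * (W b - W a) + real n * h * e)"
      using main[of n] xn by (simp add: X_def)
    also have "\<dots> = X * E a + X * C * (W b - W a) * h + X * (b - a) * e"
      using n0 by (simp add: h_def field_simps)
    also have "X * (b - a) * e = \<epsilon> / 2"
    proof -
      have "X * (b - a) \<noteq> 0" using Xpos ab' by simp
      then show ?thesis by (metis e_def mult.commute nonzero_eq_divide_eq)
    qed
    also have "X * C * (W b - W a) * h \<le> \<epsilon> / 2"
    proof -
      have "X * C * (W b - W a) * h = h * Z * (\<epsilon> / 2)" using that by (simp add: Z_def)
      also have "\<dots> \<le> 1 * (\<epsilon> / 2)" using hZ that by (intro mult_right_mono) auto
      finally show ?thesis by simp
    qed
    finally show ?thesis by simp
  qed
  then show ?thesis using field_le_epsilon X_def by blast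
qed simp

text \<open>Write V1 = V + k X + y and expand the square. The term w V^2 / 2 is kept apart because
  it becomes the Gronwall factor; in every other error a coefficient change w comes multiplied by
  the step length k, the form that \<open>discrete_gronwall\<close> tolerates.\<close>

lemma quadratic_step:
  fixes r r1 V V1 X k \<eta> D w A M e :: real
  assumes "\<bar>r1 - r\<bar> \<le> w" "\<bar>r\<bar> \<le> A" "\<bar>r1\<bar> \<le> A" "\<bar>V\<bar> \<le> M" "\<bar>V1 - V - k * X\<bar> \<le> k * \<eta>"
    "\<bar>X\<bar> \<le> D" "\<eta> \<le> D" "0 \<le> k" "k \<le> e"
  shows "r1 * V1\<^sup>2 / 2 \<le> r * V\<^sup>2 / 2 + w * V\<^sup>2 / 2 + k * (r * V * X)
           + k * (2 * M * D * w + A * M * \<eta> + 2 * A * D\<^sup>2 * e)"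
proof -
  define d where "d = V1 - V"
  define y where "y = d - k * X"
  have D0: "0 \<le> D" and A0: "0 \<le> A" and M0: "0 \<le> M" and w0: "0 \<le> w" using assms by auto
  have "k * \<bar>X\<bar> \<le> k * D" "k * \<eta> \<le> k * D" using assms by (auto intro: mult_left_mono)
  moreover have "\<bar>k * X\<bar> = k * \<bar>X\<bar>" using assms by (simp add: abs_mult)
  ultimately have d: "\<bar>d\<bar> \<le> 2 * (k * D)" using assms unfolding d_def by linarith
  have y: "\<bar>y\<bar> \<le> k * \<eta>" using assms by (simp add: y_def d_def)
  have t1: "(r1 - r) * V\<^sup>2 \<le> w * V\<^sup>2" using assms by (intro mult_right_mono) auto
  have t2: "(r1 - r) * V * d \<le> w * M * (2 * (k * D))"
  proof -
    have "\<bar>(r1 - r) * V * d\<bar> \<le> w * M * (2 * (k * D))"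
      unfolding abs_mult using assms d w0 M0 by (intro mult_mono) auto
    then show ?thesis by linarith
  qed
  have t3: "r1 * d\<^sup>2 \<le> A * (4 * (k * e) * D\<^sup>2)"
  proof -
    have "d\<^sup>2 \<le> (2 * (k * D))\<^sup>2" using d by (metis abs_ge_zero power2_abs power_mono)
    also have "\<dots> = 4 * (k * k) * D\<^sup>2" by (simp add: power2_eq_square)
    also have "\<dots> \<le> 4 * (k * e) * D\<^sup>2" using assms by (intro mult_right_mono mult_left_mono) auto
    finally have d2: "d\<^sup>2 \<le> 4 * (k * e) * D\<^sup>2" .
    have "r1 * d\<^sup>2 \<le> A * d\<^sup>2" using assms by (intro mult_right_mono) auto
    also have "\<dots> \<le> A * (4 * (k * e) * D\<^sup>2)" using d2 A0 by (intro mult_left_mono)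
    finally show ?thesis .
  qed
  have t4: "r * V * y \<le> A * M * (k * \<eta>)"
  proof -
    have "\<bar>r * V * y\<bar> \<le> A * M * (k * \<eta>)"
      unfolding abs_mult using assms y A0 M0 by (intro mult_mono) auto
    then show ?thesis by linarith
  qed
  have "r1 * V1\<^sup>2 = r * V\<^sup>2 + (r1 - r) * V\<^sup>2 + 2 * ((r1 - r) * V * d) + r1 * d\<^sup>2 + 2 * (r * V * y)
      + 2 * (k * (r * V * X))"
    by (simp add: d_def y_def power2_eq_square algebra_simps)
  then show ?thesis using t1 t2 t3 t4 by (simp add: algebra_simps)
qed

text \<open>With the geometric mean c of r and a in place of \<beta>, the form is c / 2 times a
  square; enlarging c to \<beta> adds something nonnegative. The form is the energy crossing the
  line t = \<beta> x.\<close>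

lemma boundary_form_nonneg:
  fixes r a V P \<beta> :: real
  assumes "0 \<le> r" "0 \<le> a" "0 \<le> \<beta>" "r * a \<le> \<beta>\<^sup>2"
  shows "0 \<le> r * a * (V * P) + \<beta> / 2 * (r * V\<^sup>2 + a * P\<^sup>2)"
proof -
  define c where "c = sqrt (r * a)"
  have c: "0 \<le> c" "c \<le> \<beta>" "c * c = r * a"
    using assms by (auto simp: c_def real_le_lsqrt)
  have "0 \<le> (sqrt r * V + sqrt a * P)\<^sup>2" by simp
  also have "\<dots> = r * V\<^sup>2 + a * P\<^sup>2 + 2 * c * (V * P)"
    using assms by (simp add: power2_sum power_mult_distrib c_def real_sqrt_mult algebra_simps)
  finally have 1: "0 \<le> c / 2 * (r * V\<^sup>2 + a * P\<^sup>2 + 2 * c * (V * P))" using c by simp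
  have "c / 2 * (r * V\<^sup>2 + a * P\<^sup>2) \<le> \<beta> / 2 * (r * V\<^sup>2 + a * P\<^sup>2)"
    using assms c by (intro mult_right_mono) auto
  then show ?thesis using 1 c(3) by (simp add: algebra_simps)
qed

text \<open>The move along the slanted line is split at the corner (x, \<tau> + \<beta> y). The leg
  in time uses the mean value theorem; the leg in space uses only the integral identity, since f
  need not be differentiable in x where c jumps.\<close>

lemma characteristic_step:
  fixes f f' g :: "real \<Rightarrow> real \<Rightarrow> real" and c :: "real \<Rightarrow> real"
  assumes xy: "x < y" and \<tau>: "0 \<le> \<tau>" and \<beta>: "0 \<le> \<beta>" and x0: "0 \<le> x"
    and der: "\<And>t. 0 \<le> t \<Longrightarrow> (f x has_real_derivative f' x t) (at t within {0..})"
    and int: "((\<lambda>\<xi>. c \<xi> * g \<xi> (\<tau> + \<beta> * y)) has_integral (f y (\<tau> + \<beta> * y) - f x (\<tau> + \<beta> * y))) {x..y}"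
    and c: "\<And>\<xi>. \<xi> \<in> {x..y} \<Longrightarrow> \<bar>c \<xi> - c x\<bar> \<le> w" "\<bar>c x\<bar> \<le> A"
    and g: "\<And>\<xi>. \<xi> \<in> {x..y} \<Longrightarrow> \<bar>g \<xi> (\<tau> + \<beta> * y)\<bar> \<le> M"
           "\<And>\<xi>. \<xi> \<in> {x..y} \<Longrightarrow> \<bar>g \<xi> (\<tau> + \<beta> * y) - g x (\<tau> + \<beta> * x)\<bar> \<le> e"
    and f': "\<And>t. t \<in> {\<tau> + \<beta> * x..\<tau> + \<beta> * y} \<Longrightarrow> \<bar>f' x t - f' x (\<tau> + \<beta> * x)\<bar> \<le> e"
  shows "\<bar>f y (\<tau> + \<beta> * y) - f x (\<tau> + \<beta> * x)
            - (y - x) * (c x * g x (\<tau> + \<beta> * x) + \<beta> * f' x (\<tau> + \<beta> * x))\<bar>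
         \<le> (y - x) * (M * w + (A + \<beta>) * e)"
proof -
  let ?s = "\<tau> + \<beta> * y" and ?t = "\<tau> + \<beta> * x"
  have A0: "0 \<le> A" using c by linarith
  have e0: "0 \<le> e" using g(2)[of x] xy by auto
  have M0: "0 \<le> M" using g(1)[of x] xy by auto
  have w0: "0 \<le> w" using c(1)[of x] xy by auto
  have "((\<lambda>\<xi>. c \<xi> * g \<xi> ?s - c x * g x ?t) has_integral
         (f y ?s - f x ?s - (y - x) * (c x * g x ?t))) {x..y}"
    using has_integral_diff[OF int has_integral_const_real[of "c x * g x ?t" x y]] xy by simp
  then have i1: "\<bar>f y ?s - f x ?s - (y - x) * (c x * g x ?t)\<bar> \<le> (M * w + A * e) * (y - x)"
  proof -
    assume i: "((\<lambda>\<xi>. c \<xi> * g \<xi> ?s - c x * g x ?t) has_integral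
         (f y ?s - f x ?s - (y - x) * (c x * g x ?t))) {x..y}"
    have "norm (f y ?s - f x ?s - (y - x) * (c x * g x ?t)) \<le> (M * w + A * e) * measure lborel {x..y}"
    proof (rule has_integral_bound_real[OF _ finite.emptyI i])
      show "0 \<le> M * w + A * e" using A0 e0 M0 w0 by simp
      fix \<xi> assume "\<xi> \<in> {x..y} - {}"
      then have \<xi>: "\<xi> \<in> {x..y}" by simp
      have "c \<xi> * g \<xi> ?s - c x * g x ?t = (c \<xi> - c x) * g \<xi> ?s + c x * (g \<xi> ?s - g x ?t)"
        by (simp add: algebra_simps)
      also have "norm \<dots> \<le> \<bar>(c \<xi> - c x) * g \<xi> ?s\<bar> + \<bar>c x * (g \<xi> ?s - g x ?t)\<bar>"
        by (simp add: abs_triangle_ineq)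
      also have "\<dots> \<le> w * M + A * e"
        unfolding abs_mult using c g \<xi> w0 A0 by (intro add_mono mult_mono) auto
      finally show "norm (c \<xi> * g \<xi> ?s - c x * g x ?t) \<le> M * w + A * e" by (simp add: mult.commute)
    qed
    then show ?thesis using xy by simp
  qed
  have i2: "\<bar>f x ?s - f x ?t - (y - x) * (\<beta> * f' x ?t)\<bar> \<le> (y - x) * (\<beta> * e)"
  proof (cases "\<beta> = 0")
    case False
    then have lt: "?t < ?s" using xy \<beta> by simp
    have t0: "0 \<le> ?t" using \<tau> \<beta> x0 by simp
    have "\<exists>z\<in>{?t<..<?s}. f x ?s - f x ?t = f' x z * (?s - ?t)"
    proof (rule mvt_simple[OF lt, of _ "\<lambda>z. (*) (f' x z)"])
      fix z assume "?t \<le> z" "z \<le> ?s"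
      then have "(f x has_real_derivative f' x z) (at z within {?t..?s})"
        using t0 by (intro DERIV_subset[OF der]) auto
      then show "(f x has_derivative (*) (f' x z)) (at z within {?t..?s})"
        by (simp add: has_field_derivative_def)
    qed
    then obtain z where z: "z \<in> {?t<..<?s}" "f x ?s - f x ?t = f' x z * (?s - ?t)" by blast
    have "f x ?s - f x ?t - (y - x) * (\<beta> * f' x ?t) = (y - x) * (\<beta> * (f' x z - f' x ?t))"
      unfolding z(2) by (simp add: algebra_simps)
    also have "\<bar>\<dots>\<bar> \<le> (y - x) * (\<beta> * e)"
      unfolding abs_mult using xy \<beta> f'[of z] z by (intro mult_mono) auto
    finally show ?thesis .
  qed simp
  show ?thesis using i1 i2 by (simp add: algebra_simps) 
qed

section \<open>The sidewise energy estimate\<close>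

lemma continuous_strip_bounded:
  fixes f :: "real \<Rightarrow> real \<Rightarrow> real"
  assumes "continuous_on ({0..L} \<times> {0..}) (\<lambda>z. f (fst z) (snd z))"
  obtains M where "0 \<le> M" "\<And>x t. \<lbrakk>x \<in> {0..L}; t \<in> {0..R}\<rbrakk> \<Longrightarrow> \<bar>f x t\<bar> \<le> M"
proof -
  have "compact ((\<lambda>z. f (fst z) (snd z)) ` ({0..L} \<times> {0..R}))"
    by (intro compact_continuous_image continuous_on_subset[OF assms] compact_Times) auto
  then have "bounded ((\<lambda>z. f (fst z) (snd z)) ` ({0..L} \<times> {0..R}))"
    by (rule compact_imp_bounded)
  then obtain M where M: "0 < M" "\<forall>y\<in>(\<lambda>z. f (fst z) (snd z)) ` ({0..L} \<times> {0..R}). norm y \<le> M"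
    unfolding bounded_pos by blast
  show thesis
  proof (rule that[of M])
    fix x t assume "x \<in> {0..L}" "t \<in> {0..R}"
    then show "\<bar>f x t\<bar> \<le> M" using M(2)[rule_format, of "f x t"] by force
  qed (use M in simp)
qed

lemma continuous_strip_uniform:
  fixes f :: "real \<Rightarrow> real \<Rightarrow> real"
  assumes "continuous_on ({0..L} \<times> {0..}) (\<lambda>z. f (fst z) (snd z))" and "0 < e"
  obtains d where "0 < d"
    "\<And>x y t s. \<lbrakk>x \<in> {0..L}; y \<in> {0..L}; t \<in> {0..R}; s \<in> {0..R}; \<bar>y - x\<bar> < d; \<bar>s - t\<bar> < d\<rbrakk>
      \<Longrightarrow> \<bar>f y s - f x t\<bar> \<le> e"
proof -
  have "uniformly_continuous_on ({0..L} \<times> {0..R}) (\<lambda>z. f (fst z) (snd z))"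
    by (intro compact_uniformly_continuous continuous_on_subset[OF assms(1)] compact_Times) auto
  then obtain d where d: "d > 0"
    "\<And>z z'. \<lbrakk>z \<in> {0..L} \<times> {0..R}; z' \<in> {0..L} \<times> {0..R}; dist z' z < d\<rbrakk>
       \<Longrightarrow> dist (f (fst z') (snd z')) (f (fst z) (snd z)) < e"
    unfolding uniformly_continuous_on_def using \<open>0 < e\<close> by metis
  show thesis
  proof (rule that[of "d / 2"])
    fix x y t s assume a: "x \<in> {0..L}" "y \<in> {0..L}" "t \<in> {0..R}" "s \<in> {0..R}"
      "\<bar>y - x\<bar> < d / 2" "\<bar>s - t\<bar> < d / 2"
    have "dist (y, s) (x, t) \<le> \<bar>y - x\<bar> + \<bar>s - t\<bar>"
      by (simp add: dist_Pair_Pair dist_real_def) (metis sqrt_sum_squares_le_sum_abs power2_abs)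
    then have "dist (y, s) (x, t) < d" using a by linarith
    then show "\<bar>f y s - f x t\<bar> \<le> e"
      using d(2)[of "(x, t)" "(y, s)"] a by (simp add: dist_real_def)
  qed (use d in auto)
qed

text \<open>The equations v_x = \<alpha> p_t and p_x = \<rho> v_t are stated as integrals from 0
  because the coefficients may jump; the first also encodes v = 0 at x = 0. Time is the whole half
  line, so that shifted times \<tau> + \<beta> x and forward difference quotients never leave the
  domain.\<close>

locale sidewise_system =
  fixes L T :: real and \<alpha> \<rho> :: "real \<Rightarrow> real" and v v' p p' :: "real \<Rightarrow> real \<Rightarrow> real"
  assumes L: "0 < L" and T: "0 < T"
    and cont: "continuous_on ({0..L} \<times> {0..}) (\<lambda>z. v (fst z) (snd z))"
      "continuous_on ({0..L} \<times> {0..}) (\<lambda>z. v' (fst z) (snd z))"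
      "continuous_on ({0..L} \<times> {0..}) (\<lambda>z. p (fst z) (snd z))"
      "continuous_on ({0..L} \<times> {0..}) (\<lambda>z. p' (fst z) (snd z))"
    and vanish: "\<And>x t. \<lbrakk>x \<in> {0..L}; T \<le> t\<rbrakk> \<Longrightarrow> v x t = 0"
      "\<And>x t. \<lbrakk>x \<in> {0..L}; T \<le> t\<rbrakk> \<Longrightarrow> p x t = 0"
    and deriv: "\<And>x t. \<lbrakk>x \<in> {0..L}; 0 \<le> t\<rbrakk> \<Longrightarrow> (v x has_real_derivative v' x t) (at t within {0..})"
      "\<And>x t. \<lbrakk>x \<in> {0..L}; 0 \<le> t\<rbrakk> \<Longrightarrow> (p x has_real_derivative p' x t) (at t within {0..})"
    and int: "\<And>x t. \<lbrakk>x \<in> {0..L}; 0 \<le> t\<rbrakk> \<Longrightarrow> ((\<lambda>\<xi>. \<alpha> \<xi> * p' \<xi> t) has_integral v x t) {0..x}"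
      "\<And>x t. \<lbrakk>x \<in> {0..L}; 0 \<le> t\<rbrakk> \<Longrightarrow> ((\<lambda>\<xi>. \<rho> \<xi> * v' \<xi> t) has_integral (p x t - p 0 t)) {0..x}"
begin

lemma int_between:
  assumes "0 \<le> x" "x < y" "y \<le> L" "0 \<le> t"
  shows "((\<lambda>\<xi>. \<alpha> \<xi> * p' \<xi> t) has_integral (v y t - v x t)) {x..y}"
    "((\<lambda>\<xi>. \<rho> \<xi> * v' \<xi> t) has_integral (p y t - p x t)) {x..y}"
proof -
  have gen: "(f has_integral (b - a)) {x..y}"
    if "(f has_integral a) {0..x}" "(f has_integral b) {0..y}" for f :: "real \<Rightarrow> real" and a b
  proof -
    have "f integrable_on {x..y}"
      by (rule integrable_on_subinterval[OF has_integral_integrable[OF that(2)]]) (use assms in auto)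
    moreover have "integral {0..x} f + integral {x..y} f = integral {0..y} f"
      using assms that(2) by (intro Henstock_Kurzweil_Integration.integral_combine) auto
    ultimately show ?thesis
      using that by (simp add: has_integral_iff)
  qed
  show "((\<lambda>\<xi>. \<alpha> \<xi> * p' \<xi> t) has_integral (v y t - v x t)) {x..y}"
    using assms by (intro gen int) auto
  show "((\<lambda>\<xi>. \<rho> \<xi> * v' \<xi> t) has_integral (p y t - p x t)) {x..y}"
    using gen[OF int(2)[of x t] int(2)[of y t]] assms by auto
qed

lemma continuous_on_shift:
  fixes f :: "real \<Rightarrow> real \<Rightarrow> real"
  assumes "continuous_on ({0..L} \<times> {0..}) (\<lambda>z. f (fst z) (snd z))" "x \<in> {0..L}" "0 \<le> c" "S \<subseteq> {0..}"
  shows "continuous_on S (\<lambda>\<tau>. f x (\<tau> + c))"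
proof -
  have c: "continuous_on S (\<lambda>\<tau>. (x, \<tau> + c))" by (intro continuous_intros)
  have "continuous_on S (\<lambda>\<tau>. (\<lambda>z. f (fst z) (snd z)) (x, \<tau> + c))"
    by (rule continuous_on_compose2[OF assms(1) c]) (use assms(2-4) in force)
  then show ?thesis by simp
qed

text \<open>Along t = \<tau> + \<beta> x, and apart from the variation of the coefficients, the
  x-derivative of the energy density is a total derivative in \<tau>, with vanishing boundary value
  at T and a favourable sign at 0. A change w of the coefficients alters the density by at most the
  fraction w / m, whence 1 / m in the exponent; A / m compares weighted and plain norms at the two
  ends.\<close>

lemma energy_estimate:
  fixes W :: "real \<Rightarrow> real" and \<beta> m A :: real
  assumes W: "mono W"
    and bv: "\<And>x y. x \<le> y \<Longrightarrow> \<bar>\<alpha> y - \<alpha> x\<bar> \<le> W y - W x" "\<And>x y. x \<le> y \<Longrightarrow> \<bar>\<rho> y - \<rho> x\<bar> \<le> W y - W x"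
    and m: "0 < m" and \<alpha>: "\<And>x. m \<le> \<alpha> x" "\<And>x. \<alpha> x \<le> A" and \<rho>: "\<And>x. m \<le> \<rho> x" "\<And>x. \<rho> x \<le> A"
    and \<beta>: "0 \<le> \<beta>" and slow: "\<And>x. \<rho> x * \<alpha> x \<le> \<beta>\<^sup>2"
  shows "integral {0..T} (\<lambda>\<tau>. (v L (\<tau> + \<beta> * L))\<^sup>2)
         \<le> A / m * exp ((W L - W 0) / m) * integral {0..T} (\<lambda>\<tau>. (p 0 \<tau>)\<^sup>2)"
proof -
  define V where "V x \<tau> = v x (\<tau> + \<beta> * x)" for x \<tau>
  define P where "P x \<tau> = p x (\<tau> + \<beta> * x)" for x \<tau>
  define V' where "V' x \<tau> = v' x (\<tau> + \<beta> * x)" for x \<tau>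
  define P' where "P' x \<tau> = p' x (\<tau> + \<beta> * x)" for x \<tau>
  define E where "E x = integral {0..T} (\<lambda>\<tau>. \<rho> x * (V x \<tau>)\<^sup>2 / 2 + \<alpha> x * (P x \<tau>)\<^sup>2 / 2)" for x
  \<comment> \<open>The largest time met: \<tau> + \<beta> x with \<tau> \<le> T and x \<le>
    L.\<close>
  define R where "R = T + \<beta> * L"
  have cV: "continuous_on {0..T} (V x)" "continuous_on {0..T} (P x)"
    "continuous_on {0..T} (V' x)" "continuous_on {0..T} (P' x)" if "x \<in> {0..L}" for x
    using that \<beta> unfolding V_def P_def V'_def P'_def by (auto intro!: continuous_on_shift cont)
  have pos: "0 < \<alpha> x" "0 < \<rho> x" for x using m \<alpha>(1)[of x] \<rho>(1)[of x] by auto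
  have A0: "0 < A" using pos(1)[of 0] \<alpha>(2)[of 0] by linarith
  obtain M1 where M1: "0 \<le> M1" "\<And>x t. \<lbrakk>x \<in> {0..L}; t \<in> {0..R}\<rbrakk> \<Longrightarrow> \<bar>v x t\<bar> \<le> M1"
    using continuous_strip_bounded[OF cont(1), where R = R] by blast
  obtain M2 where M2: "0 \<le> M2" "\<And>x t. \<lbrakk>x \<in> {0..L}; t \<in> {0..R}\<rbrakk> \<Longrightarrow> \<bar>v' x t\<bar> \<le> M2"
    using continuous_strip_bounded[OF cont(2), where R = R] by blast
  obtain M3 where M3: "0 \<le> M3" "\<And>x t. \<lbrakk>x \<in> {0..L}; t \<in> {0..R}\<rbrakk> \<Longrightarrow> \<bar>p x t\<bar> \<le> M3"
    using continuous_strip_bounded[OF cont(3), where R = R] by blast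
  obtain M4 where M4: "0 \<le> M4" "\<And>x t. \<lbrakk>x \<in> {0..L}; t \<in> {0..R}\<rbrakk> \<Longrightarrow> \<bar>p' x t\<bar> \<le> M4"
    using continuous_strip_bounded[OF cont(4), where R = R] by blast
  define M where "M = M1 + M2 + M3 + M4"
  have M0: "0 \<le> M" using M1 M2 M3 M4 by (simp add: M_def)
  have M: "\<bar>v x t\<bar> \<le> M" "\<bar>v' x t\<bar> \<le> M" "\<bar>p x t\<bar> \<le> M" "\<bar>p' x t\<bar> \<le> M"
    if "x \<in> {0..L}" "t \<in> {0..R}" for x t
    using M1(1) M2(1) M3(1) M4(1) M1(2)[OF that] M2(2)[OF that] M3(2)[OF that] M4(2)[OF that]
    unfolding M_def by linarith+
  define w0 where "w0 = W L - W 0"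
  have w0: "0 \<le> w0" using W L by (simp add: w0_def mono_def)
  \<comment> \<open>The first two summands bound the slopes such as \<alpha> P' + \<beta> V', the
    others bound the error \<eta>, because w \<le> w0 and e \<le> 1. \<open>C\<close> and
    \<open>C2\<close> collect the parts of \<open>2 * T * B\<close> proportional to w and to
    e.\<close>
  define D where "D = A * M + \<beta> * M + M * w0 + (A + \<beta>)"
  define C where "C = 2 * T * (2 * M * D + A * M * M)"
  define C2 where "C2 = 2 * T * (A * M * (A + \<beta>) + 2 * A * D\<^sup>2)"
  have D0: "0 \<le> D" using A0 M0 w0 \<beta> by (simp add: D_def)
  have C0: "0 \<le> C" using A0 M0 D0 T by (simp add: C_def)
  have C20: "0 \<le> C2" using A0 M0 D0 T \<beta> by (simp add: C2_def)
  have Eint: "(\<lambda>\<tau>. \<rho> x * (V x \<tau>)\<^sup>2 / 2 + \<alpha> x * (P x \<tau>)\<^sup>2 / 2) integrable_on {0..T}"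
    if "x \<in> {0..L}" for x
    using cV[OF that] by (intro integrable_continuous_real continuous_intros) auto
  have E0: "0 \<le> E x" if "x \<in> {0..L}" for x
    unfolding E_def using pos[of x] by (intro Henstock_Kurzweil_Integration.integral_nonneg Eint that) auto
  have "E L \<le> exp (1 / m * (W L - W 0)) * E 0"
  proof (rule discrete_gronwall[OF _ W _ C0])
    fix e0 :: real assume e0: "0 < e0"
    define e where "e = min 1 (e0 / (C2 + 1))"
    have e: "0 < e" "e \<le> 1" using e0 C20 by (auto simp: e_def)
    have eC: "C2 * e \<le> e0"
    proof -
      have "C2 * e \<le> (C2 + 1) * (e0 / (C2 + 1))"
        using C20 e by (intro mult_mono) (auto simp: e_def)
      then show ?thesis using C20 by simp
    qed
    obtain d1 where d1: "0 < d1"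
      "\<And>x y t s. \<lbrakk>x \<in> {0..L}; y \<in> {0..L}; t \<in> {0..R}; s \<in> {0..R}; \<bar>y - x\<bar> < d1; \<bar>s - t\<bar> < d1\<rbrakk>
      \<Longrightarrow> \<bar>v' y s - v' x t\<bar> \<le> e"
      using continuous_strip_uniform[OF cont(2) e(1), where R = R] by blast
    obtain d2 where d2: "0 < d2"
      "\<And>x y t s. \<lbrakk>x \<in> {0..L}; y \<in> {0..L}; t \<in> {0..R}; s \<in> {0..R}; \<bar>y - x\<bar> < d2; \<bar>s - t\<bar> < d2\<rbrakk>
      \<Longrightarrow> \<bar>p' y s - p' x t\<bar> \<le> e"
      using continuous_strip_uniform[OF cont(4) e(1), where R = R] by blast
    \<comment> \<open>Dividing by \<beta> + 1 controls the time shift \<beta> (y - x) along with y -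
      x; the bound by \<open>e\<close> makes the terms quadratic in the step small.\<close>
    define d where "d = min (min d1 d2 / (\<beta> + 1)) e"
    have d0: "0 < d" using d1 d2 e \<beta> by (simp add: d_def)
    have dd: "k < d1 \<and> k < d2 \<and> \<beta> * k < d1 \<and> \<beta> * k < d2 \<and> k < e" if "0 < k" "k < d" for k
    proof -
      have "k < min d1 d2 / (\<beta> + 1)" using that by (simp add: d_def)
      then have "(\<beta> + 1) * k < min d1 d2" using \<beta> by (simp add: field_simps)
      moreover have "0 \<le> \<beta> * k" using \<beta> that by simp
      ultimately show ?thesis using that by (auto simp: algebra_simps d_def)
    qed
    show "\<exists>d>0. \<forall>x y. 0 \<le> x \<longrightarrow> x < y \<longrightarrow> y \<le> L \<longrightarrow> y - x < d \<longrightarrow>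
                 E y \<le> (1 + 1 / m * (W y - W x)) * E x + (y - x) * (C * (W y - W x) + e0)"
    proof (intro exI[of _ d] conjI d0 allI impI)
      fix x y assume xy: "0 \<le> x" "x < y" "y \<le> L" "y - x < d"
      define k where "k = y - x"
      define w where "w = W y - W x"
      define \<eta> where "\<eta> = M * w + (A + \<beta>) * e"
      define B where "B = 2 * M * D * w + A * M * \<eta> + 2 * A * D\<^sup>2 * e"
      have k: "0 < k" "k < d" using xy by (auto simp: k_def)
      note kd = dd[OF k]
      have xL: "x \<in> {0..L}" "y \<in> {0..L}" using xy by auto
      have w: "0 \<le> w" "w \<le> w0"
        using W xy by (auto simp: w_def w0_def mono_def intro!: diff_mono)
      have \<eta>D: "\<eta> \<le> D"
      proof -
        have "M * w \<le> M * w0" using w M0 by (intro mult_left_mono)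
        moreover have "(A + \<beta>) * e \<le> (A + \<beta>) * 1" using e A0 \<beta> by (intro mult_left_mono) auto
        moreover have "0 \<le> A * M + \<beta> * M" using A0 M0 \<beta> by simp
        ultimately show ?thesis by (simp add: \<eta>_def D_def)
      qed
      have bx: "\<beta> * x \<le> \<beta> * y" "\<beta> * y \<le> \<beta> * L" "0 \<le> \<beta> * x" "\<beta> * y - \<beta> * x = \<beta> * k"
        using xy \<beta> by (auto intro!: mult_left_mono) (simp add: k_def algebra_simps)
      have osc: "\<bar>\<alpha> \<xi> - \<alpha> x\<bar> \<le> w" "\<bar>\<rho> \<xi> - \<rho> x\<bar> \<le> w" if "\<xi> \<in> {x..y}" for \<xi>
        using bv(1)[of x \<xi>] bv(2)[of x \<xi>] that monoD[OF W, of \<xi> y] by (auto simp: w_def)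
      have absA: "\<bar>\<alpha> z\<bar> \<le> A" "\<bar>\<rho> z\<bar> \<le> A" for z
        using pos[of z] \<alpha>(2)[of z] \<rho>(2)[of z] by auto
      define G where "G \<tau> = \<rho> x * V x \<tau> * (\<alpha> x * P' x \<tau> + \<beta> * V' x \<tau>)
          + \<alpha> x * P x \<tau> * (\<rho> x * V' x \<tau> + \<beta> * P' x \<tau>)" for \<tau>
      \<comment> \<open>\<open>F\<close> is an antiderivative of \<open>G\<close> in \<tau>: the
        mixed terms of \<open>G\<close> are the product rule for V P.\<close>
      define F where "F \<tau> = \<rho> x * \<alpha> x * (V x \<tau> * P x \<tau>) + \<beta> / 2 * (\<rho> x * (V x \<tau>)\<^sup>2 + \<alpha> x * (P x \<tau>)\<^sup>2)" for \<tau>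
      have pointwise: "\<rho> y * (V y \<tau>)\<^sup>2 / 2 + \<alpha> y * (P y \<tau>)\<^sup>2 / 2
          \<le> (\<rho> x * (V x \<tau>)\<^sup>2 / 2 + \<alpha> x * (P x \<tau>)\<^sup>2 / 2)
            + w / m * (\<rho> x * (V x \<tau>)\<^sup>2 / 2 + \<alpha> x * (P x \<tau>)\<^sup>2 / 2) + k * G \<tau> + k * (2 * B)"
        if \<tau>: "\<tau> \<in> {0..T}" for \<tau>
      proof -
        have tR: "\<tau> + \<beta> * x \<in> {0..R}" "\<tau> + \<beta> * y \<in> {0..R}"
          using \<tau> bx by (auto simp: R_def)
        have mid: "\<bar>z - (\<tau> + \<beta> * x)\<bar> < d1" "\<bar>z - (\<tau> + \<beta> * x)\<bar> < d2" "z \<in> {0..R}"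
          if "z \<in> {\<tau> + \<beta> * x..\<tau> + \<beta> * y}" for z
          using that kd bx tR by auto
        have sV: "\<bar>V y \<tau> - V x \<tau> - k * (\<alpha> x * P' x \<tau> + \<beta> * V' x \<tau>)\<bar> \<le> k * \<eta>"
          unfolding V_def P'_def V'_def k_def \<eta>_def
        proof (rule characteristic_step[OF xy(2) _ \<beta> xy(1)])
          show "0 \<le> \<tau>" using \<tau> by simp
          show "((\<lambda>\<xi>. \<alpha> \<xi> * p' \<xi> (\<tau> + \<beta> * y)) has_integral v y (\<tau> + \<beta> * y) - v x (\<tau> + \<beta> * y)) {x..y}"
            using xy tR by (intro int_between) auto
          show "\<bar>p' \<xi> (\<tau> + \<beta> * y) - p' x (\<tau> + \<beta> * x)\<bar> \<le> e" if "\<xi> \<in> {x..y}" for \<xi>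
            using that xy kd bx tR by (intro d2(2)) (auto simp: k_def)
          show "\<bar>v' x t - v' x (\<tau> + \<beta> * x)\<bar> \<le> e" if "t \<in> {\<tau> + \<beta> * x..\<tau> + \<beta> * y}" for t
            using that xL d1(1) tR mid[OF that] by (intro d1(2)) auto
        qed (use xL osc absA M tR deriv in auto)
        have sP: "\<bar>P y \<tau> - P x \<tau> - k * (\<rho> x * V' x \<tau> + \<beta> * P' x \<tau>)\<bar> \<le> k * \<eta>"
          unfolding P_def P'_def V'_def k_def \<eta>_def
        proof (rule characteristic_step[OF xy(2) _ \<beta> xy(1)])
          show "0 \<le> \<tau>" using \<tau> by simp
          show "((\<lambda>\<xi>. \<rho> \<xi> * v' \<xi> (\<tau> + \<beta> * y)) has_integral p y (\<tau> + \<beta> * y) - p x (\<tau> + \<beta> * y)) {x..y}"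
            using xy tR by (intro int_between) auto
          show "\<bar>v' \<xi> (\<tau> + \<beta> * y) - v' x (\<tau> + \<beta> * x)\<bar> \<le> e" if "\<xi> \<in> {x..y}" for \<xi>
            using that xy kd bx tR by (intro d1(2)) (auto simp: k_def)
          show "\<bar>p' x t - p' x (\<tau> + \<beta> * x)\<bar> \<le> e" if "t \<in> {\<tau> + \<beta> * x..\<tau> + \<beta> * y}" for t
            using that xL d2(1) tR mid[OF that] by (intro d2(2)) auto
        qed (use xL osc absA M tR deriv in auto)
        have bd: "\<bar>a * X + \<beta> * Y\<bar> \<le> D" if "\<bar>a\<bar> \<le> A" "\<bar>X\<bar> \<le> M" "\<bar>Y\<bar> \<le> M" for a X Y
        proof -
          have "\<bar>a * X + \<beta> * Y\<bar> \<le> \<bar>a\<bar> * \<bar>X\<bar> + \<beta> * \<bar>Y\<bar>"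
            using \<beta> by (metis abs_mult abs_of_nonneg abs_triangle_ineq)
          also have "\<dots> \<le> A * M + \<beta> * M" using that \<beta> A0 by (intro add_mono mult_mono) auto
          also have "\<dots> \<le> D" using M0 w0 A0 \<beta> by (simp add: D_def)
          finally show ?thesis .
        qed
        have "\<rho> y * (V y \<tau>)\<^sup>2 / 2 \<le> \<rho> x * (V x \<tau>)\<^sup>2 / 2 + w * (V x \<tau>)\<^sup>2 / 2
             + k * (\<rho> x * V x \<tau> * (\<alpha> x * P' x \<tau> + \<beta> * V' x \<tau>)) + k * B"
          unfolding B_def
          by (rule quadratic_step[OF _ _ _ _ sV _ \<eta>D])
             (use osc[of y] absA xy k kd M xL tR bd in \<open>auto simp: V_def P'_def V'_def\<close>)
        moreover have "\<alpha> y * (P y \<tau>)\<^sup>2 / 2 \<le> \<alpha> x * (P x \<tau>)\<^sup>2 / 2 + w * (P x \<tau>)\<^sup>2 / 2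
             + k * (\<alpha> x * P x \<tau> * (\<rho> x * V' x \<tau> + \<beta> * P' x \<tau>)) + k * B"
          unfolding B_def
          by (rule quadratic_step[OF _ _ _ _ sP _ \<eta>D])
             (use osc[of y] absA xy k kd M xL tR bd in \<open>auto simp: P_def P'_def V'_def\<close>)
        moreover have "w * z\<^sup>2 / 2 \<le> w / m * (c * z\<^sup>2 / 2)" if "m \<le> c" for z c
        proof -
          have "w * z\<^sup>2 / 2 = w / m * (m * z\<^sup>2 / 2)" using m by simp
          also have "\<dots> \<le> w / m * (c * z\<^sup>2 / 2)"
            using that w m by (intro mult_left_mono divide_right_mono mult_right_mono) auto
          finally show ?thesis .
        qed
        note this[OF \<rho>(1)[of x], of "V x \<tau>"] this[OF \<alpha>(1)[of x], of "P x \<tau>"]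
        ultimately show ?thesis unfolding G_def distrib_left[of "w / m"] distrib_left[of k] by linarith
      qed
      have dV: "(V x has_real_derivative V' x \<tau>) (at \<tau> within {0..T})"
        and dP: "(P x has_real_derivative P' x \<tau>) (at \<tau> within {0..T})" if "\<tau> \<in> {0..T}" for \<tau>
      proof -
        have gen: "((\<lambda>\<tau>. f (\<tau> + \<beta> * x)) has_real_derivative f' (\<tau> + \<beta> * x)) (at \<tau> within {0..T})"
          if f: "\<And>t. 0 \<le> t \<Longrightarrow> (f has_real_derivative f' t) (at t within {0..})" for f f' :: "real \<Rightarrow> real"
        proof -
          have "(f \<circ> (\<lambda>\<tau>. \<tau> + \<beta> * x) has_real_derivative f' (\<tau> + \<beta> * x) * 1) (at \<tau> within {0..T})"
          proof (rule DERIV_image_chain)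
            show "(f has_real_derivative f' (\<tau> + \<beta> * x)) (at (\<tau> + \<beta> * x) within (\<lambda>\<tau>. \<tau> + \<beta> * x) ` {0..T})"
              using \<open>\<tau> \<in> {0..T}\<close> bx by (intro DERIV_subset[OF f]) auto
          qed (auto intro!: derivative_eq_intros)
          then show ?thesis by (simp add: o_def)
        qed
        show "(V x has_real_derivative V' x \<tau>) (at \<tau> within {0..T})"
          unfolding V_def V'_def using xL by (intro gen deriv)
        show "(P x has_real_derivative P' x \<tau>) (at \<tau> within {0..T})"
          unfolding P_def P'_def using xL by (intro gen deriv)
      qed
      have "(G has_integral (F T - F 0)) {0..T}"
      proof (rule fundamental_theorem_of_calculus)
        fix \<tau> assume \<tau>: "\<tau> \<in> {0..T}"
        show "(F has_vector_derivative G \<tau>) (at \<tau> within {0..T})"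
          unfolding has_real_derivative_iff_has_vector_derivative[symmetric] F_def G_def
          by (rule derivative_eq_intros refl dV[OF \<tau>] dP[OF \<tau>])+ (simp add: algebra_simps power2_eq_square)
      qed (use T in simp)
      moreover have "F T = 0"
        using xL \<beta> vanish[of x "T + \<beta> * x"] by (simp add: F_def V_def P_def)
      \<comment> \<open>Here the slope \<beta> of the lines is weighed against the
        coefficients.\<close>
      moreover have "0 \<le> F 0"
        unfolding F_def using pos[of x] slow \<beta> by (intro boundary_form_nonneg) auto
      ultimately have G: "G integrable_on {0..T}" "integral {0..T} G \<le> 0"
        by (auto simp: has_integral_iff)
      have cB: "((\<lambda>\<tau>. k * (2 * B)) has_integral ((T - 0) *\<^sub>R (k * (2 * B)))) {0..T}"
        using has_integral_const_real[of "k * (2 * B)" 0 T] T by simp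
      have "((\<lambda>\<tau>. (\<rho> x * (V x \<tau>)\<^sup>2 / 2 + \<alpha> x * (P x \<tau>)\<^sup>2 / 2)
            + w / m * (\<rho> x * (V x \<tau>)\<^sup>2 / 2 + \<alpha> x * (P x \<tau>)\<^sup>2 / 2) + k * G \<tau> + k * (2 * B))
          has_integral (E x + w / m * E x + k * integral {0..T} G + (T - 0) *\<^sub>R (k * (2 * B)))) {0..T}"
        unfolding E_def using Eint[OF xL(1)] G(1) T
        by (intro has_integral_add has_integral_mult_right integrable_integral cB) auto
      then have "E y \<le> E x + w / m * E x + k * integral {0..T} G + (T - 0) *\<^sub>R (k * (2 * B))"
        unfolding E_def[of y] using pointwise
        by (intro has_integral_le[OF integrable_integral[OF Eint[OF xL(2)]]])
      then have "E y \<le> E x + w / m * E x + k * integral {0..T} G + k * (2 * B) * T"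
        by (simp add: mult.commute)
      also have "\<dots> \<le> (1 + 1 / m * w) * E x + k * (2 * B) * T"
        using G(2) k by (simp add: algebra_simps mult_nonneg_nonpos)
      also have "k * (2 * B) * T = k * (C * w + C2 * e)"
        by (simp add: B_def C_def C2_def \<eta>_def algebra_simps)
      also have "\<dots> \<le> k * (C * w + e0)" using k eC by (intro mult_left_mono) auto
      finally show "E y \<le> (1 + 1 / m * (W y - W x)) * E x + (y - x) * (C * (W y - W x) + e0)"
        by (simp add: k_def w_def)
    qed
  qed (use L m E0 in auto)
  \<comment> \<open>At x = 0 the velocity vanishes and only the flux is left in the energy.\<close>
  moreover have "E 0 \<le> A / 2 * integral {0..T} (\<lambda>\<tau>. (p 0 \<tau>)\<^sup>2)"
  proof -
    have v0: "v 0 t = 0" if "0 \<le> t" for t using int(1)[of 0 t] L that by (simp add: has_integral_iff)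
    have i: "(\<lambda>\<tau>. (p 0 \<tau>)\<^sup>2) integrable_on {0..T}"
      using cV(2)[of 0] L by (intro integrable_continuous_real continuous_intros) (auto simp: P_def)
    have "E 0 \<le> integral {0..T} (\<lambda>\<tau>. A / 2 * (p 0 \<tau>)\<^sup>2)"
      unfolding E_def using L v0 \<alpha>(2)[of 0]
      by (intro integral_le Eint integrable_on_mult_right i) (auto simp: V_def P_def intro!: mult_right_mono divide_right_mono)
    then show ?thesis by simp
  qed
  moreover have "m / 2 * integral {0..T} (\<lambda>\<tau>. (v L (\<tau> + \<beta> * L))\<^sup>2) \<le> E L"
  proof -
    have i: "(\<lambda>\<tau>. (v L (\<tau> + \<beta> * L))\<^sup>2) integrable_on {0..T}"
      using cV(1)[of L] L by (intro integrable_continuous_real continuous_intros) (auto simp: V_def)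
    have "integral {0..T} (\<lambda>\<tau>. m / 2 * (v L (\<tau> + \<beta> * L))\<^sup>2) \<le> E L"
      unfolding E_def
    proof (intro integral_le Eint integrable_on_mult_right i)
      fix \<tau> assume "\<tau> \<in> {0..T}"
      have "m * (V L \<tau>)\<^sup>2 \<le> \<rho> L * (V L \<tau>)\<^sup>2" using \<rho> by (intro mult_right_mono) auto
      moreover have "0 \<le> \<alpha> L * (P L \<tau>)\<^sup>2" using pos[of L] by simp
      ultimately show "m / 2 * (v L (\<tau> + \<beta> * L))\<^sup>2 \<le> \<rho> L * (V L \<tau>)\<^sup>2 / 2 + \<alpha> L * (P L \<tau>)\<^sup>2 / 2"
        by (simp add: V_def)
    qed (use L in auto)
    then show ?thesis by simp
  qed
  ultimately have "m / 2 * integral {0..T} (\<lambda>\<tau>. (v L (\<tau> + \<beta> * L))\<^sup>2)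
      \<le> exp (1 / m * (W L - W 0)) * (A / 2 * integral {0..T} (\<lambda>\<tau>. (p 0 \<tau>)\<^sup>2))"
    using mult_left_mono[OF _ exp_ge_zero, of "E 0" "A / 2 * integral {0..T} (\<lambda>\<tau>. (p 0 \<tau>)\<^sup>2)"
        "1 / m * (W L - W 0)"] by linarith
  also have "\<dots> = m / 2 * (A / m * exp ((W L - W 0) / m) * integral {0..T} (\<lambda>\<tau>. (p 0 \<tau>)\<^sup>2))"
    using m by simp
  finally show ?thesis by (rule mult_left_le_imp_le) (use m in simp)
qed

end

section \<open>Difference quotients\<close>

definition diff_quot :: "real \<Rightarrow> (real \<Rightarrow> real) \<Rightarrow> real \<Rightarrow> real" where
  "diff_quot h f t = (f (t + h) - f t) / h"

text \<open>Cauchy-Schwarz against a constant, obtained by integrating (g - c)^2 with c the mean of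
  g; this stays within gauge integrals.\<close>

lemma integral_square_bound:
  fixes g :: "real \<Rightarrow> real"
  assumes "a < b" "(g has_integral I) {a..b}" "(\<lambda>x. (g x)\<^sup>2) integrable_on {a..b}"
  shows "I\<^sup>2 \<le> (b - a) * integral {a..b} (\<lambda>x. (g x)\<^sup>2)"
proof -
  define c where "c = I / (b - a)"
  have "((\<lambda>x. (g x)\<^sup>2 - 2 * c * g x + c\<^sup>2) has_integral
      (integral {a..b} (\<lambda>x. (g x)\<^sup>2) - 2 * c * I + (b - a) * c\<^sup>2)) {a..b}"
    using has_integral_add[OF has_integral_diff[OF integrable_integral[OF assms(3)]
        has_integral_mult_right[OF assms(2), of "2 * c"]] has_integral_const_real[of "c\<^sup>2" a b]] assms(1)
    by simp
  then have "0 \<le> integral {a..b} (\<lambda>x. (g x)\<^sup>2) - 2 * c * I + (b - a) * c\<^sup>2"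
  proof (rule has_integral_nonneg)
    fix x
    have "(g x)\<^sup>2 - 2 * c * g x + c\<^sup>2 = (g x - c)\<^sup>2" by (simp add: power2_eq_square algebra_simps)
    then show "0 \<le> (g x)\<^sup>2 - 2 * c * g x + c\<^sup>2" by simp
  qed
  moreover have "(b - a) * c = I" using assms(1) by (simp add: c_def)
  then have "2 * c * I = 2 * I\<^sup>2 / (b - a)" "(b - a) * c\<^sup>2 = I\<^sup>2 / (b - a)"
    using assms(1) by (auto simp: c_def power2_eq_square)
  ultimately have "I\<^sup>2 / (b - a) \<le> integral {a..b} (\<lambda>x. (g x)\<^sup>2)" by simp
  then show ?thesis using assms(1) by (simp add: field_simps)
qed

text \<open>By Cauchy-Schwarz the squared quotient at t is at most the increment over [t, t + h] of
  the cumulated energy \<open>G\<close>, divided by h. Integrating in t telescopes through a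
  primitive \<open>H\<close> of \<open>G\<close> and leaves the mean of \<open>G\<close> over
  [T, T + h] minus its mean over [0, h], hence at most \<open>G T\<close>. No exchange of integrals
  occurs.\<close>

lemma diff_quot_L2_bound:
  fixes P g :: "real \<Rightarrow> real"
  assumes T: "0 \<le> T" and h: "0 < h" and P: "continuous_on {0..} P"
    and int: "\<And>t s. \<lbrakk>0 \<le> t; t \<le> s\<rbrakk> \<Longrightarrow> (g has_integral (P s - P t)) {t..s}"
    and g2: "(\<lambda>t. (g t)\<^sup>2) integrable_on {0..T}" and zero: "\<And>t. T < t \<Longrightarrow> g t = 0"
  shows "integral {0..T} (\<lambda>t. (diff_quot h P t)\<^sup>2) \<le> integral {0..T} (\<lambda>t. (g t)\<^sup>2)"
proof -
  define G where "G t = integral {0..t} (\<lambda>t. (g t)\<^sup>2)" for t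
  have zint: "((\<lambda>t. (g t)\<^sup>2) has_integral 0) {T..s}" for s
    using zero by (intro has_integral_spike_finite[of "{T}" _ _ "\<lambda>_. 0" 0 for s, simplified]) auto
  have g2i: "(\<lambda>t. (g t)\<^sup>2) integrable_on {0..s}" if "T \<le> s" for s
    using T that zint[of s] g2 by (intro Henstock_Kurzweil_Integration.integrable_combine[of 0 T s]) auto
  have g2s: "(\<lambda>t. (g t)\<^sup>2) integrable_on {t..s}" if "0 \<le> t" for t s
    by (rule integrable_on_subinterval[OF g2i[of "max T s"]]) (use that in auto)
  have Gcomb: "G t + integral {t..s} (\<lambda>t. (g t)\<^sup>2) = G s" if "0 \<le> t" "t \<le> s" for t s
    unfolding G_def using that g2s by (intro Henstock_Kurzweil_Integration.integral_combine) auto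
  have G0: "0 \<le> integral {t..s} (\<lambda>t. (g t)\<^sup>2)" if "0 \<le> t" for t s
    using g2s[OF that] by (intro Henstock_Kurzweil_Integration.integral_nonneg) auto
  have Gmono: "G t \<le> G s" if "0 \<le> t" "t \<le> s" for t s
    using Gcomb[OF that] G0[of t s] that by linarith
  have GT: "G t \<le> G T" for t
  proof (cases "t \<le> T")
    case True
    then show ?thesis
      using Gmono[of t T] G0[of 0 T] by (cases "0 \<le> t") (auto simp: G_def)
  next
    case False
    then show ?thesis using Gcomb[of T t] T zint[of t] by (simp add: has_integral_iff)
  qed
  have Gc: "continuous_on {0..T + 2 * h} G"
    unfolding G_def using g2s by (intro indefinite_integral_continuous_1) auto
  define H where "H t = integral {0..t} G" for t
  have Gi: "G integrable_on {t..s}" if "0 \<le> t" "s \<le> T + 2 * h" for t s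
    using that by (intro integrable_continuous_real continuous_on_subset[OF Gc]) auto
  have Hcomb: "H s = H t + integral {t..s} G" if "0 \<le> t" "t \<le> s" "s \<le> T + 2 * h" for t s
    unfolding H_def using that Gi by (intro Henstock_Kurzweil_Integration.integral_combine[symmetric]) auto
  have dH: "(H has_real_derivative G t) (at t within {0..T + 2 * h})" if "t \<in> {0..T + 2 * h}" for t
    unfolding H_def using that by (intro integral_has_real_derivative[OF Gc]) auto
  have pt: "(diff_quot h P t)\<^sup>2 \<le> (G (t + h) - G t) / h" if "t \<in> {0..T}" for t
  proof -
    have "(P (t + h) - P t)\<^sup>2 \<le> (t + h - t) * integral {t..t + h} (\<lambda>t. (g t)\<^sup>2)"
      using that h g2s int by (intro integral_square_bound) auto
    also have "\<dots> = h * (G (t + h) - G t)" using Gcomb[of t "t + h"] that h by simp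
    finally have "(P (t + h) - P t)\<^sup>2 / h\<^sup>2 \<le> h * (G (t + h) - G t) / h\<^sup>2"
      by (intro divide_right_mono) auto
    then show ?thesis using h by (simp add: diff_quot_def power_divide power2_eq_square)
  qed
  have hi: "((\<lambda>t. (G (t + h) - G t) / h) has_integral ((H (T + h) - H T) / h - (H (0 + h) - H 0) / h)) {0..T}"
  proof (rule fundamental_theorem_of_calculus[OF T])
    fix t assume t: "t \<in> {0..T}"
    have "((H \<circ> (\<lambda>t. t + h)) has_real_derivative G (t + h) * 1) (at t within {0..T})"
    proof (rule DERIV_image_chain)
      show "(H has_real_derivative G (t + h)) (at (t + h) within (\<lambda>t. t + h) ` {0..T})"
        using t h by (intro DERIV_subset[OF dH]) auto
    qed (auto intro!: derivative_eq_intros)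
    moreover have "(H has_real_derivative G t) (at t within {0..T})"
      using t h by (intro DERIV_subset[OF dH]) auto
    ultimately show "((\<lambda>t. (H (t + h) - H t) / h) has_vector_derivative (G (t + h) - G t) / h) (at t within {0..T})"
      unfolding has_real_derivative_iff_has_vector_derivative[symmetric] o_def
      by (intro DERIV_cdivide DERIV_diff) simp_all
  qed
  have "(\<lambda>t. (diff_quot h P t)\<^sup>2) integrable_on {0..T}"
  proof -
    have "continuous_on {0..T} P" by (rule continuous_on_subset[OF P]) auto
    moreover have "continuous_on {0..T} (\<lambda>t. P (t + h))"
      using h by (intro continuous_on_compose2[OF P] continuous_intros) auto
    ultimately show ?thesis
      using h unfolding diff_quot_def by (intro integrable_continuous_real continuous_intros) auto
  qed
  then have "integral {0..T} (\<lambda>t. (diff_quot h P t)\<^sup>2) \<le> (H (T + h) - H T) / h - (H (0 + h) - H 0) / h"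
    using pt hi by (intro has_integral_le[OF integrable_integral hi]) auto
  also have "\<dots> = (integral {T..T + h} G - H h) / h"
    using Hcomb[of T "T + h"] T h by (simp add: H_def diff_divide_distrib)
  also have "\<dots> \<le> (h * G T - 0) / h"
  proof (intro divide_right_mono diff_mono)
    have "integral {T..T + h} G \<le> integral {T..T + h} (\<lambda>_. G T)"
      using Gi[of T "T + h"] T h GT by (intro integral_le) auto
    then show "integral {T..T + h} G \<le> h * G T" using h by simp
    show "0 \<le> H h" unfolding H_def
      using Gi[of 0 h] T h Gmono[of 0] by (intro Henstock_Kurzweil_Integration.integral_nonneg) (auto simp: G_def G0)
  qed (use h in auto)
  finally show ?thesis using h by (simp add: G_def)
qed

context sidewise_system
begin

text \<open>The system is linear, its coefficients do not depend on time, and a forward shift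
  preserves both the half line and the vanishing from T on.\<close>

lemma diff_quot_system:
  assumes h: "0 < h"
  shows "sidewise_system L T \<alpha> \<rho> (\<lambda>x. diff_quot h (v x)) (\<lambda>x. diff_quot h (v' x))
           (\<lambda>x. diff_quot h (p x)) (\<lambda>x. diff_quot h (p' x))"
proof -
  have c: "continuous_on ({0..L} \<times> {0..}) (\<lambda>z. diff_quot h (f (fst z)) (snd z))"
    if f: "continuous_on ({0..L} \<times> {0..}) (\<lambda>z. f (fst z) (snd z))" for f :: "real \<Rightarrow> real \<Rightarrow> real"
  proof -
    have s: "continuous_on ({0..L} \<times> {0..}) (\<lambda>z::real \<times> real. (fst z, snd z + h))"
      by (intro continuous_intros)
    have "continuous_on ({0..L} \<times> {0..}) (\<lambda>z. (\<lambda>z. f (fst z) (snd z)) (fst z, snd z + h))"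
      by (rule continuous_on_compose2[OF f s]) (use h in auto)
    then show ?thesis unfolding diff_quot_def using f h by (intro continuous_intros) auto
  qed
  have d: "(diff_quot h f has_real_derivative diff_quot h f' t) (at t within {0..})"
    if f: "\<And>t. 0 \<le> t \<Longrightarrow> (f has_real_derivative f' t) (at t within {0..})" and t: "0 \<le> t"
    for f f' :: "real \<Rightarrow> real" and t
  proof -
    have "((f \<circ> (\<lambda>t. t + h)) has_real_derivative f' (t + h) * 1) (at t within {0..})"
    proof (rule DERIV_image_chain)
      show "(f has_real_derivative f' (t + h)) (at (t + h) within (\<lambda>t. t + h) ` {0..})"
        using t h by (intro DERIV_subset[OF f]) auto
    qed (auto intro!: derivative_eq_intros)
    then show ?thesis
      unfolding diff_quot_def[abs_def] o_def using f[OF t] by (intro DERIV_cdivide DERIV_diff) simp_all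
  qed
  have i: "((\<lambda>\<xi>. c \<xi> * diff_quot h (g \<xi>) t) has_integral diff_quot h F t) {0..x}"
    if "((\<lambda>\<xi>. c \<xi> * g \<xi> t) has_integral F t) {0..x}" "((\<lambda>\<xi>. c \<xi> * g \<xi> (t + h)) has_integral F (t + h)) {0..x}"
    for c F :: "real \<Rightarrow> real" and g :: "real \<Rightarrow> real \<Rightarrow> real" and t x :: real
    using has_integral_divide[OF has_integral_diff[OF that(2,1)], of h]
    by (simp add: diff_quot_def algebra_simps)
  have "((\<lambda>\<xi>. \<rho> \<xi> * diff_quot h (v' \<xi>) t) has_integral (diff_quot h (p x) t - diff_quot h (p 0) t)) {0..x}"
    if "x \<in> {0..L}" "0 \<le> t" for x t
  proof -
    have "diff_quot h (\<lambda>t. p x t - p 0 t) t = diff_quot h (p x) t - diff_quot h (p 0) t"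
      by (simp add: diff_quot_def flip: diff_divide_distrib)
    then show ?thesis
      using i[of \<rho> v' t "\<lambda>t. p x t - p 0 t" x] int(2)[of x] that h by simp
  qed
  moreover have "diff_quot h (v x) t = 0" "diff_quot h (p x) t = 0" if "x \<in> {0..L}" "T \<le> t" for x t
    using that h by (simp_all add: diff_quot_def vanish)
  ultimately show ?thesis
    by unfold_locales (use L T h in \<open>auto intro!: c cont d deriv i int\<close>)
qed

end

text \<open>Almost everywhere convergence of the quotients is enough for an upper bound, so no
  convergence in L2 has to be shown.\<close>

lemma nn_integral_square_fatou:
  fixes f :: "nat \<Rightarrow> 'a \<Rightarrow> real"
  assumes [measurable]: "\<And>n. f n \<in> borel_measurable M"
    and "AE x in M. (\<lambda>n. f n x) \<longlonglongrightarrow> g x"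
    and "\<And>n. (\<integral>\<^sup>+x. ennreal ((f n x)\<^sup>2) \<partial>M) \<le> B"
  shows "(\<integral>\<^sup>+x. ennreal ((g x)\<^sup>2) \<partial>M) \<le> B"
proof -
  have "(\<integral>\<^sup>+x. ennreal ((g x)\<^sup>2) \<partial>M) = (\<integral>\<^sup>+x. liminf (\<lambda>n. ennreal ((f n x)\<^sup>2)) \<partial>M)"
  proof (rule nn_integral_cong_AE)
    show "AE x in M. ennreal ((g x)\<^sup>2) = liminf (\<lambda>n. ennreal ((f n x)\<^sup>2))"
      using assms(2)
    proof eventually_elim
      case (elim x)
      then have "(\<lambda>n. ennreal ((f n x)\<^sup>2)) \<longlonglongrightarrow> ennreal ((g x)\<^sup>2)"
        by (intro tendsto_ennrealI tendsto_intros)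
      then show ?case by (intro lim_imp_Liminf[symmetric]) simp_all
    qed
  qed
  also have "\<dots> \<le> liminf (\<lambda>n. \<integral>\<^sup>+x. ennreal ((f n x)\<^sup>2) \<partial>M)"
    by (rule nn_integral_liminf) simp
  also have "\<dots> \<le> liminf (\<lambda>n::nat. B)"
    using assms(3) by (intro Liminf_mono always_eventually) auto
  also have "\<dots> = B" by (simp add: Liminf_const)
  finally show ?thesis .
qed

lemma nn_integral_square_continuous:
  fixes f :: "real \<Rightarrow> real"
  assumes "continuous_on {a..b} f"
  shows "(\<integral>\<^sup>+x. ennreal ((f x)\<^sup>2) \<partial>lebesgue_on {a..b}) = ennreal (integral {a..b} (\<lambda>x. (f x)\<^sup>2))"
proof -
  have i: "integrable (lebesgue_on {a..b}) (\<lambda>x. (f x)\<^sup>2)"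
    using assms by (intro continuous_imp_integrable_real continuous_intros)
  show ?thesis
    by (subst nn_integral_eq_integral[OF i]) (simp_all add: lebesgue_integral_eq_integral[OF i])
qed

lemma diff_quot_tendsto:
  assumes "(f has_real_derivative D) (at t within {0..})" "0 \<le> t"
  shows "(\<lambda>n. diff_quot (1 / Suc n) f t) \<longlonglongrightarrow> D"
proof -
  have "((\<lambda>y. (f y - f t) / (y - t)) \<longlongrightarrow> D) (at t within {0..})"
    using assms(1) by (simp add: has_field_derivative_iff)
  moreover have "filterlim (\<lambda>n. t + 1 / Suc n) (at t within {0..}) sequentially"
    unfolding filterlim_at
  proof
    have "(\<lambda>n. t + inverse (real (Suc n))) \<longlonglongrightarrow> t + 0"
      by (intro tendsto_intros LIMSEQ_inverse_real_of_nat)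
    then show "(\<lambda>n. t + 1 / Suc n) \<longlonglongrightarrow> t" by (simp add: inverse_eq_divide)
  qed (use assms(2) in auto)
  ultimately have "(\<lambda>n. (f (t + 1 / Suc n) - f t) / (t + 1 / Suc n - t)) \<longlonglongrightarrow> D"
    by (rule filterlim_compose)
  then show ?thesis by (simp add: diff_quot_def)
qed

context sidewise_system
begin

text \<open>\<open>p 0\<close> is a double primitive of \<open>q\<close>, so its quotients with
  increments h and k have at most the L2 norm of \<open>q\<close>. The energy estimate for the
  doubly differenced system passes this on to x = L, and h tends to 0 classically because
  \<open>v L\<close> is differentiable. The increment k stays: \<open>v' L\<close> will be the
  boundary datum, which has only a weak derivative.\<close>

lemma trace_estimate:
  fixes W q :: "real \<Rightarrow> real" and \<beta> m A k :: real
  assumes W: "mono W"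
    and bv: "\<And>x y. x \<le> y \<Longrightarrow> \<bar>\<alpha> y - \<alpha> x\<bar> \<le> W y - W x" "\<And>x y. x \<le> y \<Longrightarrow> \<bar>\<rho> y - \<rho> x\<bar> \<le> W y - W x"
    and m: "0 < m" and \<alpha>: "\<And>x. m \<le> \<alpha> x" "\<And>x. \<alpha> x \<le> A" and \<rho>: "\<And>x. m \<le> \<rho> x" "\<And>x. \<rho> x \<le> A"
    and \<beta>: "0 \<le> \<beta>" and slow: "\<And>x. \<rho> x * \<alpha> x \<le> \<beta>\<^sup>2" and k: "0 < k"
    and q: "\<And>t s. \<lbrakk>0 \<le> t; t \<le> s\<rbrakk> \<Longrightarrow> (q has_integral (p' 0 s - p' 0 t)) {t..s}"
    and q2: "(\<lambda>t. (q t)\<^sup>2) integrable_on {0..T}" and q0: "\<And>t. T < t \<Longrightarrow> q t = 0"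
    and p'0: "\<And>t. T \<le> t \<Longrightarrow> p' 0 t = 0"
  shows "(\<integral>\<^sup>+t. ennreal ((diff_quot k (v' L) t)\<^sup>2) \<partial>lebesgue_on {\<beta> * L..T})
         \<le> ennreal (A / m * exp ((W L - W 0) / m) * integral {0..T} (\<lambda>t. (q t)\<^sup>2))"
proof -
  define c where "c = \<beta> * L"
  define K where "K = A / m * exp ((W L - W 0) / m)"
  have A0: "0 < A" using m \<alpha>(1)[of 0] \<alpha>(2)[of 0] by linarith
  have K0: "0 \<le> K" using A0 m by (simp add: K_def)
  have c0: "0 \<le> c" using \<beta> L by (simp add: c_def)
  interpret S1: sidewise_system L T \<alpha> \<rho> "\<lambda>x. diff_quot k (v x)" "\<lambda>x. diff_quot k (v' x)"
     "\<lambda>x. diff_quot k (p x)" "\<lambda>x. diff_quot k (p' x)"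
    by (rule diff_quot_system[OF k])
  have cp: "continuous_on {0..} (f 0)"
    if "continuous_on ({0..L} \<times> {0..}) (\<lambda>z. f (fst z) (snd z))" for f :: "real \<Rightarrow> real \<Rightarrow> real"
    using continuous_on_shift[OF that, of 0 0 "{0..}"] L by simp
  have step: "(\<integral>\<^sup>+t. ennreal ((diff_quot h (diff_quot k (v L)) t)\<^sup>2) \<partial>lebesgue_on {c..T})
         \<le> ennreal (K * integral {0..T} (\<lambda>t. (q t)\<^sup>2))" if h: "0 < h" for h
  proof -
    interpret S2: sidewise_system L T \<alpha> \<rho> "\<lambda>x. diff_quot h (diff_quot k (v x))" "\<lambda>x. diff_quot h (diff_quot k (v' x))"
       "\<lambda>x. diff_quot h (diff_quot k (p x))" "\<lambda>x. diff_quot h (diff_quot k (p' x))"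
      by (rule S1.diff_quot_system[OF h])
    let ?F = "diff_quot h (diff_quot k (v L))"
    have cF: "continuous_on {c..T} ?F"
      using S2.continuous_on_shift[OF S2.cont(1), of L 0 "{c..T}"] L c0 by simp
    have cF': "continuous_on S (\<lambda>t. ?F (t + c))" if "S \<subseteq> {0..}" for S
      using S2.continuous_on_shift[OF S2.cont(1), of L c S] L c0 that by simp
    \<comment> \<open>The energy estimate lives on shifted times: c = \<beta> L moves [c, T] to
      [0, T - c], a part of [0, T].\<close>
    have "integral {c..T} (\<lambda>t. (?F t)\<^sup>2) = integral {0..T - c} ((\<lambda>t. (?F t)\<^sup>2) \<circ> (+) c)"
      using integral_shift_Icc_real[of 0 "T - c" "\<lambda>t. (?F t)\<^sup>2" c] by simp
    also have "\<dots> = integral {0..T - c} (\<lambda>t. (?F (t + c))\<^sup>2)" by (simp add: o_def add.commute)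
    also have "\<dots> \<le> integral {0..T} (\<lambda>t. (?F (t + c))\<^sup>2)"
      using c0 by (intro integral_subset_le integrable_continuous_real continuous_intros cF') auto
    also have "\<dots> \<le> K * integral {0..T} (\<lambda>t. (diff_quot h (diff_quot k (p 0)) t)\<^sup>2)"
      unfolding K_def c_def by (rule S2.energy_estimate[OF W bv m \<alpha> \<rho> \<beta> slow])
    also have "integral {0..T} (\<lambda>t. (diff_quot h (diff_quot k (p 0)) t)\<^sup>2)
        \<le> integral {0..T} (\<lambda>t. (diff_quot k (p' 0) t)\<^sup>2)"
    proof (rule diff_quot_L2_bound[OF _ h])
      show "continuous_on {0..} (diff_quot k (p 0))" by (rule cp[OF S1.cont(3)])
      show "(\<lambda>t. (diff_quot k (p' 0) t)\<^sup>2) integrable_on {0..T}"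
        by (intro integrable_continuous_real continuous_intros continuous_on_subset[OF cp[OF S1.cont(4)]]) auto
      show "diff_quot k (p' 0) t = 0" if "T < t" for t
        using that k by (simp add: diff_quot_def p'0)
      show "(diff_quot k (p' 0) has_integral diff_quot k (p 0) s - diff_quot k (p 0) t) {t..s}"
        if "0 \<le> t" "t \<le> s" for t s
        using that L by (intro fundamental_theorem_of_calculus)
          (auto simp: has_real_derivative_iff_has_vector_derivative[symmetric] intro!: DERIV_subset[OF S1.deriv(2)])
    qed (use T in simp)
    also have "\<dots> \<le> integral {0..T} (\<lambda>t. (q t)\<^sup>2)"
      using T by (intro diff_quot_L2_bound[OF _ k cp[OF cont(4)] q q2 q0]) auto
    finally have "integral {c..T} (\<lambda>t. (?F t)\<^sup>2) \<le> K * integral {0..T} (\<lambda>t. (q t)\<^sup>2)"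
      using K0 by (simp add: mult_left_mono)
    then show ?thesis
      by (subst nn_integral_square_continuous[OF cF]) (rule ennreal_leI)
  qed
  have "(\<integral>\<^sup>+t. ennreal ((diff_quot k (v' L) t)\<^sup>2) \<partial>lebesgue_on {c..T})
         \<le> ennreal (K * integral {0..T} (\<lambda>t. (q t)\<^sup>2))"
  proof (rule nn_integral_square_fatou)
    show "(\<integral>\<^sup>+t. ennreal ((diff_quot (1 / Suc n) (diff_quot k (v L)) t)\<^sup>2) \<partial>lebesgue_on {c..T})
         \<le> ennreal (K * integral {0..T} (\<lambda>t. (q t)\<^sup>2))" for n
      by (rule step) simp
    show "AE t in lebesgue_on {c..T}. (\<lambda>n. diff_quot (1 / Suc n) (diff_quot k (v L)) t) \<longlonglongrightarrow> diff_quot k (v' L) t"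
      using L c0 by (intro AE_I2 diff_quot_tendsto S1.deriv) auto
    show "diff_quot (1 / Suc n) (diff_quot k (v L)) \<in> borel_measurable (lebesgue_on {c..T})" for n
    proof -
      interpret S2: sidewise_system L T \<alpha> \<rho> "\<lambda>x. diff_quot (1 / Suc n) (diff_quot k (v x))"
        "\<lambda>x. diff_quot (1 / Suc n) (diff_quot k (v' x))" "\<lambda>x. diff_quot (1 / Suc n) (diff_quot k (p x))"
        "\<lambda>x. diff_quot (1 / Suc n) (diff_quot k (p' x))"
        by (rule S1.diff_quot_system) simp
      show ?thesis
        using S2.continuous_on_shift[OF S2.cont(1), of L 0 "{c..T}"] L c0
        by (intro continuous_imp_measurable_on_sets_lebesgue) auto
    qed
  qed
  then show ?thesis by (simp add: K_def c_def)
qed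

end

section \<open>Lebesgue integrals over open intervals as gauge integrals\<close>

lemma finite_measure_Ioo: "finite_measure (lebesgue_on {a<..<b::real})"
  by (intro finite_measure_lebesgue_on) simp

lemma integrable_Ioo_has_integral:
  fixes f :: "real \<Rightarrow> real"
  assumes "integrable (lebesgue_on {a<..<b}) f"
  shows "(f has_integral (\<integral>x. f x \<partial>lebesgue_on {a<..<b})) {a..b}"
  using has_integral_integral_lebesgue_on[OF assms] by (simp add: has_integral_Icc_iff_Ioo)

lemma integral_Ioo_eq:
  fixes f :: "real \<Rightarrow> real"
  assumes "integrable (lebesgue_on {a<..<b}) f"
  shows "(\<integral>x. f x \<partial>lebesgue_on {a<..<b}) = integral {a..b} f"
  using integrable_Ioo_has_integral[OF assms] by (simp add: has_integral_iff)

lemma integrable_Ioo_subinterval: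
  fixes f :: "real \<Rightarrow> real"
  assumes "integrable (lebesgue_on {a<..<b}) f" "a \<le> x" "y \<le> b"
  shows "f integrable_on {x..y}"
  by (rule integrable_on_subinterval[OF has_integral_integrable[OF integrable_Ioo_has_integral[OF assms(1)]]])
     (use assms in auto)

lemma integrable_Ioo_continuous:
  fixes f :: "real \<Rightarrow> real"
  assumes "continuous_on {a..b} f"
  shows "integrable (lebesgue_on {a<..<b}) f"
proof -
  have "bounded (f ` {a..b})"
    by (intro compact_imp_bounded compact_continuous_image assms) simp
  then obtain C where C: "\<forall>y\<in>f ` {a..b}. norm y \<le> C" unfolding bounded_iff by blast
  show ?thesis
  proof (rule finite_measure.integrable_const_bound[OF finite_measure_Ioo])
    show "AE x in lebesgue_on {a<..<b}. norm (f x) \<le> C" using C by (intro AE_I2) auto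
    show "f \<in> borel_measurable (lebesgue_on {a<..<b})"
      by (intro continuous_imp_measurable_on_sets_lebesgue continuous_on_subset[OF assms]) auto
  qed
qed

lemma integrable_mult_bounded:
  fixes f h :: "'a \<Rightarrow> real"
  assumes f: "integrable M f" and h[measurable]: "h \<in> borel_measurable M"
    and C: "AE x in M. \<bar>h x\<bar> \<le> C"
  shows "integrable M (\<lambda>x. h x * f x)"
proof (rule Bochner_Integration.integrable_bound)
  show "integrable M (\<lambda>x. C * f x)" using f by simp
  show "AE x in M. norm (h x * f x) \<le> norm (C * f x)"
    using C
  proof eventually_elim
    case (elim x)
    then have "\<bar>h x\<bar> * \<bar>f x\<bar> \<le> \<bar>C\<bar> * \<bar>f x\<bar>" by (intro mult_right_mono) auto
    then show ?case by (simp add: abs_mult)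
  qed
  show "(\<lambda>x. h x * f x) \<in> borel_measurable M"
    by (rule borel_measurable_times[OF h borel_measurable_integrable[OF f]])
qed

section \<open>Square-integrable functions\<close>

lemma L2_fun_measurable: "L2_fun a b f \<Longrightarrow> f \<in> borel_measurable (lebesgue_on {a<..<b})"
  by (simp add: L2_fun_def)

lemma L2_fun_integrable: "L2_fun a b f \<Longrightarrow> integrable (lebesgue_on {a<..<b}) f"
  unfolding L2_fun_def by (blast intro: finite_measure.square_integrable_imp_integrable[OF finite_measure_Ioo])

lemma L2_fun_mult_integrable:
  assumes "L2_fun a b f" "L2_fun a b g"
  shows "integrable (lebesgue_on {a<..<b}) (\<lambda>x. f x * g x)"
proof (rule Bochner_Integration.integrable_bound)
  show "integrable (lebesgue_on {a<..<b}) (\<lambda>x. (f x)\<^sup>2 + (g x)\<^sup>2)"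
    using assms by (simp add: L2_fun_def)
  show "AE x in lebesgue_on {a<..<b}. norm (f x * g x) \<le> norm ((f x)\<^sup>2 + (g x)\<^sup>2)"
  proof (rule AE_I2)
    fix x
    have "0 \<le> (\<bar>f x\<bar> - \<bar>g x\<bar>)\<^sup>2" by simp
    then have "2 * (\<bar>f x\<bar> * \<bar>g x\<bar>) \<le> (f x)\<^sup>2 + (g x)\<^sup>2" by (simp add: power2_diff)
    moreover have "0 \<le> \<bar>f x\<bar> * \<bar>g x\<bar>" by simp
    ultimately have "\<bar>f x\<bar> * \<bar>g x\<bar> \<le> (f x)\<^sup>2 + (g x)\<^sup>2" by linarith
    then show "norm (f x * g x) \<le> norm ((f x)\<^sup>2 + (g x)\<^sup>2)" by (simp add: abs_mult)
  qed
  show "(\<lambda>x. f x * g x) \<in> borel_measurable (lebesgue_on {a<..<b})"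
    by (rule borel_measurable_times[OF L2_fun_measurable[OF assms(1)] L2_fun_measurable[OF assms(2)]])
qed

lemma L2_fun_add:
  assumes "L2_fun a b f" "L2_fun a b g"
  shows "L2_fun a b (\<lambda>x. f x + g x)"
proof -
  have "integrable (lebesgue_on {a<..<b}) (\<lambda>x. (f x)\<^sup>2 + (g x)\<^sup>2 + 2 * (f x * g x))"
    using assms L2_fun_mult_integrable[OF assms] by (simp add: L2_fun_def)
  then have "integrable (lebesgue_on {a<..<b}) (\<lambda>x. (f x + g x)\<^sup>2)"
    by (simp add: power2_sum mult.assoc)
  then show ?thesis using assms by (auto simp: L2_fun_def)
qed

lemma L2_fun_cmult: "L2_fun a b f \<Longrightarrow> L2_fun a b (\<lambda>x. c * f x)"
  by (auto simp: L2_fun_def power_mult_distrib)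

lemma L2_fun_diff:
  assumes "L2_fun a b f" "L2_fun a b g"
  shows "L2_fun a b (\<lambda>x. f x - g x)"
  using L2_fun_add[OF assms(1) L2_fun_cmult[OF assms(2), of "-1"]] by simp

lemma L2_fun_mult_bounded:
  assumes f: "L2_fun a b f" and h[measurable]: "h \<in> borel_measurable (lebesgue_on {a<..<b})"
    and C: "AE x in lebesgue_on {a<..<b}. \<bar>h x\<bar> \<le> C"
  shows "L2_fun a b (\<lambda>x. h x * f x)"
  unfolding L2_fun_def
proof
  show "(\<lambda>x. h x * f x) \<in> borel_measurable (lebesgue_on {a<..<b})"
    using L2_fun_measurable[OF f] by measurable
  have "integrable (lebesgue_on {a<..<b}) (\<lambda>x. (h x)\<^sup>2 * (f x)\<^sup>2)"
  proof (rule integrable_mult_bounded)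
    show "AE x in lebesgue_on {a<..<b}. \<bar>(h x)\<^sup>2\<bar> \<le> C\<^sup>2"
      using C by eventually_elim (metis abs_ge_zero abs_power2 power2_abs power_mono)
  qed (use f in \<open>auto simp: L2_fun_def\<close>)
  then show "integrable (lebesgue_on {a<..<b}) (\<lambda>x. (h x * f x)\<^sup>2)" by (simp add: power_mult_distrib)
qed

lemma L2_fun_bounded:
  assumes h: "h \<in> borel_measurable (lebesgue_on {a<..<b})"
    and C: "AE x in lebesgue_on {a<..<b}. \<bar>h x\<bar> \<le> C"
  shows "L2_fun a b h"
proof -
  have "L2_fun a b (\<lambda>x. 1)"
    using integrable_Ioo_continuous[of a b "\<lambda>x. 1"] by (simp add: L2_fun_def)
  then show ?thesis using L2_fun_mult_bounded[OF _ h C] by fastforce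
qed

lemma L2_norm_nonneg: "0 \<le> L2_norm a b f"
  by (simp add: L2_norm_def)

lemma L2_norm_square: "(L2_norm a b f)\<^sup>2 = (\<integral>x. (f x)\<^sup>2 \<partial>lebesgue_on {a<..<b})"
  by (simp add: L2_norm_def)

lemma L2_cauchy_schwarz:
  assumes f: "L2_fun a b f" and g: "L2_fun a b g"
  shows "\<bar>\<integral>x. f x * g x \<partial>lebesgue_on {a<..<b}\<bar> \<le> L2_norm a b f * L2_norm a b g"
proof -
  let ?M = "lebesgue_on {a<..<b}"
  define F where "F = (\<integral>x. (f x)\<^sup>2 \<partial>?M)"
  define G where "G = (\<integral>x. (g x)\<^sup>2 \<partial>?M)"
  define I where "I = (\<integral>x. f x * g x \<partial>?M)"
  have F0: "0 \<le> F" by (simp add: F_def)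
  have quad: "0 \<le> t\<^sup>2 * F - 2 * t * I + G" for t
  proof -
    have i: "integrable ?M (\<lambda>x. (f x)\<^sup>2)" "integrable ?M (\<lambda>x. (g x)\<^sup>2)" "integrable ?M (\<lambda>x. f x * g x)"
      using f g L2_fun_mult_integrable[OF f g] by (auto simp: L2_fun_def)
    have "0 \<le> (\<integral>x. (t * f x - g x)\<^sup>2 \<partial>?M)" by simp
    also have "\<dots> = (\<integral>x. t\<^sup>2 * (f x)\<^sup>2 - 2 * t * (f x * g x) + (g x)\<^sup>2 \<partial>?M)"
      by (simp add: power2_diff power_mult_distrib algebra_simps)
    also have "\<dots> = t\<^sup>2 * F - 2 * t * I + G"
      using i by (simp add: F_def G_def I_def)
    finally show ?thesis .
  qed
  have "I\<^sup>2 \<le> F * G"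
  proof (cases "F = 0")
    case True
    have "I = 0"
    proof (rule ccontr)
      assume "I \<noteq> 0"
      \<comment> \<open>For F = 0 this choice of t would give the quadratic the value -1.\<close>
      then have "2 * ((G + 1) / (2 * I)) * I = G + 1" by simp
      then show False using quad[of "(G + 1) / (2 * I)"] True by simp
    qed
    then show ?thesis using True by simp
  next
    case False
    then have "(I / F)\<^sup>2 * F - 2 * (I / F) * I + G = G - I\<^sup>2 / F"
      by (simp add: power2_eq_square)
    then have "I\<^sup>2 / F \<le> G" using quad[of "I / F"] by simp
    then show ?thesis using False F0 by (simp add: field_simps)
  qed
  then have "sqrt (I\<^sup>2) \<le> sqrt (F * G)" by (rule real_sqrt_le_mono)
  then show ?thesis by (simp add: L2_norm_def F_def G_def I_def real_sqrt_mult)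
qed

lemma L2_norm_AE_cong:
  assumes "L2_fun a b f" "L2_fun a b g" "AE x in lebesgue_on {a<..<b}. f x = g x"
  shows "L2_norm a b f = L2_norm a b g"
proof -
  have "(\<integral>x. (f x)\<^sup>2 \<partial>lebesgue_on {a<..<b}) = (\<integral>x. (g x)\<^sup>2 \<partial>lebesgue_on {a<..<b})"
    using assms by (intro integral_cong_AE) (auto simp: L2_fun_def)
  then show ?thesis by (simp add: L2_norm_def)
qed

section \<open>Weak derivatives\<close>

text \<open>The second difference of \<open>(max 0 z)\<^sup>2 / 2\<close>: a \<open>C\<^sup>1\<close> step from 0 to 1 whose derivative is a hat
  function on \<open>[0,2]\<close>.\<close>

definition ramp2 :: "real \<Rightarrow> real" where "ramp2 z = (max 0 z)\<^sup>2 / 2"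

definition step_fun :: "real \<Rightarrow> real" where "step_fun z = ramp2 z - 2 * ramp2 (z - 1) + ramp2 (z - 2)"

definition hat_fun :: "real \<Rightarrow> real" where "hat_fun z = max 0 z - 2 * max 0 (z - 1) + max 0 (z - 2)"

lemma ramp2_deriv: "(ramp2 has_real_derivative max 0 z) (at z)"
proof -
  consider "z < 0" | "z = 0" | "z > 0" by linarith
  then show ?thesis
  proof cases
    case 1
    have "((\<lambda>z. 0) has_real_derivative max 0 z) (at z)" using 1 by simp
    then show ?thesis
      by (rule has_field_derivative_transform_within_open[where S = "{..<0}"]) (use 1 in \<open>auto simp: ramp2_def\<close>)
  next
    case 2
    have "((\<lambda>y. max 0 y / 2) \<longlongrightarrow> max 0 0 / 2) (at (0::real))" by (intro tendsto_intros) simp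
    then have "((\<lambda>y. max 0 y / 2) \<longlongrightarrow> 0) (at (0::real))" by simp
    then have "((\<lambda>y. (ramp2 y - ramp2 0) / (y - 0)) \<longlongrightarrow> 0) (at 0)"
      by (rule Lim_transform_eventually)
         (auto simp: eventually_at_filter ramp2_def max_def power2_eq_square)
    then show ?thesis using 2 by (simp add: has_field_derivative_iff)
  next
    case 3
    have "((\<lambda>z. z\<^sup>2 / 2) has_real_derivative max 0 z) (at z)"
      using 3 by (auto intro!: derivative_eq_intros)
    then show ?thesis
      by (rule has_field_derivative_transform_within_open[where S = "{0<..}"]) (use 3 in \<open>auto simp: ramp2_def\<close>)
  qed
qed

lemma step_fun_deriv: "(step_fun has_real_derivative hat_fun z) (at z)"
  unfolding step_fun_def[abs_def] hat_fun_def
  by (auto intro!: derivative_eq_intros DERIV_chain2[OF ramp2_deriv])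

lemma continuous_hat_fun: "continuous_on S hat_fun"
  unfolding hat_fun_def[abs_def] by (intro continuous_intros)

lemma step_fun_0: "z \<le> 0 \<Longrightarrow> step_fun z = 0" and step_fun_1: "2 \<le> z \<Longrightarrow> step_fun z = 1"
  by (auto simp: step_fun_def ramp2_def power2_eq_square field_simps)

lemma step_fun_bounds: "0 \<le> step_fun z" "step_fun z \<le> 1"
proof -
  consider "z \<le> 0" | "0 \<le> z" "z \<le> 1" | "1 \<le> z" "z \<le> 2" | "2 \<le> z" by linarith
  then have "0 \<le> step_fun z \<and> step_fun z \<le> 1"
  proof cases
    case 2
    then have "step_fun z = z\<^sup>2 / 2" by (simp add: step_fun_def ramp2_def)
    moreover have "z\<^sup>2 \<le> 1" "0 \<le> z\<^sup>2" using 2 by (simp_all add: power_le_one)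
    ultimately show ?thesis by linarith
  next
    case 3
    then have "step_fun z = 1 - (2 - z)\<^sup>2 / 2"
      by (simp add: step_fun_def ramp2_def power2_eq_square field_simps)
    moreover have "(2 - z)\<^sup>2 \<le> 1" using 3 by (intro power_le_one) auto
    moreover have "0 \<le> (2 - z)\<^sup>2" by simp
    ultimately show ?thesis by linarith
  qed (auto simp: step_fun_0 step_fun_1)
  then show "0 \<le> step_fun z" "step_fun z \<le> 1" by auto
qed

lemma hat_fun_nonneg: "0 \<le> hat_fun z" and hat_fun_zero: "z \<notin> {0..2} \<Longrightarrow> hat_fun z = 0"
  by (auto simp: hat_fun_def max_def)

text \<open>The scaled hats form an approximate identity: each is the derivative of a step from 0 to
  1, hence of mass 1, and lives on [x, x + 2 / n], which finally lies inside the interval.\<close>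

lemma hat_average_tendsto:
  fixes f :: "real \<Rightarrow> real"
  assumes x: "a < x" "x < b" and f: "continuous_on {a<..<b} f" and fi: "integrable (lebesgue_on {a<..<b}) f"
  shows "(\<lambda>n. \<integral>z. f z * (real n * hat_fun (real n * (z - x))) \<partial>lebesgue_on {a<..<b}) \<longlonglongrightarrow> f x"
proof (rule LIMSEQ_I)
  fix r :: real assume r: "0 < r"
  have "isCont f x" using f x by (simp add: continuous_on_eq_continuous_at)
  then obtain d where d: "d > 0" "\<And>z. \<bar>z - x\<bar> < d \<Longrightarrow> \<bar>f z - f x\<bar> < r / 2"
    using \<open>isCont f x\<close>[unfolded continuous_at_eps_delta dist_real_def, rule_format, of "r / 2"] r by auto
  obtain N :: nat where N: "real N > max (2 / d) (2 / (b - x))" using reals_Archimedean2 by blast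
  show "\<exists>no. \<forall>n\<ge>no. norm ((\<integral>z. f z * (real n * hat_fun (real n * (z - x))) \<partial>lebesgue_on {a<..<b}) - f x) < r"
  proof (intro exI[of _ N] allI impI)
    fix n assume "N \<le> n"
    then have n: "real n > 2 / d" "real n > 2 / (b - x)" using N by auto
    have n0: "real n > 0" using n(1) d(1) by (smt (verit) divide_pos_pos)
    have nd: "2 / n < d" "x + 2 / n < b" using n n0 d(1) x by (auto simp: field_simps)
    define \<phi> where "\<phi> z = real n * hat_fun (real n * (z - x))" for z
    have \<phi>c: "continuous_on S \<phi>" for S
      unfolding \<phi>_def[abs_def] by (intro continuous_intros continuous_on_compose2[OF continuous_hat_fun[of UNIV]]) auto
    have \<phi>0: "\<phi> z = 0" if "z \<notin> {x..x + 2 / n}" for z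
      using that n0 unfolding \<phi>_def by (subst hat_fun_zero) (auto simp: field_simps)
    have \<phi>n: "0 \<le> \<phi> z" for z using n0 hat_fun_nonneg by (simp add: \<phi>_def)
    have \<phi>1: "(\<phi> has_integral 1) {x..x + 2 / n}"
    proof -
      have "(\<phi> has_integral (step_fun (real n * (x + 2 / n - x)) - step_fun (real n * (x - x)))) {x..x + 2 / n}"
      proof (rule fundamental_theorem_of_calculus)
        fix z
        have "((\<lambda>z. step_fun (real n * (z - x))) has_real_derivative \<phi> z) (at z)"
          unfolding \<phi>_def by (rule DERIV_cong[OF DERIV_chain2[OF step_fun_deriv]]) (auto intro!: derivative_eq_intros)
        then show "((\<lambda>z. step_fun (real n * (z - x))) has_vector_derivative \<phi> z) (at z within {x..x + 2 / n})"
          unfolding has_real_derivative_iff_has_vector_derivative[symmetric]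
          by (rule has_field_derivative_at_within)
      qed (use n0 in simp)
      then show ?thesis using n0 by (simp add: step_fun_0 step_fun_1)
    qed
    have sub: "{x..x + 2 / n} \<subseteq> {a<..<b}" using x nd by auto
    have fi': "((\<lambda>z. f z * \<phi> z) has_integral integral {x..x + 2 / n} (\<lambda>z. f z * \<phi> z)) {x..x + 2 / n}"
      by (intro integrable_integral integrable_continuous_real continuous_intros \<phi>c continuous_on_subset[OF f sub])
    have sup: "((\<lambda>z. f z * \<phi> z) has_integral integral {x..x + 2 / n} (\<lambda>z. f z * \<phi> z)) {a<..<b}"
      by (rule has_integral_on_superset[OF fi' _ sub]) (simp add: \<phi>0)
    have leb: "((\<lambda>z. f z * \<phi> z) has_integral (\<integral>z. f z * \<phi> z \<partial>lebesgue_on {a<..<b})) {a<..<b}"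
    proof (rule has_integral_integral_lebesgue_on)
      have "bounded (\<phi> ` {a..b})" by (intro compact_imp_bounded compact_continuous_image \<phi>c) simp
      then obtain C where C: "\<forall>y\<in>\<phi> ` {a..b}. norm y \<le> C" unfolding bounded_iff by blast
      have "integrable (lebesgue_on {a<..<b}) (\<lambda>z. \<phi> z * f z)"
      proof (rule integrable_mult_bounded[OF fi])
        show "AE z in lebesgue_on {a<..<b}. \<bar>\<phi> z\<bar> \<le> C" using C by (intro AE_I2) auto
        show "\<phi> \<in> borel_measurable (lebesgue_on {a<..<b})"
          by (intro continuous_imp_measurable_on_sets_lebesgue \<phi>c) auto
      qed
      then show "integrable (lebesgue_on {a<..<b}) (\<lambda>z. f z * \<phi> z)" by (simp add: mult.commute)
    qed simp
    have "(\<integral>z. f z * \<phi> z \<partial>lebesgue_on {a<..<b}) = integral {x..x + 2 / n} (\<lambda>z. f z * \<phi> z)"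
      by (rule has_integral_unique[OF leb sup])
    moreover have "norm (integral {x..x + 2 / n} (\<lambda>z. f z * \<phi> z) - f x) \<le> r / 2"
    proof -
      have 1: "((\<lambda>z. f z * \<phi> z - f x * \<phi> z) has_integral (integral {x..x + 2 / n} (\<lambda>z. f z * \<phi> z) - f x * 1)) {x..x + 2 / n}"
        by (intro has_integral_diff fi' has_integral_mult_right \<phi>1)
      have 2: "((\<lambda>z. r / 2 * \<phi> z) has_integral (r / 2 * 1)) {x..x + 2 / n}"
        by (intro has_integral_mult_right \<phi>1)
      have "norm (integral {x..x + 2 / n} (\<lambda>z. f z * \<phi> z - f x * \<phi> z)) \<le> integral {x..x + 2 / n} (\<lambda>z. r / 2 * \<phi> z)"
      proof (rule integral_norm_bound_integral)
        fix z assume "z \<in> {x..x + 2 / n}"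
        then have "\<bar>f z - f x\<bar> * \<phi> z \<le> r / 2 * \<phi> z"
          using d(2)[of z] nd \<phi>n[of z] by (intro mult_right_mono) auto
        then show "norm (f z * \<phi> z - f x * \<phi> z) \<le> r / 2 * \<phi> z"
          using \<phi>n[of z] by (simp add: abs_mult flip: left_diff_distrib)
      qed (use has_integral_integrable[OF 1] has_integral_integrable[OF 2] in simp_all)
      then show ?thesis unfolding integral_unique[OF 1] integral_unique[OF 2] by simp
    qed
    ultimately have "norm ((\<integral>z. f z * \<phi> z \<partial>lebesgue_on {a<..<b}) - f x) \<le> r / 2" by simp
    then show "norm ((\<integral>z. f z * (real n * hat_fun (real n * (z - x))) \<partial>lebesgue_on {a<..<b}) - f x) < r"
      using r unfolding \<phi>_def by linarith
  qed
qed

lemma integrable_mult_continuous: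
  fixes f h :: "real \<Rightarrow> real"
  assumes f: "integrable (lebesgue_on {a<..<b}) f" and h: "continuous_on {a..b} h"
  shows "integrable (lebesgue_on {a<..<b}) (\<lambda>x. h x * f x)"
proof -
  have "bounded (h ` {a..b})" by (intro compact_imp_bounded compact_continuous_image h) simp
  then obtain C where C: "\<forall>y\<in>h ` {a..b}. norm y \<le> C" unfolding bounded_iff by blast
  show ?thesis
  proof (rule integrable_mult_bounded[OF f])
    show "AE x in lebesgue_on {a<..<b}. \<bar>h x\<bar> \<le> C" using C by (intro AE_I2) auto
    show "h \<in> borel_measurable (lebesgue_on {a<..<b})"
      by (intro continuous_imp_measurable_on_sets_lebesgue continuous_on_subset[OF h]) auto
  qed
qed

lemma C1c_fun_continuous:
  assumes "C1c_fun a b p p'"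
  shows "continuous_on S p" "continuous_on S p'"
  using assms unfolding C1c_fun_def
  by (auto intro: continuous_on_subset has_real_derivative_imp_continuous_on)

text \<open>A smoothed indicator of \<open>{x<..y}\<close>: it rises just after x and falls just
  after y, so its support is \<open>{x..y + 2 / n}\<close>.\<close>

lemma step_difference_C1c:
  assumes n: "0 < (n::real)" and xy: "a < x" "x \<le> y" "y + 2 / n < b"
  shows "C1c_fun a b (\<lambda>z. step_fun (n * (z - x)) - step_fun (n * (z - y)))
     (\<lambda>z. n * hat_fun (n * (z - x)) - n * hat_fun (n * (z - y)))"
  unfolding C1c_fun_def
proof (intro conjI allI exI impI)
  have d: "((\<lambda>z. step_fun (n * (z - c))) has_real_derivative n * hat_fun (n * (z - c))) (at z)" for c z
    by (rule DERIV_cong[OF DERIV_chain2[OF step_fun_deriv]]) (auto intro!: derivative_eq_intros)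
  show "((\<lambda>z. step_fun (n * (z - x)) - step_fun (n * (z - y))) has_real_derivative
      n * hat_fun (n * (z - x)) - n * hat_fun (n * (z - y))) (at z)" for z
    by (intro DERIV_diff d)
  show "continuous_on UNIV (\<lambda>z. n * hat_fun (n * (z - x)) - n * hat_fun (n * (z - y)))"
    by (intro continuous_intros continuous_on_compose2[OF continuous_hat_fun[of UNIV]]) auto
  show "step_fun (n * (z - x)) - step_fun (n * (z - y)) = 0" if "z \<notin> {x..y + 2 / n}" for z
  proof (cases "z < x")
    case True
    then show ?thesis using n xy by (simp add: step_fun_0 mult_nonneg_nonpos)
  next
    case False
    then have z: "y + 2 / n \<le> z" using that by auto
    then have "2 \<le> n * (z - y)" using n by (simp add: field_simps)
    moreover have "n * (z - y) \<le> n * (z - x)" using n xy by (intro mult_left_mono) auto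
    ultimately show ?thesis by (simp add: step_fun_1)
  qed
qed (use xy in auto)

text \<open>Test with smoothed indicators of [x, y]. On the left their derivatives are differences
  of two approximate identities, which give f x - f y; on the right dominated convergence gives
  minus the integral of g.\<close>

lemma weak_deriv_has_integral_interior:
  fixes f g :: "real \<Rightarrow> real"
  assumes f: "continuous_on {a<..<b} f" "integrable (lebesgue_on {a<..<b}) f"
    and g: "integrable (lebesgue_on {a<..<b}) g" and wd: "has_weak_deriv a b f g"
    and xy: "a < x" "x \<le> y" "y < b"
  shows "(g has_integral (f y - f x)) {x..y}"
proof -
  let ?M = "lebesgue_on {a<..<b}"
  define p where "p n z = step_fun (real n * (z - x)) - step_fun (real n * (z - y))" for n z
  define p' where "p' n z = real n * hat_fun (real n * (z - x)) - real n * hat_fun (real n * (z - y))" for n z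
  obtain N :: nat where N: "real N > 2 / (b - y)" using reals_Archimedean2 by blast
  have test: "C1c_fun a b (p n) (p' n)" if "N \<le> n" for n
  proof -
    have n: "real n > 2 / (b - y)" using N that by (meson less_le_trans of_nat_le_iff)
    then have n0: "0 < real n" using xy by (smt (verit) divide_pos_pos)
    then show ?thesis
      unfolding p_def p'_def using n xy by (intro step_difference_C1c) (auto simp: field_simps)
  qed
  have hc: "continuous_on S (\<lambda>z. real n * hat_fun (real n * (z - c)))" for n c S
    by (intro continuous_intros continuous_on_compose2[OF continuous_hat_fun[of UNIV]]) auto
  have "(\<lambda>n. \<integral>z. f z * p' n z \<partial>?M) \<longlonglongrightarrow> f x - f y"
  proof -
    have "(\<integral>z. f z * p' n z \<partial>?M) = (\<integral>z. f z * (real n * hat_fun (real n * (z - x))) \<partial>?M)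
       - (\<integral>z. f z * (real n * hat_fun (real n * (z - y))) \<partial>?M)" for n
      using integrable_mult_continuous[OF f(2) hc[where c = x and n = n]] integrable_mult_continuous[OF f(2) hc[where c = y and n = n]]
      unfolding p'_def right_diff_distrib by (intro Bochner_Integration.integral_diff) (simp_all add: mult.commute)
    then show ?thesis
      using tendsto_diff[OF hat_average_tendsto[OF _ _ f, of x] hat_average_tendsto[OF _ _ f, of y]] xy by simp
  qed
  \<comment> \<open>The limit is the half-open indicator because \<open>step_fun\<close> vanishes at
    0, which makes every test 0 at x itself; the point x is restored by a spike at the end.\<close>
  moreover have "(\<lambda>n. \<integral>z. g z * p n z \<partial>?M) \<longlonglongrightarrow> (\<integral>z. g z * indicator {x<..y} z \<partial>?M)"
  proof (rule integral_dominated_convergence)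
    show "integrable ?M (\<lambda>z. norm (g z))" using g by (rule integrable_norm)
    show "AE z in ?M. norm (g z * p n z) \<le> norm (g z)" for n
    proof (rule AE_I2)
      fix z
      have "\<bar>p n z\<bar> \<le> 1"
        using step_fun_bounds[of "real n * (z - x)"] step_fun_bounds[of "real n * (z - y)"] unfolding p_def by linarith
      then show "norm (g z * p n z) \<le> norm (g z)" by (simp add: abs_mult mult_left_le)
    qed
    have gm: "g \<in> borel_measurable ?M" using g by (rule borel_measurable_integrable)
    show "(\<lambda>z. g z * p n z) \<in> borel_measurable ?M" for n
    proof (rule borel_measurable_times[OF gm])
      have "continuous_on UNIV step_fun" by (rule has_real_derivative_imp_continuous_on[OF step_fun_deriv])
      then have "continuous_on {a<..<b} (p n)" unfolding p_def[abs_def]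
        by (intro continuous_intros continuous_on_compose2[where f = "\<lambda>z. real n * (z - c)" for c]) auto
      then show "p n \<in> borel_measurable ?M" by (intro continuous_imp_measurable_on_sets_lebesgue) auto
    qed
    have "indicator {x<..y} \<in> borel_measurable (lebesgue_on {a<..<b})"
      by (rule borel_measurable_indicator) (use xy in \<open>auto simp: sets_restrict_space_iff intro!: sets_completionI_sets\<close>)
    then show "(\<lambda>z. g z * indicator {x<..y} z) \<in> borel_measurable ?M"
      by (rule borel_measurable_times[OF gm])
    show "AE z in ?M. (\<lambda>n. g z * p n z) \<longlonglongrightarrow> g z * indicator {x<..y} z"
    proof (intro AE_I2 tendsto_mult_left)
      have lim: "(\<lambda>n. step_fun (real n * (z - c))) \<longlonglongrightarrow> (if c < z then 1 else 0)" for z c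
      proof (cases "c < z")
        case True
        obtain m :: nat where m: "real m > 2 / (z - c)" using reals_Archimedean2 by blast
        have "step_fun (real n * (z - c)) = 1" if "m \<le> n" for n
        proof (rule step_fun_1)
          have "2 / (z - c) \<le> real n" using m that by (meson less_imp_le less_le_trans of_nat_le_iff)
          then show "2 \<le> real n * (z - c)" using True by (simp add: field_simps)
        qed
        then show ?thesis using True by (intro tendsto_eventually) (auto simp: eventually_sequentially)
      next
        case False
        then have "step_fun (real n * (z - c)) = 0" for n by (intro step_fun_0 mult_nonneg_nonpos) auto
        then show ?thesis using False by simp
      qed
      show "(\<lambda>n. p n z) \<longlonglongrightarrow> indicator {x<..y} z" for z
        using tendsto_diff[OF lim[of z x] lim[of z y]] xy unfolding p_def
        by (auto simp: indicator_def split: if_splits)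
    qed
  qed
  then have "(\<lambda>n. - (\<integral>z. g z * p n z \<partial>?M)) \<longlonglongrightarrow> - (\<integral>z. g z * indicator {x<..y} z \<partial>?M)"
    by (rule tendsto_minus)
  then have "(\<lambda>n. \<integral>z. f z * p' n z \<partial>?M) \<longlonglongrightarrow> - (\<integral>z. g z * indicator {x<..y} z \<partial>?M)"
  proof (rule Lim_transform_eventually)
    show "\<forall>\<^sub>F n in sequentially. - (\<integral>z. g z * p n z \<partial>?M) = (\<integral>z. f z * p' n z \<partial>?M)"
      using test wd unfolding has_weak_deriv_def eventually_sequentially by metis
  qed
  ultimately have eq: "f y - f x = (\<integral>z. g z * indicator {x<..y} z \<partial>?M)"
    using LIMSEQ_unique by fastforce
  have gi: "integrable ?M (\<lambda>z. g z * indicator {x<..y} z)"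
    using g by (rule integrable_real_mult_indicator[rotated]) (use xy in \<open>auto simp: sets_restrict_space_iff\<close>)
  have "((\<lambda>z. g z * indicator {x<..y} z) has_integral (f y - f x)) {a..b}"
    unfolding eq by (rule integrable_Ioo_has_integral[OF gi])
  then have "((\<lambda>z. if z \<in> {x..y} then g z else 0) has_integral (f y - f x)) {a..b}"
    by (rule has_integral_spike_finite[of "{x}", rotated 2]) (auto simp: indicator_def)
  then show ?thesis
    using xy by (subst (asm) has_integral_restrict) auto
qed

text \<open>By the interior case f minus a primitive of g is constant on the open interval;
  continuity carries this to the endpoints, where boundary values are read off.\<close>

lemma weak_deriv_has_integral:
  fixes f g :: "real \<Rightarrow> real"
  assumes f: "continuous_on {a..b} f"
    and g: "integrable (lebesgue_on {a<..<b}) g" and wd: "has_weak_deriv a b f g"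
    and xy: "a \<le> x" "x \<le> y" "y \<le> b"
  shows "(g has_integral (f y - f x)) {x..y}"
proof (cases "x = y")
  case False
  then have ab: "a < b" using xy by simp
  have gi: "g integrable_on {x..y}" if "a \<le> x" "y \<le> b" for x y
    by (rule integrable_Ioo_subinterval[OF g that])
  define G where "G z = integral {a..z} g" for z
  have Gc: "continuous_on {a..b} G"
    unfolding G_def using gi by (intro indefinite_integral_continuous_1) auto
  have comb: "G s + integral {s..t} g = G t" if "a \<le> s" "s \<le> t" "t \<le> b" for s t
    unfolding G_def using that gi by (intro Henstock_Kurzweil_Integration.integral_combine) auto
  define c where "c = (a + b) / 2"
  have c: "a < c" "c < b" using ab by (auto simp: c_def)
  have const: "f z - G z = f c - G c" if "z \<in> {a<..<b}" for z
  proof -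
    have fi: "continuous_on {a<..<b} f" by (rule continuous_on_subset[OF f]) auto
    note * = weak_deriv_has_integral_interior[OF fi integrable_Ioo_continuous[OF f] g wd]
    show ?thesis
      using *[of c z] *[of z c] comb[of c z] comb[of z c] c that
      by (cases "c \<le> z") (auto simp: has_integral_iff)
  qed
  have "f z - G z = f c - G c" if z: "z \<in> {a..b}" for z
  proof (rule continuous_constant_on_closure[of "{a<..<b}" "\<lambda>z. f z - G z" "f c - G c" z])
    show "continuous_on (closure {a<..<b}) (\<lambda>z. f z - G z)"
      using ab by (simp add: closure_greaterThanLessThan) (intro continuous_intros f Gc)
  qed (use const z ab in \<open>auto simp: closure_greaterThanLessThan\<close>)
  from this[of x] this[of y] have "integral {x..y} g = f y - f x"
    using comb[of x y] xy by auto
  then show ?thesis using gi[of x y] xy by (simp add: has_integral_iff)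
qed (use has_integral_refl in auto)

text \<open>Lebesgue differentiation: off a negligible set, h x is the limit of the averages of h
  over [x, x + t]. That theorem concerns functions on the whole line, whence the extension
  \<open>H\<close> by zero.\<close>

lemma integrals_zero_imp_AE_zero:
  fixes h :: "real \<Rightarrow> real"
  assumes h: "\<And>x y. \<lbrakk>a \<le> x; x \<le> y; y \<le> b\<rbrakk> \<Longrightarrow> (h has_integral 0) {x..y}"
  shows "AE x in lebesgue_on {a<..<b}. h x = 0"
proof -
  define H where "H x = (if x \<in> {a..b} then h x else 0)" for x
  have "H integrable_on cbox c d" for c d
  proof -
    have "h integrable_on {max a c..min b d}"
      using h[of "max a c" "min b d"] by (cases "max a c \<le> min b d") (auto simp: has_integral_iff)
    then have "h integrable_on ({a..b} \<inter> cbox c d)" by simp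
    then show ?thesis unfolding H_def[abs_def] by (subst integrable_restrict_Int) (simp add: Int_commute)
  qed
  from integrable_ccontinuous_explicit[OF this] obtain N where N: "negligible N"
    "\<And>x e. \<lbrakk>x \<notin> N; 0 < e\<rbrakk> \<Longrightarrow> \<exists>d>0. \<forall>t. 0 < t \<and> t < d \<longrightarrow>
       norm (integral (cbox x (x + t *\<^sub>R One)) H /\<^sub>R t ^ DIM(real) - H x) < e" by metis
  have "h x = 0" if x: "x \<in> {a<..<b}" "x \<notin> N" for x
  proof (rule ccontr)
    assume nz: "h x \<noteq> 0"
    then obtain d where d: "d > 0"
      "\<And>t. 0 < t \<Longrightarrow> t < d \<Longrightarrow> norm (integral {x..x + t} H / t - H x) < \<bar>h x\<bar>"
      using N(2)[OF x(2), of "\<bar>h x\<bar>"] by (auto simp: divide_inverse mult.commute)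
    define t where "t = min (d / 2) (b - x)"
    have t: "0 < t" "t < d" "x + t \<le> b" using d(1) x by (auto simp: t_def)
    have "integral {x..x + t} H = integral {x..x + t} h"
      using x t by (intro Henstock_Kurzweil_Integration.integral_cong) (auto simp: H_def)
    also have "\<dots> = 0" using h[of x "x + t"] x t by (simp add: has_integral_iff)
    finally show False using d(2)[OF t(1,2)] x by (simp add: H_def)
  qed
  then have sub: "{x \<in> {a<..<b}. h x \<noteq> 0} \<subseteq> N" by blast
  have "AE x in lebesgue. x \<in> {a<..<b} \<longrightarrow> h x = 0"
    using N(1) sub by (intro AE_I'[of N]) (auto simp: negligible_iff_null_sets)
  then show ?thesis by (simp add: AE_restrict_space_iff)
qed

lemma weak_deriv_unique:
  assumes f: "continuous_on {a..b} f"
    and g1: "integrable (lebesgue_on {a<..<b}) g1" "has_weak_deriv a b f g1"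
    and g2: "integrable (lebesgue_on {a<..<b}) g2" "has_weak_deriv a b f g2"
  shows "AE x in lebesgue_on {a<..<b}. g1 x = g2 x"
proof -
  have "AE x in lebesgue_on {a<..<b}. g1 x - g2 x = 0"
  proof (rule integrals_zero_imp_AE_zero)
    fix x y assume "a \<le> x" "x \<le> y" "y \<le> b"
    then show "((\<lambda>x. g1 x - g2 x) has_integral 0) {x..y}"
      using has_integral_diff[OF weak_deriv_has_integral[OF f g1] weak_deriv_has_integral[OF f g2], of x y] by simp
  qed
  then show ?thesis by simp
qed

section \<open>Functions in H1\<close>

lemma H1_fun_weak_deriv:
  assumes "H1_fun a b f"
  shows "L2_fun a b (weak_deriv a b f)" "has_weak_deriv a b f (weak_deriv a b f)"
proof -
  have "\<exists>g. L2_fun a b g \<and> has_weak_deriv a b f g" using assms by (simp add: H1_fun_def)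
  then have "L2_fun a b (weak_deriv a b f) \<and> has_weak_deriv a b f (weak_deriv a b f)"
    unfolding weak_deriv_def by (rule someI_ex)
  then show "L2_fun a b (weak_deriv a b f)" "has_weak_deriv a b f (weak_deriv a b f)" by auto
qed

lemma H1_fun_continuous: "H1_fun a b f \<Longrightarrow> continuous_on {a..b} f"
  by (simp add: H1_fun_def)

lemma H1_fun_has_integral:
  assumes "H1_fun a b f" "a \<le> x" "x \<le> y" "y \<le> b"
  shows "(weak_deriv a b f has_integral (f y - f x)) {x..y}"
  using assms H1_fun_weak_deriv[OF assms(1)] L2_fun_integrable
  by (intro weak_deriv_has_integral) (auto simp: H1_fun_continuous)

lemma H1_fun_diff:
  assumes f: "H1_fun a b f" and g: "H1_fun a b g"
  shows "H1_fun a b (\<lambda>x. f x - g x)"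
proof -
  have i: "integrable (lebesgue_on {a<..<b}) (\<lambda>x. h x * r x)"
    if "L2_fun a b h" "C1c_fun a b p p'" "r = p \<or> r = p'" for h p p' r
    using integrable_mult_continuous[OF L2_fun_integrable[OF that(1)] C1c_fun_continuous(1)[OF that(2)]]
      integrable_mult_continuous[OF L2_fun_integrable[OF that(1)] C1c_fun_continuous(2)[OF that(2)]] that(3)
    by (auto simp: mult.commute)
  have "has_weak_deriv a b (\<lambda>x. f x - g x) (\<lambda>x. weak_deriv a b f x - weak_deriv a b g x)"
    unfolding has_weak_deriv_def
  proof (intro allI impI)
    fix p p' assume p: "C1c_fun a b p p'"
    have L2: "L2_fun a b f" "L2_fun a b g" using f g by (auto simp: H1_fun_def)
    show "(\<integral>x. (f x - g x) * p' x \<partial>lebesgue_on {a<..<b}) =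
      - (\<integral>x. (weak_deriv a b f x - weak_deriv a b g x) * p x \<partial>lebesgue_on {a<..<b})"
      using i[OF L2(1) p] i[OF L2(2) p] i[OF H1_fun_weak_deriv(1)[OF f] p] i[OF H1_fun_weak_deriv(1)[OF g] p]
        H1_fun_weak_deriv(2)[OF f] H1_fun_weak_deriv(2)[OF g] p
      unfolding left_diff_distrib has_weak_deriv_def by simp
  qed
  then show ?thesis
    using f g H1_fun_weak_deriv(1)[OF f] H1_fun_weak_deriv(1)[OF g] unfolding H1_fun_def
    by (blast intro: continuous_on_diff L2_fun_diff)
qed

lemma L2_fun_integral_bound:
  assumes g: "L2_fun a b g" and xy: "a \<le> x" "x \<le> y" "y \<le> b"
  shows "\<bar>integral {x..y} g\<bar> \<le> sqrt (y - x) * L2_norm a b g"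
proof (cases "x = y")
  case False
  have g2: "integrable (lebesgue_on {a<..<b}) (\<lambda>x. (g x)\<^sup>2)" using g by (simp add: L2_fun_def)
  have i: "(g has_integral integral {x..y} g) {x..y}"
    using integrable_Ioo_subinterval[OF L2_fun_integrable[OF g]] xy by blast
  have "(integral {x..y} g)\<^sup>2 \<le> (y - x) * integral {x..y} (\<lambda>x. (g x)\<^sup>2)"
    using False xy i integrable_Ioo_subinterval[OF g2] by (intro integral_square_bound) auto
  also have "\<dots> \<le> (y - x) * integral {a..b} (\<lambda>x. (g x)\<^sup>2)"
    using xy integrable_Ioo_subinterval[OF g2]
    by (intro mult_left_mono integral_subset_le) auto
  also have "\<dots> = (y - x) * (L2_norm a b g)\<^sup>2"
    by (simp add: L2_norm_square integral_Ioo_eq[OF g2])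
  finally have "sqrt ((integral {x..y} g)\<^sup>2) \<le> sqrt ((y - x) * (L2_norm a b g)\<^sup>2)"
    by (rule real_sqrt_le_mono)
  then show ?thesis by (simp add: real_sqrt_mult L2_norm_nonneg)
qed (simp add: L2_norm_nonneg)

text \<open>One-dimensional Sobolev embedding: average (f x)^2 \<le> 2 (f z)^2 + 2 (f x - f z)^2
  over z, the oscillation being controlled by the weak derivative. It turns convergence in H1 into
  uniform convergence.\<close>

lemma H1_fun_pointwise_bound:
  assumes f: "H1_fun a b f" and ab: "a < b" and x: "x \<in> {a..b}"
  shows "\<bar>f x\<bar> \<le> sqrt (2 / (b - a) + 2 * (b - a)) * H1_norm a b f"
proof -
  let ?g = "weak_deriv a b f"
  define Q where "Q = (b - a) * (L2_norm a b ?g)\<^sup>2"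
  have fL: "L2_fun a b f" using f by (simp add: H1_fun_def)
  then have f2: "((\<lambda>z. (f z)\<^sup>2) has_integral (L2_norm a b f)\<^sup>2) {a..b}"
    using integrable_Ioo_has_integral[of a b "\<lambda>z. (f z)\<^sup>2"] by (simp add: L2_fun_def L2_norm_square)
  have osc: "(f x - f z)\<^sup>2 \<le> Q" if z: "z \<in> {a..b}" for z
  proof -
    have le: "(f t - f s)\<^sup>2 \<le> Q" if "a \<le> s" "s \<le> t" "t \<le> b" for s t
    proof -
      have "\<bar>f t - f s\<bar> \<le> sqrt (t - s) * L2_norm a b ?g"
        using L2_fun_integral_bound[OF H1_fun_weak_deriv(1)[OF f] that] H1_fun_has_integral[OF f that]
        by (simp add: has_integral_iff)
      then have "(f t - f s)\<^sup>2 \<le> (sqrt (t - s) * L2_norm a b ?g)\<^sup>2"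
        by (metis abs_ge_zero power2_abs power_mono)
      also have "\<dots> = (t - s) * (L2_norm a b ?g)\<^sup>2" using that by (simp add: power_mult_distrib)
      also have "\<dots> \<le> Q" unfolding Q_def using that by (intro mult_right_mono) auto
      finally show ?thesis .
    qed
    show ?thesis
      using le[of z x] le[of x z] x z by (cases "z \<le> x") (auto simp: power2_commute)
  qed
  have up: "((\<lambda>z. 2 * (f z)\<^sup>2 + 2 * Q) has_integral (2 * (L2_norm a b f)\<^sup>2 + (b - a) * (2 * Q))) {a..b}"
    using has_integral_add[OF has_integral_mult_right[OF f2, of 2] has_integral_const_real[of "2 * Q" a b]] ab by simp
  have lo: "((\<lambda>z. (f x)\<^sup>2) has_integral (b - a) * (f x)\<^sup>2) {a..b}"
    using has_integral_const_real[of "(f x)\<^sup>2" a b] ab by simp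
  have "(f x)\<^sup>2 \<le> 2 * (f z)\<^sup>2 + 2 * Q" if "z \<in> {a..b}" for z
  proof -
    have "0 \<le> (f x - 2 * f z)\<^sup>2" by simp
    moreover have "(f x)\<^sup>2 = 2 * (f z)\<^sup>2 + 2 * (f x - f z)\<^sup>2 - (f x - 2 * f z)\<^sup>2"
      by (simp add: power2_eq_square algebra_simps)
    ultimately show ?thesis using osc[OF that] by linarith
  qed
  then have "(b - a) * (f x)\<^sup>2 \<le> 2 * (L2_norm a b f)\<^sup>2 + (b - a) * (2 * Q)"
    by (rule has_integral_le[OF lo up])
  then have "(f x)\<^sup>2 \<le> (2 * (L2_norm a b f)\<^sup>2 + (b - a) * (2 * Q)) / (b - a)"
    using ab by (simp add: field_simps)
  also have "\<dots> = 2 / (b - a) * (L2_norm a b f)\<^sup>2 + 2 * (b - a) * (L2_norm a b ?g)\<^sup>2"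
    using ab by (simp add: Q_def add_divide_distrib)
  also have "\<dots> \<le> (2 / (b - a) + 2 * (b - a)) * (L2_norm a b f)\<^sup>2 + (2 / (b - a) + 2 * (b - a)) * (L2_norm a b ?g)\<^sup>2"
    using ab by (intro add_mono mult_right_mono) auto
  also have "\<dots> = (2 / (b - a) + 2 * (b - a)) * (H1_norm a b f)\<^sup>2"
    by (simp add: H1_norm_def distrib_left)
  finally have "sqrt ((f x)\<^sup>2) \<le> sqrt ((2 / (b - a) + 2 * (b - a)) * (H1_norm a b f)\<^sup>2)"
    by (rule real_sqrt_le_mono)
  moreover have "0 \<le> H1_norm a b f" by (simp add: H1_norm_def)
  ultimately show ?thesis by (simp add: real_sqrt_mult)
qed

section \<open>Partial integrals and Fubini over a triangle\<close>

lemma integral_Ioo_below: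
  fixes f :: "real \<Rightarrow> real"
  assumes f: "integrable (lebesgue_on {a<..<b}) f" and c: "c \<in> {a..b}"
  shows "integrable (lebesgue_on {a<..<b}) (\<lambda>x. if x < c then f x else 0)"
    "(\<integral>x. (if x < c then f x else 0) \<partial>lebesgue_on {a<..<b}) = integral {a..c} f"
proof -
  have eq: "(\<lambda>x. if x < c then f x else 0) = (\<lambda>x. f x * indicator {..<c} x)" by auto
  have m: "{..<c} \<inter> {a<..<b} \<in> sets lebesgue" by auto
  have "integrable (lebesgue_on {a<..<b}) (\<lambda>x. indicator {..<c} x * f x)"
  proof (rule integrable_mult_bounded[OF f])
    show "AE x in lebesgue_on {a<..<b}. \<bar>indicator {..<c} x\<bar> \<le> (1::real)" by simp
    show "indicator {..<c} \<in> borel_measurable (lebesgue_on {a<..<b})"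
      by (rule borel_measurable_indicator') (use m in \<open>auto simp: sets_restrict_space_iff Int_commute Int_def\<close>)
  qed
  then show i: "integrable (lebesgue_on {a<..<b}) (\<lambda>x. if x < c then f x else 0)"
    unfolding eq by (simp add: mult.commute)
  have "integral {a..b} (\<lambda>x. if x < c then f x else 0) = integral {a..b} (\<lambda>x. if x \<in> {a..c} then f x else 0)"
    by (rule integral_spike[of "{c}"]) auto
  also have "\<dots> = integral {a..c} f"
    using c by (subst integral_restrict_Int) (simp add: Int_absorb1)
  finally show "(\<integral>x. (if x < c then f x else 0) \<partial>lebesgue_on {a<..<b}) = integral {a..c} f"
    using integral_Ioo_eq[OF i] by simp
qed

lemma integral_Ioo_above:
  fixes f :: "real \<Rightarrow> real"
  assumes f: "integrable (lebesgue_on {a<..<b}) f" and c: "c \<in> {a..b}"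
  shows "(\<integral>x. (if c < x then f x else 0) \<partial>lebesgue_on {a<..<b}) = integral {c..b} f"
proof -
  have i: "integrable (lebesgue_on {a<..<b}) (\<lambda>x. if x < c then f x else 0)"
    by (rule integral_Ioo_below(1)[OF f c])
  have fi: "f integrable_on {a..b}" by (rule integrable_Ioo_subinterval[OF f]) auto
  have "(\<integral>x. (if c < x then f x else 0) \<partial>lebesgue_on {a<..<b})
      = (\<integral>x. f x - (if x < c then f x else 0) \<partial>lebesgue_on {a<..<b})"
  proof (rule integral_cong_AE)
    have "AE x in lebesgue. x \<noteq> c" by (rule AE_completion, rule AE_lborel_singleton)
    then have "AE x in lebesgue_on {a<..<b}. x \<noteq> c" by (simp add: AE_restrict_space_iff eventually_mono)
    then show "AE x in lebesgue_on {a<..<b}. (if c < x then f x else 0) = f x - (if x < c then f x else 0)"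
      by eventually_elim auto
    have "{c<..} \<inter> {a<..<b} \<in> sets lebesgue" by auto
    then have "indicator {c<..} \<in> borel_measurable (lebesgue_on {a<..<b})"
      by (intro borel_measurable_indicator') (auto simp: sets_restrict_space_iff Int_commute Int_def)
    then have "(\<lambda>x. f x * indicator {c<..} x) \<in> borel_measurable (lebesgue_on {a<..<b})"
      by (rule borel_measurable_times[OF borel_measurable_integrable[OF f]])
    moreover have "(\<lambda>x. if c < x then f x else 0) = (\<lambda>x. f x * indicator {c<..} x)" by auto
    ultimately show "(\<lambda>x. if c < x then f x else 0) \<in> borel_measurable (lebesgue_on {a<..<b})" by simp
    show "(\<lambda>x. f x - (if x < c then f x else 0)) \<in> borel_measurable (lebesgue_on {a<..<b})"
      using f i by (intro borel_measurable_diff borel_measurable_integrable)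
  qed
  also have "\<dots> = integral {a..b} f - integral {a..c} f"
    using f i integral_Ioo_below(2)[OF f c] by (simp add: integral_Ioo_eq)
  also have "\<dots> = integral {c..b} f"
    using Henstock_Kurzweil_Integration.integral_combine[of a c b f] c fi by auto
  finally show ?thesis .
qed

text \<open>Fubini over the triangle a < x < \<xi> < b. Its use is to trade a test function that is
  a primitive of \<alpha> for a primitive of \<rho> \<psi>_t.\<close>

lemma integral_swap_triangle:
  fixes f \<alpha> :: "real \<Rightarrow> real"
  assumes f: "integrable (lebesgue_on {a<..<b}) f" and \<alpha>: "integrable (lebesgue_on {a<..<b}) \<alpha>"
  shows "(\<integral>x. f x * integral {x..b} \<alpha> \<partial>lebesgue_on {a<..<b})
       = (\<integral>\<xi>. \<alpha> \<xi> * integral {a..\<xi>} f \<partial>lebesgue_on {a<..<b})"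
proof -
  let ?M = "lebesgue_on {a<..<b}"
  interpret M: finite_measure ?M by (rule finite_measure_Ioo)
  interpret P: pair_sigma_finite ?M ?M ..
  have fm[measurable]: "f \<in> borel_measurable ?M" and \<alpha>m[measurable]: "\<alpha> \<in> borel_measurable ?M"
    using f \<alpha> by auto
  have "integrable (?M \<Otimes>\<^sub>M ?M) (\<lambda>(x, \<xi>). f x * \<alpha> \<xi>)"
  proof (rule P.Fubini_integrable)
    show "(\<lambda>(x, \<xi>). f x * \<alpha> \<xi>) \<in> borel_measurable (?M \<Otimes>\<^sub>M ?M)" by measurable
    have "integrable ?M (\<lambda>x. \<bar>f x\<bar> * (\<integral>\<xi>. \<bar>\<alpha> \<xi>\<bar> \<partial>?M))" using f by simp
    then show "integrable ?M (\<lambda>x. \<integral>\<xi>. norm (case (x, \<xi>) of (x, \<xi>) \<Rightarrow> f x * \<alpha> \<xi>) \<partial>?M)"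
      by (simp add: abs_mult)
    show "AE x in ?M. integrable ?M (\<lambda>\<xi>. case (x, \<xi>) of (x, \<xi>) \<Rightarrow> f x * \<alpha> \<xi>)"
      using \<alpha> by simp
  qed
  then have "integrable (?M \<Otimes>\<^sub>M ?M) (\<lambda>z. indicator {z. fst z < snd z} z * (case z of (x, \<xi>) \<Rightarrow> f x * \<alpha> \<xi>))"
  proof (rule integrable_mult_bounded)
    have idm: "(\<lambda>x. x) \<in> borel_measurable ?M" using id_borel_measurable_lebesgue_on[of "{a<..<b}"] by (simp add: id_def)
    have [measurable]: "fst \<in> borel_measurable (?M \<Otimes>\<^sub>M ?M)" "snd \<in> borel_measurable (?M \<Otimes>\<^sub>M ?M)"
      by (rule measurable_compose[OF measurable_fst idm], rule measurable_compose[OF measurable_snd idm])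
    have "{z \<in> space (?M \<Otimes>\<^sub>M ?M). fst z < snd z} \<in> sets (?M \<Otimes>\<^sub>M ?M)"
      by (rule borel_measurable_less) measurable
    then show "indicator {z. fst z < snd z} \<in> borel_measurable (?M \<Otimes>\<^sub>M ?M)"
      by (intro borel_measurable_indicator') (simp add: Int_def conj_commute)
    show "AE z in ?M \<Otimes>\<^sub>M ?M. \<bar>indicator {z. fst z < snd z} z\<bar> \<le> (1::real)" by simp
  qed
  moreover have "(\<lambda>z. indicator {z. fst z < snd z} z * (case z of (x, \<xi>) \<Rightarrow> f x * \<alpha> \<xi>))
      = (\<lambda>(x, \<xi>). if x < \<xi> then f x * \<alpha> \<xi> else 0)" by (auto simp: indicator_def)
  ultimately have "integrable (?M \<Otimes>\<^sub>M ?M) (\<lambda>(x, \<xi>). if x < \<xi> then f x * \<alpha> \<xi> else 0)" by simp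
  from P.Fubini_integral[OF this]
  have "(\<integral>\<xi>. (\<integral>x. (if x < \<xi> then f x * \<alpha> \<xi> else 0) \<partial>?M) \<partial>?M)
      = (\<integral>x. (\<integral>\<xi>. (if x < \<xi> then f x * \<alpha> \<xi> else 0) \<partial>?M) \<partial>?M)" .
  also have "(\<integral>\<xi>. (\<integral>x. (if x < \<xi> then f x * \<alpha> \<xi> else 0) \<partial>?M) \<partial>?M) = (\<integral>\<xi>. \<alpha> \<xi> * integral {a..\<xi>} f \<partial>?M)"
  proof (rule Bochner_Integration.integral_cong[OF refl])
    fix \<xi> assume "\<xi> \<in> space ?M"
    then have "\<alpha> \<xi> * integral {a..\<xi>} f = \<alpha> \<xi> * (\<integral>x. (if x < \<xi> then f x else 0) \<partial>?M)"
      by (subst integral_Ioo_below(2)[OF f]) auto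
    also have "\<dots> = (\<integral>x. \<alpha> \<xi> * (if x < \<xi> then f x else 0) \<partial>?M)" by simp
    also have "\<dots> = (\<integral>x. (if x < \<xi> then f x * \<alpha> \<xi> else 0) \<partial>?M)"
      by (intro Bochner_Integration.integral_cong) auto
    finally show "(\<integral>x. (if x < \<xi> then f x * \<alpha> \<xi> else 0) \<partial>?M) = \<alpha> \<xi> * integral {a..\<xi>} f" by simp
  qed
  also have "(\<integral>x. (\<integral>\<xi>. (if x < \<xi> then f x * \<alpha> \<xi> else 0) \<partial>?M) \<partial>?M) = (\<integral>x. f x * integral {x..b} \<alpha> \<partial>?M)"
  proof (rule Bochner_Integration.integral_cong[OF refl])
    fix x assume "x \<in> space ?M"
    then have "f x * integral {x..b} \<alpha> = f x * (\<integral>\<xi>. (if x < \<xi> then \<alpha> \<xi> else 0) \<partial>?M)"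
      by (subst integral_Ioo_above[OF \<alpha>]) auto
    also have "\<dots> = (\<integral>\<xi>. f x * (if x < \<xi> then \<alpha> \<xi> else 0) \<partial>?M)" by simp
    also have "\<dots> = (\<integral>\<xi>. (if x < \<xi> then f x * \<alpha> \<xi> else 0) \<partial>?M)"
      by (intro Bochner_Integration.integral_cong) auto
    finally show "(\<integral>\<xi>. (if x < \<xi> then f x * \<alpha> \<xi> else 0) \<partial>?M) = f x * integral {x..b} \<alpha>" by simp
  qed
  finally show ?thesis by simp
qed

text \<open>Integration by parts reduced to Fubini: swapping over the triangle replaces p' by its
  primitive from a, which is p because p a = 0.\<close>

lemma H1_fun_upper_integral:
  fixes \<omega> :: "real \<Rightarrow> real"
  assumes \<omega>: "L2_fun a b \<omega>"
  shows "H1_fun a b (\<lambda>x. integral {x..b} \<omega>)" "has_weak_deriv a b (\<lambda>x. integral {x..b} \<omega>) (\<lambda>x. - \<omega> x)"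
proof -
  have \<omega>i: "integrable (lebesgue_on {a<..<b}) \<omega>" by (rule L2_fun_integrable[OF \<omega>])
  have "continuous_on {a..b} (\<lambda>x. integral {x..b} \<omega>)"
    using integrable_Ioo_subinterval[OF \<omega>i] by (intro indefinite_integral_continuous_1') auto
  moreover from this have "L2_fun a b (\<lambda>x. integral {x..b} \<omega>)"
    unfolding L2_fun_def
    by (auto intro!: integrable_Ioo_continuous continuous_intros borel_measurable_integrable)
  moreover show wd: "has_weak_deriv a b (\<lambda>x. integral {x..b} \<omega>) (\<lambda>x. - \<omega> x)"
    unfolding has_weak_deriv_def
  proof (intro allI impI)
    fix p p' assume p: "C1c_fun a b p p'"
    obtain c d where cd: "a < c" "d < b" "\<And>x. x \<notin> {c..d} \<Longrightarrow> p x = 0"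
      using p unfolding C1c_fun_def by blast
    have "(\<integral>x. integral {x..b} \<omega> * p' x \<partial>lebesgue_on {a<..<b}) = (\<integral>x. p' x * integral {x..b} \<omega> \<partial>lebesgue_on {a<..<b})"
      by (simp add: mult.commute)
    also have "\<dots> = (\<integral>\<xi>. \<omega> \<xi> * integral {a..\<xi>} p' \<partial>lebesgue_on {a<..<b})"
      by (rule integral_swap_triangle[OF integrable_Ioo_continuous[OF C1c_fun_continuous(2)[OF p]] \<omega>i])
    also have "\<dots> = (\<integral>\<xi>. \<omega> \<xi> * p \<xi> \<partial>lebesgue_on {a<..<b})"
    proof (rule Bochner_Integration.integral_cong[OF refl])
      fix \<xi> assume "\<xi> \<in> space (lebesgue_on {a<..<b})"
      then have "a \<le> \<xi>" by simp
      moreover have "(p has_vector_derivative p' x) (at x within {a..\<xi>})" for x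
        using p unfolding C1c_fun_def
        by (simp add: has_real_derivative_iff_has_vector_derivative[symmetric] has_field_derivative_at_within)
      ultimately have "(p' has_integral (p \<xi> - p a)) {a..\<xi>}"
        by (rule fundamental_theorem_of_calculus)
      moreover have "p a = 0" using cd by simp
      ultimately show "\<omega> \<xi> * integral {a..\<xi>} p' = \<omega> \<xi> * p \<xi>" by (simp add: has_integral_iff)
    qed
    finally show "(\<integral>x. integral {x..b} \<omega> * p' x \<partial>lebesgue_on {a<..<b}) = - (\<integral>x. - \<omega> x * p x \<partial>lebesgue_on {a<..<b})"
      by simp
  qed
  moreover have "L2_fun a b (\<lambda>x. - \<omega> x)" using L2_fun_cmult[OF \<omega>, of "-1"] by simp
  ultimately show "H1_fun a b (\<lambda>x. integral {x..b} \<omega>)" unfolding H1_fun_def by blast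
qed

section \<open>Coefficients of bounded variation\<close>

lemma AE_Ioo_ex:
  fixes a b :: real
  assumes "a < b" "AE x in lebesgue_on {a<..<b}. P x"
  obtains x where "x \<in> {a<..<b}" "P x"
proof -
  have "\<exists>x\<in>{a<..<b}. P x"
  proof (rule ccontr)
    assume no: "\<not> (\<exists>x\<in>{a<..<b}. P x)"
    have "AE x in lebesgue_on {a<..<b}. P x \<longrightarrow> False"
      by (rule AE_I2) (use no in auto)
    then have "AE x in lebesgue_on {a<..<b}. False" by (rule AE_mp[OF assms(2)])
    then have "emeasure (lebesgue_on {a<..<b}) (space (lebesgue_on {a<..<b})) = 0"
      unfolding ae_filter_eq_bot_iff[symmetric] trivial_limit_def .
    then show False using assms(1) by (simp add: emeasure_restrict_space)
  qed
  then show thesis using that by blast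
qed

text \<open>\<open>V x\<close> is the total variation up to x, taken over chains that end at x, so
  that an open interval without a first point causes no trouble. Appending y to a chain ending at x
  gives the increment; the chain consisting of x alone gives 0 \<le> V x.\<close>

lemma bounded_variation_on_majorant:
  assumes "bounded_variation_on I f"
  obtains V M where "\<And>x. x \<in> I \<Longrightarrow> 0 \<le> V x" "\<And>x. x \<in> I \<Longrightarrow> V x \<le> M"
    "\<And>x y. \<lbrakk>x \<in> I; y \<in> I; x < y\<rbrakk> \<Longrightarrow> \<bar>f y - f x\<bar> \<le> V y - V x"
proof -
  obtain M where M: "\<And>(z :: nat \<Rightarrow> real) n. \<lbrakk>\<And>i. i \<le> n \<Longrightarrow> z i \<in> I; \<And>i. i < n \<Longrightarrow> z i < z (Suc i)\<rbrakk> \<Longrightarrow>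
      (\<Sum>i<n. \<bar>f (z (Suc i)) - f (z i)\<bar>) \<le> M"
    using assms unfolding bounded_variation_on_def by metis
  define S where "S x = {\<Sum>i<n. \<bar>f (z (Suc i)) - f (z i)\<bar> | (z :: nat \<Rightarrow> real) n.
      (\<forall>i\<le>n. z i \<in> I) \<and> (\<forall>i<n. z i < z (Suc i)) \<and> z n = x}" for x
  have SM: "s \<le> M" if "s \<in> S x" for s x using that M unfolding S_def by blast
  have bdd: "bdd_above (S x)" for x using SM by (meson bdd_aboveI)
  have S0: "0 \<in> S x" if "x \<in> I" for x
    unfolding S_def using that by (intro CollectI exI[of _ "\<lambda>_. x"] exI[of _ 0]) auto
  show thesis
  proof (rule that[of "\<lambda>x. Sup (S x)" M])
    fix x y assume xy: "x \<in> I" "y \<in> I" "x < y"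
    have "s \<le> Sup (S y) - \<bar>f y - f x\<bar>" if "s \<in> S x" for s
    proof -
      obtain z :: "nat \<Rightarrow> real" and n where z: "s = (\<Sum>i<n. \<bar>f (z (Suc i)) - f (z i)\<bar>)"
        "\<And>i. i \<le> n \<Longrightarrow> z i \<in> I" "\<And>i. i < n \<Longrightarrow> z i < z (Suc i)" "z n = x"
        using \<open>s \<in> S x\<close> unfolding S_def by blast
      define z' where "z' = z(Suc n := y)"
      have "(\<Sum>i<Suc n. \<bar>f (z' (Suc i)) - f (z' i)\<bar>) = s + \<bar>f y - f x\<bar>"
        using z by (simp add: z'_def)
      moreover have "(\<Sum>i<Suc n. \<bar>f (z' (Suc i)) - f (z' i)\<bar>) \<in> S y"
        unfolding S_def using z xy
        by (intro CollectI exI[of _ z'] exI[of _ "Suc n"]) (auto simp: z'_def less_Suc_eq)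
      ultimately show ?thesis using cSup_upper[OF _ bdd, of "s + \<bar>f y - f x\<bar>" y] by simp
    qed
    then have "Sup (S x) \<le> Sup (S y) - \<bar>f y - f x\<bar>"
      using S0[OF xy(1)] by (intro cSup_least) auto
    then show "\<bar>f y - f x\<bar> \<le> Sup (S y) - Sup (S x)" by simp
  next
    fix x assume "x \<in> I"
    then show "0 \<le> Sup (S x)" "Sup (S x) \<le> M"
      using cSup_upper[OF S0 bdd] cSup_least[of "S x" M] SM S0[of x] by blast+
  qed
qed

text \<open>A good representative lives on the whole line, so that the values at the endpoints of the
  interval and beyond cause no case distinctions; \<open>W\<close> jumps there.\<close>

lemma BV_fun_representative:
  assumes ab: "a < b" and f: "BV_fun a b f"
    and bounds: "AE x in lebesgue_on {a<..<b}. lo \<le> f x \<and> f x \<le> hi"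
  obtains g W where "mono W" "\<And>x y. x \<le> y \<Longrightarrow> \<bar>g y - g x\<bar> \<le> W y - W x"
    "\<And>x. lo \<le> g x" "\<And>x. g x \<le> hi" "AE x in lebesgue_on {a<..<b}. f x = g x"
proof -
  obtain g0 where g0: "bounded_variation_on {a<..<b} g0" "AE x in lebesgue_on {a<..<b}. f x = g0 x"
    using f unfolding BV_fun_def by blast
  obtain V M where V: "\<And>x. x \<in> {a<..<b} \<Longrightarrow> 0 \<le> V x" "\<And>x. x \<in> {a<..<b} \<Longrightarrow> V x \<le> M"
    "\<And>x y. \<lbrakk>x \<in> {a<..<b}; y \<in> {a<..<b}; x < y\<rbrakk> \<Longrightarrow> \<bar>g0 y - g0 x\<bar> \<le> V y - V x"
    using bounded_variation_on_majorant[OF g0(1)] by metis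
  obtain x0 where x0: "x0 \<in> {a<..<b}" "lo \<le> f x0 \<and> f x0 \<le> hi" by (rule AE_Ioo_ex[OF ab bounds])
  have lohi: "lo \<le> hi" using x0 by linarith
  have M0: "0 \<le> M" using V(1)[OF x0(1)] V(2)[OF x0(1)] by linarith
  \<comment> \<open>Truncation to [lo, hi] is 1-Lipschitz, so it does not increase the variation,
    and inside the interval it changes g0 only on a null set.\<close>
  define g where "g x = (if x \<in> {a<..<b} then max lo (min hi (g0 x)) else lo)" for x
  \<comment> \<open>As 0 \<le> V \<le> M inside, each jump of \<open>W\<close> at an endpoint is at
    least hi - lo and covers any change of g there.\<close>
  define W where "W x = (if x \<le> a then lo - hi else if b \<le> x then M + hi - lo else V x)" for x
  have gb: "lo \<le> g x" "g x \<le> hi" for x using lohi by (auto simp: g_def)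
  have gW: "\<bar>g y - g x\<bar> \<le> W y - W x" if "x \<le> y" for x y
  proof (cases "x \<in> {a<..<b} \<and> y \<in> {a<..<b}")
    case True
    then have "\<bar>g0 y - g0 x\<bar> \<le> V y - V x" using V(3)[of x y] that by (cases "x = y") auto
    moreover have "\<bar>max lo (min hi (g0 y)) - max lo (min hi (g0 x))\<bar> \<le> \<bar>g0 y - g0 x\<bar>"
      by (auto simp: max_def min_def)
    ultimately show ?thesis using True by (auto simp: g_def W_def)
  next
    case False
    have "\<bar>g y - g x\<bar> \<le> hi - lo" using gb[of x] gb[of y] by linarith
    moreover have 1: "hi - lo \<le> W y - W x" if "\<not> (x \<le> a \<and> y \<le> a)" "\<not> (b \<le> x \<and> b \<le> y)"
      using False that \<open>x \<le> y\<close> ab lohi M0 V(1)[of y] V(2)[of x]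
      by (cases "x \<le> a"; cases "b \<le> y") (auto simp: W_def)
    moreover have 2: "g x = g y \<and> W x = W y" if "(x \<le> a \<and> y \<le> a) \<or> (b \<le> x \<and> b \<le> y)"
      using that ab by (auto simp: g_def W_def)
    ultimately show ?thesis
    proof (cases "(x \<le> a \<and> y \<le> a) \<or> (b \<le> x \<and> b \<le> y)")
      case True
      then show ?thesis using 2 by simp
    next
      case False
      then have "hi - lo \<le> W y - W x" by (intro 1) auto
      then show ?thesis using \<open>\<bar>g y - g x\<bar> \<le> hi - lo\<close> by linarith
    qed
  qed
  show thesis
  proof (rule that[OF _ gW gb])
    show "mono W" by (rule monoI) (use gW in \<open>smt (verit) abs_ge_zero\<close>)
    show "AE x in lebesgue_on {a<..<b}. f x = g x"
      using g0(2) bounds AE_space by eventually_elim (auto simp: g_def)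
  qed
qed

lemma mono_tendsto_at_right:
  fixes G :: "real \<Rightarrow> real"
  assumes "mono G"
  obtains l where "(G \<longlongrightarrow> l) (at_right a)"
proof -
  define l where "l = Inf (G ` {a<..})"
  have bdd: "bdd_below (G ` {a<..})"
    using assms by (intro bdd_belowI[of _ "G a"]) (auto simp: mono_def)
  have "(G \<longlongrightarrow> l) (at_right a)"
  proof (rule order_tendstoI)
    fix u assume "u < l"
    then have "u < G x" if "a < x" for x
      using cInf_lower[OF _ bdd, of "G x"] that unfolding l_def by force
    then show "\<forall>\<^sub>F x in at_right a. u < G x" by (auto simp: eventually_at_right_field intro: exI[of _ "a + 1"])
  next
    fix u assume "l < u"
    then obtain x where x: "a < x" "G x < u"
      unfolding l_def using cInf_less_iff[OF _ bdd] by auto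
    then have "G y < u" if "a < y" "y < x" for y
      using monoD[OF assms, of y x] that by linarith
    then show "\<forall>\<^sub>F x in at_right a. G x < u" using x by (auto simp: eventually_at_right_field)
  qed
  then show thesis by (rule that)
qed

text \<open>Jordan decomposition: g is the difference of the monotone functions g + W and W.\<close>

lemma BV_representative_tendsto_at_right:
  fixes g W :: "real \<Rightarrow> real"
  assumes W: "mono W" and gW: "\<And>x y. x \<le> y \<Longrightarrow> \<bar>g y - g x\<bar> \<le> W y - W x"
  obtains l where "(g \<longlongrightarrow> l) (at_right a)"
proof -
  have "mono (\<lambda>x. g x + W x)" by (rule monoI) (use gW in \<open>smt (verit)\<close>)
  then obtain l1 where l1: "((\<lambda>x. g x + W x) \<longlongrightarrow> l1) (at_right a)" by (rule mono_tendsto_at_right)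
  obtain l2 where l2: "(W \<longlongrightarrow> l2) (at_right a)" using W by (rule mono_tendsto_at_right)
  show thesis using tendsto_diff[OF l1 l2] by (intro that) simp
qed

lemma BV_representative_measurable:
  fixes g W :: "real \<Rightarrow> real"
  assumes W: "mono W" and gW: "\<And>x y. x \<le> y \<Longrightarrow> \<bar>g y - g x\<bar> \<le> W y - W x"
  shows "g \<in> borel_measurable borel"
proof -
  have "mono (\<lambda>x. g x + W x)" by (rule monoI) (use gW in \<open>smt (verit)\<close>)
  then have "(\<lambda>x. (g x + W x) - W x) \<in> borel_measurable borel"
    using W by (intro borel_measurable_diff borel_measurable_mono)
  then show ?thesis by simp
qed

text \<open>The definition by \<open>THE\<close> calls for uniqueness: two distinct essential limits
  would contradict each other almost everywhere on an interval of positive length.\<close>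

lemma left_endpoint_value_eq:
  assumes ab: "a < b" and fg: "AE x in lebesgue_on {a<..<b}. f x = g x"
    and l: "(g \<longlongrightarrow> l) (at_right a)"
  shows "left_endpoint_value a f = l"
  unfolding left_endpoint_value_def
proof (rule the_equality)
  have fg': "AE x in lebesgue. x \<in> {a<..<b} \<longrightarrow> f x = g x" using fg by (simp add: AE_restrict_space_iff)
  show 1: "\<forall>e>0. \<exists>d>0. AE x in lebesgue. a < x \<and> x < a + d \<longrightarrow> \<bar>f x - l\<bar> < e"
  proof (intro allI impI)
    fix e :: real assume "0 < e"
    then have "\<forall>\<^sub>F x in at_right a. dist (g x) l < e" using l by (rule tendstoD[rotated])
    then obtain c where c: "a < c" "\<And>x. \<lbrakk>a < x; x < c\<rbrakk> \<Longrightarrow> \<bar>g x - l\<bar> < e"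
      unfolding eventually_at_right_field dist_real_def by blast
    show "\<exists>d>0. AE x in lebesgue. a < x \<and> x < a + d \<longrightarrow> \<bar>f x - l\<bar> < e"
    proof (intro exI conjI)
      show "0 < min (c - a) (b - a)" using c ab by simp
      show "AE x in lebesgue. a < x \<and> x < a + min (c - a) (b - a) \<longrightarrow> \<bar>f x - l\<bar> < e"
        using fg' by eventually_elim (use c in auto)
    qed
  qed
  fix l' assume 2: "\<forall>e>0. \<exists>d>0. AE x in lebesgue. a < x \<and> x < a + d \<longrightarrow> \<bar>f x - l'\<bar> < e"
  show "l' = l"
  proof (rule ccontr)
    assume "l' \<noteq> l"
    then have e: "0 < \<bar>l' - l\<bar> / 2" by simp
    obtain d1 where d1: "d1 > 0" "AE x in lebesgue. a < x \<and> x < a + d1 \<longrightarrow> \<bar>f x - l\<bar> < \<bar>l' - l\<bar> / 2"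
      using 1 e by blast
    obtain d2 where d2: "d2 > 0" "AE x in lebesgue. a < x \<and> x < a + d2 \<longrightarrow> \<bar>f x - l'\<bar> < \<bar>l' - l\<bar> / 2"
      using 2 e by blast
    have "AE x in lebesgue. x \<in> {a<..<a + min d1 d2} \<longrightarrow> False"
      using d1(2) d2(2)
    proof eventually_elim
      case (elim x)
      have "\<bar>l' - l\<bar> \<le> \<bar>f x - l\<bar> + \<bar>f x - l'\<bar>" by linarith
      then show ?case using elim by auto
    qed
    then have "AE x in lebesgue_on {a<..<a + min d1 d2}. False" by (simp add: AE_restrict_space_iff)
    then show False using d1(1) d2(1) AE_Ioo_ex[of a "a + min d1 d2" "\<lambda>_. False"] by auto
  qed
qed

section \<open>Almost everywhere representatives and the maximal slowness\<close>

lemma borel_measurable_lebesgue_on_AE: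
  fixes f g :: "real \<Rightarrow> real"
  assumes S: "S \<in> sets lebesgue" and g: "g \<in> borel_measurable (lebesgue_on S)"
    and fg: "AE x in lebesgue_on S. f x = g x"
  shows "f \<in> borel_measurable (lebesgue_on S)"
proof -
  have "AE x in lebesgue. x \<in> S \<longrightarrow> f x = g x" using fg S by (simp add: AE_restrict_space_iff)
  then have "AE x in lebesgue. (if x \<in> S then g x else 0) = (if x \<in> S then f x else 0)"
    by eventually_elim simp
  then have "(\<lambda>x. if x \<in> S then f x else 0) \<in> borel_measurable lebesgue"
    by (rule borel_measurable_AE[OF iffD2[OF borel_measurable_if[OF S] g]])
  then show ?thesis by (rule iffD1[OF borel_measurable_if[OF S]])
qed

lemma borel_measurable_lebesgue_on: "g \<in> borel_measurable borel \<Longrightarrow> g \<in> borel_measurable (lebesgue_on S)"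
  by (rule measurable_restrict_space1, rule measurable_completion) simp

text \<open>The essential supremum is over the closed interval, the hypotheses are on the open one;
  the endpoints are null. The bounds on the coefficients keep the supremum finite, so
  \<open>real_of_ereal\<close>, which sends infinite values to 0, loses nothing.\<close>

lemma max_slowness_bound:
  assumes L: "0 < L"
    and \<rho>: "0 < \<rho>\<^sub>0" "AE x in lebesgue_on {0<..<L}. \<rho>\<^sub>0 \<le> \<rho> x \<and> \<rho> x \<le> \<rho>\<^sub>1"
    and a: "0 < a\<^sub>0" "AE x in lebesgue_on {0<..<L}. a\<^sub>0 \<le> a x \<and> a x \<le> a\<^sub>1"
    and r: "r \<in> borel_measurable borel" "AE x in lebesgue_on {0<..<L}. \<rho> x = r x"
    and g: "g \<in> borel_measurable borel" "AE x in lebesgue_on {0<..<L}. a x = g x"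
  shows "0 < max_slowness L \<rho> a"
    "AE x in lebesgue_on {0<..<L}. \<rho> x \<le> (max_slowness L \<rho> a)\<^sup>2 * a x"
proof -
  define F where "F x = ereal (sqrt (\<rho> x / a x))" for x
  have endp: "AE x in lebesgue. x \<noteq> 0 \<and> x \<noteq> L"
  proof -
    have "AE x in lebesgue. x \<noteq> c" for c :: real by (rule AE_completion, rule AE_lborel_singleton)
    then show ?thesis by (simp add: eventually_conj)
  qed
  have Icc: "AE x in lebesgue_on {0..L}. P x" if "AE x in lebesgue_on {0<..<L}. P x" for P
  proof -
    have "AE x in lebesgue. x \<in> {0<..<L} \<longrightarrow> P x" using that by (simp add: AE_restrict_space_iff)
    then have "AE x in lebesgue. x \<in> {0..L} \<longrightarrow> P x" using endp by eventually_elim auto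
    then show ?thesis by (simp add: AE_restrict_space_iff)
  qed
  have Ioo: "AE x in lebesgue_on {0<..<L}. P x" if "AE x in lebesgue_on {0..L}. P x" for P
  proof -
    have "AE x in lebesgue. x \<in> {0..L} \<longrightarrow> P x" using that by (simp add: AE_restrict_space_iff)
    then have "AE x in lebesgue. x \<in> {0<..<L} \<longrightarrow> P x" by eventually_elim auto
    then show ?thesis by (simp add: AE_restrict_space_iff)
  qed
  have Fm: "F \<in> borel_measurable (lebesgue_on {0..L})"
  proof -
    have "AE x in lebesgue_on {0..L}. sqrt (\<rho> x / a x) = sqrt (r x / g x)"
      using Icc[OF r(2)] Icc[OF g(2)] by eventually_elim simp
    moreover have "(\<lambda>x. sqrt (r x / g x)) \<in> borel_measurable borel" using r(1) g(1) by measurable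
    ultimately have "(\<lambda>x. sqrt (\<rho> x / a x)) \<in> borel_measurable (lebesgue_on {0..L})"
      by (intro borel_measurable_lebesgue_on_AE[OF _ borel_measurable_lebesgue_on]) auto
    then show ?thesis unfolding F_def by measurable
  qed
  have le: "esssup (lebesgue_on {0..L}) F \<le> ereal (sqrt (\<rho>\<^sub>1 / a\<^sub>0))"
  proof (rule esssup_I[OF Fm])
    show "AE x in lebesgue_on {0..L}. F x \<le> ereal (sqrt (\<rho>\<^sub>1 / a\<^sub>0))"
      using Icc[OF \<rho>(2)] Icc[OF a(2)] by eventually_elim (use \<rho>(1) a(1) in \<open>auto simp: F_def intro!: frac_le\<close>)
  qed
  have ae: "AE x in lebesgue_on {0<..<L}. F x \<le> esssup (lebesgue_on {0..L}) F"
    by (intro Ioo esssup_AE)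
  obtain x where x: "F x \<le> esssup (lebesgue_on {0..L}) F" "\<rho>\<^sub>0 \<le> \<rho> x" "a\<^sub>0 \<le> a x"
    using AE_Ioo_ex[OF L, of "\<lambda>x. F x \<le> esssup (lebesgue_on {0..L}) F \<and> \<rho>\<^sub>0 \<le> \<rho> x \<and> a\<^sub>0 \<le> a x"]
      ae \<rho>(2) a(2) by (auto simp: eventually_conj_iff elim: eventually_mono)
  have Fx: "0 < sqrt (\<rho> x / a x)" using x \<rho>(1) a(1) by simp
  have eq: "esssup (lebesgue_on {0..L}) F = ereal (max_slowness L \<rho> a)"
  proof -
    have "max_slowness L \<rho> a = real_of_ereal (esssup (lebesgue_on {0..L}) F)"
      by (simp add: max_slowness_def F_def[abs_def])
    then show ?thesis
      using le x(1) by (cases "esssup (lebesgue_on {0..L}) F") (auto simp: F_def)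
  qed
  have "sqrt (\<rho> x / a x) \<le> max_slowness L \<rho> a" using x(1) unfolding eq by (simp add: F_def)
  then show pos: "0 < max_slowness L \<rho> a" using Fx by linarith
  show "AE x in lebesgue_on {0<..<L}. \<rho> x \<le> (max_slowness L \<rho> a)\<^sup>2 * a x"
    using ae \<rho>(2) a(2)
  proof eventually_elim
    case (elim x)
    then have "sqrt (\<rho> x / a x) \<le> max_slowness L \<rho> a" by (simp add: eq F_def)
    then have "(sqrt (\<rho> x / a x))\<^sup>2 \<le> (max_slowness L \<rho> a)\<^sup>2"
      using elim \<rho>(1) a(1) by (intro power_mono) auto
    then show ?case using elim \<rho>(1) a(1) by (simp add: field_simps)
  qed
qed

section \<open>From a finite-energy solution to a sidewise system\<close>

lemma L2_norm_mult_bounded: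
  assumes f: "L2_fun a b f" and h: "h \<in> borel_measurable (lebesgue_on {a<..<b})"
    and C: "\<And>x. \<bar>h x\<bar> \<le> C"
  shows "L2_norm a b (\<lambda>x. h x * f x) \<le> C * L2_norm a b f"
proof -
  have C0: "0 \<le> C" using C[of undefined] by linarith
  have "(\<integral>x. (h x * f x)\<^sup>2 \<partial>lebesgue_on {a<..<b}) \<le> (\<integral>x. C\<^sup>2 * (f x)\<^sup>2 \<partial>lebesgue_on {a<..<b})"
  proof (rule Bochner_Integration.integral_mono)
    have "L2_fun a b (\<lambda>x. h x * f x)" using C by (intro L2_fun_mult_bounded[OF f h, of C]) auto
    then show "integrable (lebesgue_on {a<..<b}) (\<lambda>x. (h x * f x)\<^sup>2)" by (simp add: L2_fun_def)
    show "integrable (lebesgue_on {a<..<b}) (\<lambda>x. C\<^sup>2 * (f x)\<^sup>2)" using f by (simp add: L2_fun_def)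
    fix x
    have "(h x)\<^sup>2 \<le> C\<^sup>2" using C[of x] by (metis abs_ge_zero power2_abs power_mono)
    then show "(h x * f x)\<^sup>2 \<le> C\<^sup>2 * (f x)\<^sup>2" by (simp add: power_mult_distrib mult_right_mono)
  qed
  then have "sqrt (\<integral>x. (h x * f x)\<^sup>2 \<partial>lebesgue_on {a<..<b}) \<le> sqrt (C\<^sup>2 * (\<integral>x. (f x)\<^sup>2 \<partial>lebesgue_on {a<..<b}))"
    by (intro real_sqrt_le_mono) simp
  then show ?thesis using C0 by (simp add: L2_norm_def real_sqrt_mult)
qed

text \<open>Continuity in the energy norm arrives as continuity in t that is uniform in x; this
  upgrades separate continuity to joint continuity.\<close>

lemma continuous_on_strip:
  fixes F :: "real \<Rightarrow> real \<Rightarrow> real"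
  assumes x: "\<And>t. 0 \<le> t \<Longrightarrow> continuous_on {0..L} (\<lambda>x. F x t)"
    and t: "\<And>t e. \<lbrakk>0 \<le> t; 0 < e\<rbrakk> \<Longrightarrow> \<forall>\<^sub>F s in at t within {0..}. \<forall>x\<in>{0..L}. \<bar>F x s - F x t\<bar> \<le> e"
  shows "continuous_on ({0..L} \<times> {0..}) (\<lambda>z. F (fst z) (snd z))"
proof (rule continuous_on_iff[THEN iffD2], intro ballI allI impI)
  fix z :: "real \<times> real" and e :: real assume z: "z \<in> {0..L} \<times> {0..}" and e: "0 < e"
  obtain x0 t0 where z0: "z = (x0, t0)" "x0 \<in> {0..L}" "0 \<le> t0" using z by auto
  obtain d1 where d1: "d1 > 0" "\<And>x. \<lbrakk>x \<in> {0..L}; dist x x0 < d1\<rbrakk> \<Longrightarrow> dist (F x t0) (F x0 t0) < e / 2"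
    using x[OF z0(3), unfolded continuous_on_iff, rule_format, OF z0(2), of "e / 2"] e by auto
  obtain d2 where d2: "d2 > 0" "\<And>s x. \<lbrakk>0 \<le> s; dist s t0 < d2; x \<in> {0..L}\<rbrakk> \<Longrightarrow> \<bar>F x s - F x t0\<bar> \<le> e / 3"
  proof -
    obtain d where d: "d > 0" "\<And>s. \<lbrakk>s \<in> {0..}; s \<noteq> t0; dist s t0 < d\<rbrakk> \<Longrightarrow> \<forall>x\<in>{0..L}. \<bar>F x s - F x t0\<bar> \<le> e / 3"
      using t[OF z0(3), of "e / 3"] e unfolding eventually_at by auto
    show thesis
    proof (rule that[OF d(1)])
      fix s x assume "0 \<le> s" "dist s t0 < d" "x \<in> {0..L}"
      then show "\<bar>F x s - F x t0\<bar> \<le> e / 3" using d(2)[of s] e by (cases "s = t0") auto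
    qed
  qed
  show "\<exists>d>0. \<forall>z'\<in>{0..L} \<times> {0..}. dist z' z < d \<longrightarrow> dist (F (fst z') (snd z')) (F (fst z) (snd z)) < e"
  proof (intro exI[of _ "min d1 d2"] conjI ballI impI)
    fix z' assume z': "z' \<in> {0..L} \<times> {0..}" "dist z' z < min d1 d2"
    obtain x' t' where z'0: "z' = (x', t')" "x' \<in> {0..L}" "0 \<le> t'" using z' by auto
    have "dist x' x0 < d1" "dist t' t0 < d2"
      using z'(2) dist_fst_le[of z' z] dist_snd_le[of z' z] by (auto simp: z0 z'0)
    then have "dist (F x' t0) (F x0 t0) < e / 2" "\<bar>F x' t' - F x' t0\<bar> \<le> e / 3"
      using d1(2) d2(2) z'0 by auto
    then show "dist (F (fst z') (snd z')) (F (fst z) (snd z)) < e"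
      using e unfolding z0(1) z'0(1) dist_real_def fst_conv snd_conv by linarith
  qed (use d1 d2 in auto)
qed

text \<open>A continuous time derivative is bounded on compact strips, which makes F Lipschitz in t
  uniformly in x.\<close>

lemma continuous_on_strip_antiderivative:
  fixes F F' :: "real \<Rightarrow> real \<Rightarrow> real"
  assumes x: "\<And>t. 0 \<le> t \<Longrightarrow> continuous_on {0..L} (\<lambda>x. F x t)"
    and F': "continuous_on ({0..L} \<times> {0..}) (\<lambda>z. F' (fst z) (snd z))"
    and d: "\<And>x t. \<lbrakk>x \<in> {0..L}; 0 \<le> t\<rbrakk> \<Longrightarrow> (F x has_real_derivative F' x t) (at t within {0..})"
  shows "continuous_on ({0..L} \<times> {0..}) (\<lambda>z. F (fst z) (snd z))"
proof (rule continuous_on_strip[OF x])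
  fix t e :: real assume t: "0 \<le> t" and e: "0 < e"
  obtain M where M: "0 \<le> M" "\<And>x s. \<lbrakk>x \<in> {0..L}; s \<in> {0..t + 1}\<rbrakk> \<Longrightarrow> \<bar>F' x s\<bar> \<le> M"
    using continuous_strip_bounded[OF F', where R = "t + 1"] by blast
  have lip: "\<bar>F x s - F x t\<bar> \<le> M * \<bar>s - t\<bar>" if "x \<in> {0..L}" "s \<in> {0..t + 1}" for x s
  proof -
    have "norm (F x s - F x t) \<le> M * norm (s - t)"
    proof (rule field_differentiable_bound)
      show "(F x has_field_derivative F' x r) (at r within {0..t + 1})" if "r \<in> {0..t + 1}" for r
        using that \<open>x \<in> {0..L}\<close> by (intro DERIV_subset[OF d]) auto
    qed (use that t M in auto)
    then show ?thesis by simp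
  qed
  define \<delta> where "\<delta> = min 1 (e / (M + 1))"
  have \<delta>: "0 < \<delta>" "M * \<delta> \<le> e"
  proof -
    show "0 < \<delta>" using e M by (simp add: \<delta>_def)
    have "M * \<delta> \<le> (M + 1) * (e / (M + 1))" using M e by (intro mult_mono) (auto simp: \<delta>_def)
    then show "M * \<delta> \<le> e" using M by simp
  qed
  show "\<forall>\<^sub>F s in at t within {0..}. \<forall>x\<in>{0..L}. \<bar>F x s - F x t\<bar> \<le> e"
    unfolding eventually_at
  proof (intro exI[of _ \<delta>] conjI ballI impI \<delta>)
    fix s x assume s: "s \<in> {0..}" "s \<noteq> t \<and> dist s t < \<delta>" and x: "x \<in> {0..L}"
    then have "\<bar>F x s - F x t\<bar> \<le> M * \<bar>s - t\<bar>"
      by (intro lip) (auto simp: \<delta>_def dist_real_def)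
    also have "\<dots> \<le> M * \<delta>" using s M by (intro mult_left_mono) (auto simp: dist_real_def)
    finally show "\<bar>F x s - F x t\<bar> \<le> e" using \<delta> by linarith
  qed
qed

text \<open>The oriented integral from t to T. The difference form remains an antiderivative of -f
  beyond T, where \<open>integral {t..T} f\<close> would be 0.\<close>

definition time_tail :: "real \<Rightarrow> (real \<Rightarrow> real) \<Rightarrow> real \<Rightarrow> real" where
  "time_tail T f t = integral {0..T} f - integral {0..t} f"

lemma time_tail_has_derivative:
  assumes f: "continuous_on {0..} f" and t: "0 \<le> t"
  shows "(time_tail T f has_real_derivative - f t) (at t within {0..})"
proof -
  have "((\<lambda>t. integral {0..t} f) has_real_derivative f t) (at t within {0..t + 1})"
    using t by (intro integral_has_real_derivative continuous_on_subset[OF f]) auto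
  moreover have "at t within {0..t + 1} = at t within {0..}"
    by (rule at_within_nhd[of _ "{..<t + 1}"]) auto
  ultimately have "((\<lambda>t. integral {0..t} f) has_real_derivative f t) (at t within {0..})" by simp
  then show ?thesis unfolding time_tail_def[abs_def] by (auto intro!: derivative_eq_intros)
qed

lemma time_tail_interval:
  assumes "\<And>s. 0 \<le> s \<Longrightarrow> f integrable_on {0..s}" "0 \<le> t" "t \<le> s"
  shows "(f has_integral (time_tail T f t - time_tail T f s)) {t..s}"
proof -
  have "f integrable_on {t..s}" by (rule integrable_on_subinterval[OF assms(1)[of s]]) (use assms in auto)
  moreover have "integral {0..t} f + integral {t..s} f = integral {0..s} f"
    using assms by (intro Henstock_Kurzweil_Integration.integral_combine) auto
  ultimately show ?thesis by (simp add: has_integral_iff time_tail_def)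
qed

lemma time_tail_eq_0:
  assumes "\<And>s. T < s \<Longrightarrow> f s = 0" "0 \<le> T" "T \<le> t" "\<And>s. 0 \<le> s \<Longrightarrow> f integrable_on {0..s}"
  shows "time_tail T f t = 0"
proof -
  have "(f has_integral 0) {T..t}"
    by (rule has_integral_spike_finite[of "{T}" _ _ "\<lambda>_. 0"]) (use assms in auto)
  moreover have "(f has_integral (time_tail T f T - time_tail T f t)) {T..t}"
    using assms by (intro time_tail_interval) auto
  ultimately have "time_tail T f T - time_tail T f t = 0" by (rule has_integral_unique[rotated])
  then show ?thesis by (simp add: time_tail_def)
qed

lemma continuous_time_tail:
  assumes "\<And>s. 0 \<le> s \<Longrightarrow> f integrable_on {0..s}"
  shows "continuous_on {0..} (time_tail T f)"
proof (rule continuous_on_eq_continuous_within[THEN iffD2], rule ballI)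
  fix t :: real assume t: "t \<in> {0..}"
  have "continuous_on {0..t + 1} (\<lambda>t. integral {0..t} f)"
    using assms[of "t + 1"] t by (intro indefinite_integral_continuous_1) auto
  then have "continuous (at t within {0..t + 1}) (\<lambda>t. integral {0..t} f)"
    using t by (auto simp: continuous_on_eq_continuous_within)
  moreover have "at t within {0..t + 1} = at t within {0..}"
    by (rule at_within_nhd[of _ "{..<t + 1}"]) auto
  ultimately have "continuous (at t within {0..}) (\<lambda>t. integral {0..t} f)" by simp
  then show "continuous (at t within {0..}) (time_tail T f)"
    unfolding time_tail_def[abs_def] by (intro continuous_intros)
qed

lemma at_within_nonneg:
  assumes "t < T"
  shows "at t within {0..} = at t within {0..T::real}"
  by (rule at_within_nhd[of _ "{..<T}"]) (use assms in auto)

lemma at_within_nonneg_split: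
  assumes "0 \<le> T"
  shows "at t within {0..} = sup (at t within {0..T::real}) (at t within {T<..})"
proof -
  have "{0..} = {0..T} \<union> {T<..}" using assms by auto
  then show ?thesis by (simp add: at_within_union)
qed

text \<open>Here \<open>r\<close> and \<open>\<alpha>\<close> are the everywhere defined bounded representatives of \<open>\<rho>\<close> and \<open>1/a\<close>.\<close>

locale wave_solution =
  fixes L T C :: real and \<rho> a \<alpha> r s q :: "real \<Rightarrow> real" and \<psi> :: "real \<Rightarrow> real \<Rightarrow> real"
  assumes L: "0 < L" and T: "0 < T"
    and sol: "finite_energy_solution L T \<rho> a s \<psi>" and trace: "is_flux_trace L T \<rho> a \<psi> q"
    and meas: "\<alpha> \<in> borel_measurable borel" "r \<in> borel_measurable borel"
    and bdd: "\<And>x. \<bar>\<alpha> x\<bar> \<le> C" "\<And>x. \<bar>r x\<bar> \<le> C"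
    and \<rho>r: "AE x in lebesgue_on {0<..<L}. \<rho> x = r x"
    and a\<alpha>: "AE x in lebesgue_on {0<..<L}. a x = 1 / \<alpha> x"
    and \<alpha>0: "\<And>x. 0 < \<alpha> x"
begin

abbreviation "velocity \<equiv> time_deriv L T \<psi>"

lemma C0: "0 \<le> C" using bdd(1)[of 0] by linarith

lemma energy: "finite_energy L T \<psi>"
  using sol by (simp add: finite_energy_solution_def)

lemma H1: "t \<in> {0..T} \<Longrightarrow> H1_fun 0 L (\<psi> t)"
  using energy by (simp add: finite_energy_def)

lemma H1_tendsto: "t \<in> {0..T} \<Longrightarrow> ((\<lambda>r. H1_norm 0 L (\<lambda>x. \<psi> r x - \<psi> t x)) \<longlongrightarrow> 0) (at t within {0..T})"
  using energy by (simp add: finite_energy_def)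

lemma has_time_deriv_velocity: "t \<in> {0..T} \<Longrightarrow> has_time_deriv L T \<psi> t (velocity t)"
  using energy by (simp add: finite_energy_def)

lemma velocity_L2: "t \<in> {0..T} \<Longrightarrow> L2_fun 0 L (velocity t)"
  using has_time_deriv_velocity by (simp add: has_time_deriv_def)

lemma velocity_tendsto:
  "t \<in> {0..T} \<Longrightarrow> ((\<lambda>r. L2_norm 0 L (\<lambda>x. velocity r x - velocity t x)) \<longlongrightarrow> 0) (at t within {0..T})"
  using energy by (simp add: finite_energy_def)

lemma measurable_coeff:
  "\<alpha> \<in> borel_measurable (lebesgue_on S)" "r \<in> borel_measurable (lebesgue_on S)"
  using meas by (auto intro: borel_measurable_lebesgue_on)

lemma measurable_a: "a \<in> borel_measurable (lebesgue_on {0<..<L})"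
  and measurable_\<rho>: "\<rho> \<in> borel_measurable (lebesgue_on {0<..<L})"
proof -
  have "(\<lambda>x. 1 / \<alpha> x) \<in> borel_measurable borel" using meas by measurable
  then show "a \<in> borel_measurable (lebesgue_on {0<..<L})"
    by (intro borel_measurable_lebesgue_on_AE[OF _ borel_measurable_lebesgue_on a\<alpha>]) auto
  show "\<rho> \<in> borel_measurable (lebesgue_on {0<..<L})"
    by (intro borel_measurable_lebesgue_on_AE[OF _ measurable_coeff(2) \<rho>r]) auto
qed

lemma L2_density: "L2_fun 0 L f \<Longrightarrow> L2_fun 0 L (\<lambda>x. r x * f x)"
  using bdd by (intro L2_fun_mult_bounded[OF _ measurable_coeff(2), of _ _ _ C]) auto

lemma density_integral_bound:
  assumes "L2_fun 0 L f" "y \<in> {0..L}"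
  shows "\<bar>integral {0..y} (\<lambda>x. r x * f x)\<bar> \<le> sqrt L * C * L2_norm 0 L f"
proof -
  have "\<bar>integral {0..y} (\<lambda>x. r x * f x)\<bar> \<le> sqrt (y - 0) * L2_norm 0 L (\<lambda>x. r x * f x)"
    using assms by (intro L2_fun_integral_bound L2_density) auto
  also have "\<dots> \<le> sqrt L * (C * L2_norm 0 L f)"
    using assms L2_norm_mult_bounded[OF assms(1) measurable_coeff(2) bdd(2)]
    by (intro mult_mono) (auto simp: L2_norm_nonneg)
  finally show ?thesis by simp
qed

lemma density_integrable:
  assumes "L2_fun 0 L f" "0 \<le> x" "y \<le> L"
  shows "(\<lambda>x. r x * f x) integrable_on {x..y}"
  using assms by (intro integrable_Ioo_subinterval[OF L2_fun_integrable[OF L2_density]]) auto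

text \<open>The extension by zero past T stays continuous because the final state is zero.\<close>

definition wave :: "real \<Rightarrow> real \<Rightarrow> real" where
  "wave x t = (if t \<le> T then \<psi> t x else 0)"

text \<open>Formally, integrating the wave equation over [0, y] says that the second time derivative
  of \<open>momentum y\<close> is a \<psi>_x at y minus a \<psi>_x at 0.\<close>

definition momentum :: "real \<Rightarrow> real \<Rightarrow> real" where
  "momentum y t = integral {0..y} (\<lambda>x. r x * wave x t)"

definition momentum' :: "real \<Rightarrow> real \<Rightarrow> real" where
  "momentum' y t = (if t \<le> T then integral {0..y} (\<lambda>x. r x * velocity t x) else 0)"

definition flux :: "real \<Rightarrow> real" where
  "flux t = (if t \<le> T then q t else 0)"

lemma final_zero:
  assumes "x \<in> {0..L}" shows "\<psi> T x = 0"
proof (rule continuous_constant_on_closure[of "{0<..<L}" "\<psi> T" 0 x])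
  show "continuous_on (closure {0<..<L}) (\<psi> T)"
    using H1_fun_continuous[OF H1[of T]] L T by (simp add: closure_greaterThanLessThan)
  show "\<psi> T x = 0" if "x \<in> {0<..<L}" for x
    using sol that by (simp add: finite_energy_solution_def)
qed (use assms L in \<open>simp add: closure_greaterThanLessThan\<close>)

lemma wave_final: "x \<in> {0..L} \<Longrightarrow> T \<le> t \<Longrightarrow> wave x t = 0"
  using final_zero by (cases "t = T") (auto simp: wave_def)

lemma momentum'_final: "y \<in> {0..L} \<Longrightarrow> T \<le> t \<Longrightarrow> momentum' y t = 0"
proof (cases "t = T")
  case True
  assume y: "y \<in> {0..L}"
  have "AE x in lebesgue_on {0<..<L}. velocity T x = 0"
    using sol by (simp add: finite_energy_solution_def)
  then have "L2_norm 0 L (velocity T) = L2_norm 0 L (\<lambda>x. 0)"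
    using velocity_L2[of T] T L2_fun_cmult[OF velocity_L2[of T], of 0] by (intro L2_norm_AE_cong) auto
  then have "L2_norm 0 L (velocity T) = 0" by (simp add: L2_norm_def)
  then show ?thesis
    using density_integral_bound[OF velocity_L2[of T] y] T True by (simp add: momentum'_def)
qed (simp add: momentum'_def)

lemma momentum_final: "y \<in> {0..L} \<Longrightarrow> T \<le> t \<Longrightarrow> momentum y t = 0"
proof -
  assume "y \<in> {0..L}" "T \<le> t"
  then have "momentum y t = integral {0..y} (\<lambda>x. 0)"
    unfolding momentum_def by (intro Henstock_Kurzweil_Integration.integral_cong) (simp add: wave_final)
  then show "momentum y t = 0" by simp
qed

text \<open>At t = T the filter on the half line is the supremum of its two sides: the energy
  hypotheses govern the left one, vanishing the right one.\<close>

lemma eventually_within_split: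
  assumes "0 \<le> t" "t \<le> T \<Longrightarrow> \<forall>\<^sub>F s in at t within {0..T}. P s" "\<And>s. T < s \<Longrightarrow> T \<le> t \<Longrightarrow> P s"
  shows "\<forall>\<^sub>F s in at t within {0..}. P s"
proof -
  consider "t < T" | "t = T" | "T < t" by linarith
  then show ?thesis
  proof cases
    case 1
    then show ?thesis using assms(2) at_within_nonneg[OF 1] by simp
  next
    case 2
    have "\<forall>\<^sub>F s in at T within {T<..}. P s"
      using assms(3) 2 by (auto simp: eventually_at_filter)
    then show ?thesis using assms(2) 2 T unfolding at_within_nonneg_split[OF less_imp_le[OF T]]
      by (simp add: eventually_sup)
  next
    case 3
    then have "\<forall>\<^sub>F s in nhds t. T < s" by (intro eventually_nhds_in_open[of "{T<..}", simplified]) auto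
    then show ?thesis using assms(3) 3 by (auto simp: eventually_at_filter elim!: eventually_mono)
  qed
qed

text \<open>H1 continuity in time is uniform in x by \<open>H1_fun_pointwise_bound\<close>.\<close>

lemma wave_continuous: "continuous_on ({0..L} \<times> {0..}) (\<lambda>z. wave (fst z) (snd z))"
proof (rule continuous_on_strip)
  show "continuous_on {0..L} (\<lambda>x. wave x t)" if "0 \<le> t" for t
    using H1_fun_continuous[OF H1[of t]] that by (cases "t \<le> T") (auto simp: wave_def)
  fix t e :: real assume t: "0 \<le> t" and e: "0 < e"
  show "\<forall>\<^sub>F u in at t within {0..}. \<forall>x\<in>{0..L}. \<bar>wave x u - wave x t\<bar> \<le> e"
  proof (rule eventually_within_split[OF t])
    assume tT: "t \<le> T"
    define K where "K = sqrt (2 / (L - 0) + 2 * (L - 0))"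
    have K: "0 < K" using L by (simp add: K_def add_pos_pos)
    have "\<forall>\<^sub>F u in at t within {0..T}. H1_norm 0 L (\<lambda>x. \<psi> u x - \<psi> t x) < e / K"
      using H1_tendsto[of t] t tT K e by (intro order_tendstoD) auto
    moreover have "\<forall>\<^sub>F u in at t within {0..T}. u \<in> {0..T}"
      by (simp add: eventually_at_filter)
    ultimately show "\<forall>\<^sub>F u in at t within {0..T}. \<forall>x\<in>{0..L}. \<bar>wave x u - wave x t\<bar> \<le> e"
    proof eventually_elim
      case (elim u)
      show ?case
      proof
        fix x assume x: "x \<in> {0..L}"
        have "\<bar>\<psi> u x - \<psi> t x\<bar> \<le> K * H1_norm 0 L (\<lambda>x. \<psi> u x - \<psi> t x)"
          unfolding K_def using H1_fun_pointwise_bound[OF H1_fun_diff[OF H1 H1], of u t x] elim t tT x L by auto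
        also have "\<dots> \<le> K * (e / K)" using elim K by (intro mult_left_mono) auto
        finally show "\<bar>wave x u - wave x t\<bar> \<le> e" using K elim tT by (simp add: wave_def)
      qed
    qed
  qed (use e wave_final in auto)
qed

text \<open>L2 continuity of the velocity becomes uniform in y after integration against r, by
  \<open>density_integral_bound\<close>.\<close>

lemma momentum'_continuous: "continuous_on ({0..L} \<times> {0..}) (\<lambda>z. momentum' (fst z) (snd z))"
proof (rule continuous_on_strip)
  show "continuous_on {0..L} (\<lambda>y. momentum' y t)" if "0 \<le> t" for t
  proof (cases "t \<le> T")
    case True
    then have "continuous_on {0..L} (\<lambda>y. integral {0..y} (\<lambda>x. r x * velocity t x))"
      using that by (intro indefinite_integral_continuous_1 density_integrable velocity_L2) auto
    then show ?thesis using True by (simp add: momentum'_def)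
  qed (simp add: momentum'_def)
  fix t e :: real assume t: "0 \<le> t" and e: "0 < e"
  show "\<forall>\<^sub>F u in at t within {0..}. \<forall>y\<in>{0..L}. \<bar>momentum' y u - momentum' y t\<bar> \<le> e"
  proof (rule eventually_within_split[OF t])
    assume tT: "t \<le> T"
    define K where "K = sqrt L * C + 1"
    have K: "0 < K" using L C0 by (simp add: K_def add_nonneg_pos)
    have "\<forall>\<^sub>F u in at t within {0..T}. L2_norm 0 L (\<lambda>x. velocity u x - velocity t x) < e / K"
      using velocity_tendsto[of t] t tT K e by (intro order_tendstoD) auto
    moreover have "\<forall>\<^sub>F u in at t within {0..T}. u \<in> {0..T}"
      by (simp add: eventually_at_filter)
    ultimately show "\<forall>\<^sub>F u in at t within {0..T}. \<forall>y\<in>{0..L}. \<bar>momentum' y u - momentum' y t\<bar> \<le> e"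
    proof eventually_elim
      case (elim u)
      show ?case
      proof
        fix y assume y: "y \<in> {0..L}"
        have L2: "L2_fun 0 L (velocity u)" "L2_fun 0 L (velocity t)"
          using elim t tT by (auto intro: velocity_L2)
        have eq: "momentum' y u - momentum' y t = integral {0..y} (\<lambda>x. r x * (velocity u x - velocity t x))"
        proof -
          have i: "((\<lambda>x. r x * f x) has_integral integral {0..y} (\<lambda>x. r x * f x)) {0..y}" if "L2_fun 0 L f" for f
            using density_integrable[OF that, of 0 y] y by (simp add: integrable_integral)
          have "((\<lambda>x. r x * velocity u x - r x * velocity t x) has_integral (momentum' y u - momentum' y t)) {0..y}"
            using has_integral_diff[OF i[OF L2(1)] i[OF L2(2)]] elim tT by (simp add: momentum'_def)
          then show ?thesis unfolding right_diff_distrib[symmetric] by (rule integral_unique[symmetric])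
        qed
        have "\<bar>momentum' y u - momentum' y t\<bar> \<le> sqrt L * C * L2_norm 0 L (\<lambda>x. velocity u x - velocity t x)"
          unfolding eq by (intro density_integral_bound L2_fun_diff L2 y)
        also have "\<dots> \<le> K * (e / K)"
          using elim C0 L by (intro mult_mono) (auto simp: K_def L2_norm_nonneg)
        finally show "\<bar>momentum' y u - momentum' y t\<bar> \<le> e" using K by simp
      qed
    qed
  qed (use e momentum'_final in auto)
qed

lemma wave_L2: "0 \<le> t \<Longrightarrow> L2_fun 0 L (\<lambda>x. wave x t)"
proof (cases "t \<le> T")
  case True
  assume "0 \<le> t"
  then show ?thesis using H1[of t] True by (simp add: wave_def H1_fun_def)
next
  case False
  then show ?thesis by (simp add: wave_def L2_fun_def)
qed

text \<open>The velocity is an L2 limit of difference quotients of \<psi>, and integration against r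
  over [0, y] is bounded on L2. At T the quotients from the right are 0, and so is
  \<open>momentum' y T\<close>.\<close>

lemma momentum_derivative:
  assumes y: "y \<in> {0..L}" and t: "0 \<le> t"
  shows "(momentum y has_real_derivative momentum' y t) (at t within {0..})"
proof -
  have inner: "((\<lambda>u. (momentum y u - momentum y t) / (u - t)) \<longlongrightarrow> momentum' y t) (at t within {0..T})"
    if tT: "t \<le> T"
  proof -
    define K where "K = sqrt L * C"
    have lim: "((\<lambda>u. K * L2_norm 0 L (\<lambda>x. (\<psi> u x - \<psi> t x) / (u - t) - velocity t x)) \<longlongrightarrow> K * 0) (at t within {0..T})"
      using has_time_deriv_velocity[of t] t tT by (intro tendsto_mult_left) (simp add: has_time_deriv_def)
    have "((\<lambda>u. (momentum y u - momentum y t) / (u - t) - momentum' y t) \<longlongrightarrow> 0) (at t within {0..T})"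
    proof (rule Lim_null_comparison[OF _ lim[simplified]])
      have "\<forall>\<^sub>F u in at t within {0..T}. u \<in> {0..T} \<and> u \<noteq> t"
        by (simp add: eventually_at_filter)
      then show "\<forall>\<^sub>F u in at t within {0..T}. norm ((momentum y u - momentum y t) / (u - t) - momentum' y t)
          \<le> K * L2_norm 0 L (\<lambda>x. (\<psi> u x - \<psi> t x) / (u - t) - velocity t x)"
      proof eventually_elim
        case (elim u)
        have L2: "L2_fun 0 L (\<psi> u)" "L2_fun 0 L (\<psi> t)" "L2_fun 0 L (velocity t)"
          using elim t tT H1[of u] H1[of t] by (auto intro: velocity_L2 simp: H1_fun_def)
        have L2d: "L2_fun 0 L (\<lambda>x. (\<psi> u x - \<psi> t x) / (u - t) - velocity t x)"
          using L2_fun_diff[OF L2_fun_cmult[OF L2_fun_diff[OF L2(1,2)], of "1 / (u - t)"] L2(3)] by simp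
        have i: "((\<lambda>x. r x * f x) has_integral integral {0..y} (\<lambda>x. r x * f x)) {0..y}" if "L2_fun 0 L f" for f
          using density_integrable[OF that, of 0 y] y by (simp add: integrable_integral)
        have "((\<lambda>x. (r x * \<psi> u x - r x * \<psi> t x) / (u - t) - r x * velocity t x) has_integral
            (momentum y u - momentum y t) / (u - t) - momentum' y t) {0..y}"
          using has_integral_diff[OF has_integral_divide[OF has_integral_diff[OF i[OF L2(1)] i[OF L2(2)]], of "u - t"] i[OF L2(3)]]
            elim tT by (simp add: momentum_def momentum'_def wave_def)
        moreover have "(\<lambda>x. (r x * \<psi> u x - r x * \<psi> t x) / (u - t) - r x * velocity t x)
            = (\<lambda>x. r x * ((\<psi> u x - \<psi> t x) / (u - t) - velocity t x))"
          by (simp add: algebra_simps diff_divide_distrib)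
        ultimately have "(momentum y u - momentum y t) / (u - t) - momentum' y t
            = integral {0..y} (\<lambda>x. r x * ((\<psi> u x - \<psi> t x) / (u - t) - velocity t x))"
          by (simp add: has_integral_iff)
        then show ?case
          unfolding K_def using density_integral_bound[OF L2d y] by simp
      qed
    qed
    then show ?thesis by (simp add: LIM_zero_iff)
  qed
  consider "t < T" | "t = T" | "T < t" by linarith
  then show ?thesis
  proof cases
    case 1
    then show ?thesis using inner at_within_nonneg[OF 1] by (simp add: has_field_derivative_iff)
  next
    case 2
    have "((\<lambda>u. (momentum y u - momentum y T) / (u - T)) \<longlongrightarrow> momentum' y T) (at T within {T<..})"
    proof (rule tendsto_eventually)
      show "\<forall>\<^sub>F u in at T within {T<..}. (momentum y u - momentum y T) / (u - T) = momentum' y T"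
        using y by (simp add: eventually_at_filter momentum_final momentum'_final)
    qed
    then have "((\<lambda>u. (momentum y u - momentum y T) / (u - T)) \<longlongrightarrow> momentum' y T) (at T within {0..})"
      using inner 2 unfolding at_within_nonneg_split[OF less_imp_le[OF T]] by (simp add: filterlim_sup)
    then show ?thesis using 2 by (simp add: has_field_derivative_iff)
  next
    case 3
    have "((\<lambda>t. 0) has_real_derivative momentum' y t) (at t)" using 3 by (simp add: momentum'_def)
    then have "(momentum y has_real_derivative momentum' y t) (at t)"
      by (rule has_field_derivative_transform_within_open[where S = "{T<..}"])
         (use 3 y momentum_final in auto)
    then show ?thesis by (rule has_field_derivative_at_within)
  qed
qed

lemma q_L2: "L2_fun 0 T q" using trace by (simp add: is_flux_trace_def)

lemma flux_integrable: "flux integrable_on {0..b}"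
proof -
  have "q integrable_on {0..T}"
    by (rule integrable_Ioo_subinterval[OF L2_fun_integrable[OF q_L2]]) auto
  then have "(\<lambda>t. if t \<in> {0..T} then q t else 0) integrable_on UNIV"
    by (simp only: integrable_restrict_UNIV)
  then have "(\<lambda>t. if t \<in> {0..T} then q t else 0) integrable_on {0..b}"
    by (rule integrable_on_subinterval) auto
  then show ?thesis
    by (rule integrable_eq) (auto simp: flux_def)
qed

lemma continuous_time:
  assumes "continuous_on ({0..L} \<times> {0..}) (\<lambda>z. f (fst z) (snd z))" "y \<in> {0..L}"
  shows "continuous_on {0..} (f y :: real \<Rightarrow> real)"
proof -
  have "continuous_on {0..} (\<lambda>t. (y, t))" by (intro continuous_intros)
  then have "continuous_on {0..} (\<lambda>t. (\<lambda>z. f (fst z) (snd z)) (y, t))"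
    by (rule continuous_on_compose2[OF assms(1)]) (use assms in auto)
  then show ?thesis by simp
qed

lemma wave_integrable: "y \<in> {0..L} \<Longrightarrow> wave y integrable_on {0..b}"
  by (intro integrable_continuous_real continuous_on_subset[OF continuous_time[OF wave_continuous]]) auto

text \<open>The function \<open>w(x) = \<integral>\<^sub>x\<^sup>y \<alpha>\<close> (zero beyond \<open>y\<close>) is the test function that turns the stiffness
  term into a point value of \<open>\<psi>\<close>.\<close>

definition cutoff :: "real \<Rightarrow> real \<Rightarrow> real" where
  "cutoff y x = (if x < y then \<alpha> x else 0)"

definition test_fun :: "real \<Rightarrow> real \<Rightarrow> real" where
  "test_fun y x = integral {x..L} (cutoff y)"

text \<open>The quantity (\<rho> \<psi>_t, w) of the weak equation for w =
  \<open>test_fun y\<close>, with \<rho> replaced by its representative.\<close>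

definition pairing :: "real \<Rightarrow> real \<Rightarrow> real" where
  "pairing y t = (\<integral>x. r x * velocity t x * test_fun y x \<partial>lebesgue_on {0<..<L})"

lemma \<alpha>_L2: "L2_fun 0 L \<alpha>"
  by (rule L2_fun_bounded[OF measurable_coeff(1), where C = C]) (simp add: bdd(1))

lemma cutoff_L2:
  assumes "y \<in> {0..L}" shows "L2_fun 0 L (cutoff y)"
proof (rule L2_fun_bounded)
  show "cutoff y \<in> borel_measurable (lebesgue_on {0<..<L})"
    unfolding cutoff_def[abs_def]
    by (rule borel_measurable_integrable[OF integral_Ioo_below(1)[OF L2_fun_integrable[OF \<alpha>_L2] assms]])
  show "AE x in lebesgue_on {0<..<L}. \<bar>cutoff y x\<bar> \<le> C"
    using bdd(1) C0 by (intro AE_I2) (auto simp: cutoff_def)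
qed

text \<open>\<open>weak_deriv\<close> is a chosen function, determined only up to null sets; hence
  the slope -\<alpha> on (0, y) is available almost everywhere.\<close>

lemma test_fun_H1:
  assumes "y \<in> {0..L}"
  shows "H1_fun 0 L (test_fun y)" "AE x in lebesgue_on {0<..<L}. weak_deriv 0 L (test_fun y) x = - cutoff y x"
proof -
  note w = H1_fun_upper_integral[OF cutoff_L2[OF assms], folded test_fun_def]
  show H: "H1_fun 0 L (test_fun y)" using w(1) by (simp add: test_fun_def[abs_def])
  have "has_weak_deriv 0 L (test_fun y) (\<lambda>x. - cutoff y x)" using w(2) by (simp add: test_fun_def[abs_def])
  moreover have "integrable (lebesgue_on {0<..<L}) (\<lambda>x. - cutoff y x)"
    using L2_fun_integrable[OF cutoff_L2[OF assms]] by simp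
  ultimately show "AE x in lebesgue_on {0<..<L}. weak_deriv 0 L (test_fun y) x = - cutoff y x"
    by (intro weak_deriv_unique[OF H1_fun_continuous[OF H] L2_fun_integrable[OF H1_fun_weak_deriv(1)[OF H]]
          H1_fun_weak_deriv(2)[OF H]])
qed

lemma test_fun_0:
  assumes "y \<in> {0..L}" shows "test_fun y 0 = integral {0..y} \<alpha>"
proof -
  have "test_fun y 0 = (\<integral>x. cutoff y x \<partial>lebesgue_on {0<..<L})"
    unfolding test_fun_def by (rule integral_Ioo_eq[OF L2_fun_integrable[OF cutoff_L2[OF assms]], symmetric])
  also have "\<dots> = integral {0..y} \<alpha>"
    unfolding cutoff_def by (rule integral_Ioo_below(2)[OF L2_fun_integrable[OF \<alpha>_L2] assms])
  finally show ?thesis .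
qed

lemma test_fun_L2: "y \<in> {0..L} \<Longrightarrow> L2_fun 0 L (test_fun y)"
  using test_fun_H1(1) by (simp add: H1_fun_def)

lemma pairing_continuous:
  assumes y: "y \<in> {0..L}"
  shows "continuous_on {0..T} (pairing y)"
  unfolding continuous_on_def
proof
  fix t assume t: "t \<in> {0..T}"
  define N where "N = L2_norm 0 L (\<lambda>x. r x * test_fun y x)"
  have "((\<lambda>u. L2_norm 0 L (\<lambda>x. velocity u x - velocity t x) * N) \<longlongrightarrow> 0 * N) (at t within {0..T})"
    by (intro tendsto_mult_right velocity_tendsto t)
  then have lim: "((\<lambda>u. L2_norm 0 L (\<lambda>x. velocity u x - velocity t x) * N) \<longlongrightarrow> 0) (at t within {0..T})"
    by simp
  have "((\<lambda>u. pairing y u - pairing y t) \<longlongrightarrow> 0) (at t within {0..T})"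
  proof (rule Lim_null_comparison[OF _ lim])
    have "\<forall>\<^sub>F u in at t within {0..T}. u \<in> {0..T}" by (simp add: eventually_at_filter)
    then show "\<forall>\<^sub>F u in at t within {0..T}. norm (pairing y u - pairing y t)
        \<le> L2_norm 0 L (\<lambda>x. velocity u x - velocity t x) * N"
    proof eventually_elim
      case (elim u)
      have i: "integrable (lebesgue_on {0<..<L}) (\<lambda>x. r x * velocity u x * test_fun y x)" if "u \<in> {0..T}" for u
        using L2_fun_mult_integrable[OF L2_density[OF velocity_L2[OF that]] test_fun_L2[OF y]] .
      have "pairing y u - pairing y t = (\<integral>x. (velocity u x - velocity t x) * (r x * test_fun y x) \<partial>lebesgue_on {0<..<L})"
        unfolding pairing_def
        by (subst Bochner_Integration.integral_diff[symmetric, OF i[OF elim] i[OF t]])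
           (intro Bochner_Integration.integral_cong refl, simp add: algebra_simps)
      then show ?case
        using L2_cauchy_schwarz[OF L2_fun_diff[OF velocity_L2[OF elim] velocity_L2[OF t]] L2_density[OF test_fun_L2[OF y]]]
        by (simp add: N_def)
    qed
  qed
  then show "(pairing y \<longlongrightarrow> pairing y t) (at t within {0..T})" by (simp add: LIM_zero_iff)
qed

lemma pairing_final:
  assumes "y \<in> {0..L}" shows "pairing y T = 0"
proof -
  have "pairing y T = (\<integral>x. 0 \<partial>lebesgue_on {0<..<L})"
    unfolding pairing_def
  proof (rule integral_cong_AE)
    have "AE x in lebesgue_on {0<..<L}. velocity T x = 0"
      using sol by (simp add: finite_energy_solution_def)
    then show "AE x in lebesgue_on {0<..<L}. r x * velocity T x * test_fun y x = 0"
      by eventually_elim simp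
    show "(\<lambda>x. r x * velocity T x * test_fun y x) \<in> borel_measurable (lebesgue_on {0<..<L})"
      using L2_fun_mult_integrable[OF L2_density[OF velocity_L2[of T]] test_fun_L2[OF assms]] T by auto
  qed simp
  then show ?thesis by simp
qed

text \<open>Fubini over the triangle moves the primitive from \<alpha> to r \<psi>_t, where it
  becomes \<open>momentum'\<close>.\<close>

lemma pairing_swap:
  assumes y: "y \<in> {0..L}" and t: "t \<in> {0..T}"
  shows "((\<lambda>\<xi>. \<alpha> \<xi> * momentum' \<xi> t) has_integral pairing y t) {0..y}"
proof -
  let ?f = "\<lambda>x. r x * velocity t x"
  have fi: "integrable (lebesgue_on {0<..<L}) ?f" by (rule L2_fun_integrable[OF L2_density[OF velocity_L2[OF t]]])
  have "continuous_on {0..L} (\<lambda>\<xi>. integral {0..\<xi>} ?f)"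
    by (intro indefinite_integral_continuous_1 integrable_Ioo_subinterval[OF fi]) auto
  from integrable_mult_continuous[OF L2_fun_integrable[OF \<alpha>_L2] this]
  have am: "integrable (lebesgue_on {0<..<L}) (\<lambda>\<xi>. \<alpha> \<xi> * integral {0..\<xi>} ?f)"
    by (simp add: mult.commute)
  have "pairing y t = (\<integral>x. ?f x * integral {x..L} (cutoff y) \<partial>lebesgue_on {0<..<L})"
    by (simp add: pairing_def test_fun_def)
  also have "\<dots> = (\<integral>\<xi>. cutoff y \<xi> * integral {0..\<xi>} ?f \<partial>lebesgue_on {0<..<L})"
    by (rule integral_swap_triangle[OF fi L2_fun_integrable[OF cutoff_L2[OF y]]])
  also have "\<dots> = (\<integral>\<xi>. (if \<xi> < y then \<alpha> \<xi> * integral {0..\<xi>} ?f else 0) \<partial>lebesgue_on {0<..<L})"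
    by (intro Bochner_Integration.integral_cong) (auto simp: cutoff_def)
  also have "\<dots> = integral {0..y} (\<lambda>\<xi>. \<alpha> \<xi> * integral {0..\<xi>} ?f)"
    by (rule integral_Ioo_below(2)[OF am y])
  finally have "pairing y t = integral {0..y} (\<lambda>\<xi>. \<alpha> \<xi> * momentum' \<xi> t)"
    using t by (simp add: momentum'_def)
  moreover have "(\<lambda>\<xi>. \<alpha> \<xi> * momentum' \<xi> t) integrable_on {0..y}"
    using integrable_Ioo_subinterval[OF am, of 0 y] y t by (simp add: momentum'_def)
  ultimately show ?thesis by (simp add: has_integral_iff)
qed

text \<open>The slope -\<alpha> of the test function cancels a and leaves minus the integral of
  \<psi>_x over [0, y]; moreover \<psi> = 0 at x = 0.\<close>

lemma stiffness_term:
  assumes y: "y \<in> {0..L}" and t: "t \<in> {0<..<T}"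
  shows "(\<integral>x. a x * weak_deriv 0 L (\<psi> t) x * weak_deriv 0 L (test_fun y) x \<partial>lebesgue_on {0<..<L}) = - \<psi> t y"
proof -
  have H: "H1_fun 0 L (\<psi> t)" using H1 t by auto
  let ?g = "weak_deriv 0 L (\<psi> t)"
  have gi: "integrable (lebesgue_on {0<..<L}) ?g" by (rule L2_fun_integrable[OF H1_fun_weak_deriv(1)[OF H]])
  have "(\<integral>x. a x * ?g x * weak_deriv 0 L (test_fun y) x \<partial>lebesgue_on {0<..<L})
      = (\<integral>x. - (if x < y then ?g x else 0) \<partial>lebesgue_on {0<..<L})"
  proof (rule integral_cong_AE)
    show "AE x in lebesgue_on {0<..<L}. a x * ?g x * weak_deriv 0 L (test_fun y) x = - (if x < y then ?g x else 0)"
      using a\<alpha> test_fun_H1(2)[OF y]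
    proof eventually_elim
      case (elim x)
      then show ?case using \<alpha>0[of x] by (simp add: cutoff_def)
    qed
    show "(\<lambda>x. a x * ?g x * weak_deriv 0 L (test_fun y) x) \<in> borel_measurable (lebesgue_on {0<..<L})"
      by (intro borel_measurable_times measurable_a L2_fun_measurable[OF H1_fun_weak_deriv(1)] H test_fun_H1(1) y)
    show "(\<lambda>x. - (if x < y then ?g x else 0)) \<in> borel_measurable (lebesgue_on {0<..<L})"
      using borel_measurable_integrable[OF integral_Ioo_below(1)[OF gi y]] by (rule borel_measurable_uminus)
  qed
  also have "\<dots> = - integral {0..y} ?g"
    using integral_Ioo_below(2)[OF gi y] by simp
  also have "integral {0..y} ?g = \<psi> t y - \<psi> t 0"
    using H1_fun_has_integral[OF H, of 0 y] y by (simp add: has_integral_iff)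
  also have "\<psi> t 0 = 0" using sol t by (simp add: finite_energy_solution_def)
  finally show ?thesis by simp
qed

lemma inertia_term:
  assumes y: "y \<in> {0..L}" and t: "t \<in> {0..T}"
  shows "(\<integral>x. \<rho> x * velocity t x * test_fun y x \<partial>lebesgue_on {0<..<L}) = pairing y t"
  unfolding pairing_def
proof (rule integral_cong_AE)
  show "AE x in lebesgue_on {0<..<L}. \<rho> x * velocity t x * test_fun y x = r x * velocity t x * test_fun y x"
    using \<rho>r by eventually_elim simp
qed (intro borel_measurable_times measurable_\<rho> measurable_coeff L2_fun_measurable[OF velocity_L2]
  L2_fun_measurable[OF test_fun_L2] y t)+

text \<open>Green's formula with \<open>test_fun y\<close>: the stiffness term contributes minus the
  value of \<psi> at y, and the value of the test function at 0, the integral of \<alpha> over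
  [0, y], brings in the flux trace.\<close>

lemma pairing_weak_deriv:
  assumes y: "y \<in> {0..L}"
  shows "has_weak_deriv 0 T (pairing y) (\<lambda>t. wave y t - test_fun y 0 * q t)"
  unfolding has_weak_deriv_def
proof (intro allI impI)
  fix \<theta> \<theta>' assume \<theta>: "C1c_fun 0 T \<theta> \<theta>'"
  let ?M = "lebesgue_on {0<..<T}"
  have i1: "integrable ?M (\<lambda>t. wave y t * \<theta> t)"
    by (intro integrable_Ioo_continuous continuous_intros C1c_fun_continuous[OF \<theta>]
        continuous_on_subset[OF continuous_time[OF wave_continuous y]]) auto
  have i2: "integrable ?M (\<lambda>t. pairing y t * \<theta>' t)"
    by (intro integrable_Ioo_continuous continuous_intros C1c_fun_continuous[OF \<theta>] pairing_continuous y)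
  have i3: "integrable ?M (\<lambda>t. q t * \<theta> t)"
    using integrable_mult_continuous[OF L2_fun_integrable[OF q_L2] C1c_fun_continuous(1)[OF \<theta>]] by (simp add: mult.commute)
  have "wave_form L T \<rho> a \<psi> (test_fun y) \<theta> \<theta>' = (\<integral>t. - (wave y t * \<theta> t) - pairing y t * \<theta>' t \<partial>?M)"
    unfolding wave_form_def
  proof (rule Bochner_Integration.integral_cong[OF refl])
    fix t assume "t \<in> space ?M"
    then have t: "t \<in> {0<..<T}" "t \<in> {0..T}" by auto
    show "(\<integral>x. a x * weak_deriv 0 L (\<psi> t) x * weak_deriv 0 L (test_fun y) x \<partial>lebesgue_on {0<..<L}) * \<theta> t
        - (\<integral>x. \<rho> x * velocity t x * test_fun y x \<partial>lebesgue_on {0<..<L}) * \<theta>' t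
        = - (wave y t * \<theta> t) - pairing y t * \<theta>' t"
      unfolding stiffness_term[OF y t(1)] inertia_term[OF y t(2)] using t by (simp add: wave_def)
  qed
  also have "\<dots> = - (\<integral>t. wave y t * \<theta> t \<partial>?M) - (\<integral>t. pairing y t * \<theta>' t \<partial>?M)"
    using i1 i2 by simp
  also have "wave_form L T \<rho> a \<psi> (test_fun y) \<theta> \<theta>' = - test_fun y 0 * (\<integral>t. q t * \<theta> t \<partial>?M)"
    using trace test_fun_H1(1)[OF y] \<theta> unfolding is_flux_trace_def by (simp add: test_fun_def)
  finally have "(\<integral>t. pairing y t * \<theta>' t \<partial>?M) = - ((\<integral>t. wave y t * \<theta> t \<partial>?M) - test_fun y 0 * (\<integral>t. q t * \<theta> t \<partial>?M))"
    by simp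
  also have "(\<integral>t. wave y t * \<theta> t \<partial>?M) - test_fun y 0 * (\<integral>t. q t * \<theta> t \<partial>?M)
      = (\<integral>t. wave y t * \<theta> t - test_fun y 0 * (q t * \<theta> t) \<partial>?M)"
    using i1 i3 by simp
  finally show "(\<integral>t. pairing y t * \<theta>' t \<partial>?M) = - (\<integral>t. (wave y t - test_fun y 0 * q t) * \<theta> t \<partial>?M)"
    by (simp add: left_diff_distrib mult.assoc)
qed

lemma flux_tail_final: "T \<le> t \<Longrightarrow> time_tail T flux t = 0"
  using T flux_integrable by (intro time_tail_eq_0) (auto simp: flux_def)

lemma wave_tail_final: "y \<in> {0..L} \<Longrightarrow> T \<le> t \<Longrightarrow> time_tail T (wave y) t = 0"
  using T wave_integrable by (intro time_tail_eq_0) (auto simp: wave_def)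

text \<open>Integrate the weak derivative from t to T, where the pairing vanishes. Together with
  \<open>pairing_swap\<close> this is the first sidewise equation.\<close>

lemma pairing_eq:
  assumes y: "y \<in> {0..L}" and t: "t \<in> {0..T}"
  shows "pairing y t = test_fun y 0 * time_tail T flux t - time_tail T (wave y) t"
proof -
  have gi: "integrable (lebesgue_on {0<..<T}) (\<lambda>t. wave y t - test_fun y 0 * q t)"
    using integrable_Ioo_continuous[OF continuous_on_subset[OF continuous_time[OF wave_continuous y]], of 0 T]
      L2_fun_integrable[OF q_L2] by simp
  have "((\<lambda>t. wave y t - test_fun y 0 * q t) has_integral (pairing y T - pairing y t)) {t..T}"
    using t by (intro weak_deriv_has_integral[OF pairing_continuous[OF y] gi pairing_weak_deriv[OF y]]) auto
  then have 1: "((\<lambda>t. wave y t - test_fun y 0 * flux t) has_integral (pairing y T - pairing y t)) {t..T}"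
    by (rule has_integral_eq[rotated]) (simp add: flux_def)
  have 2: "((\<lambda>t. wave y t - test_fun y 0 * flux t) has_integral
      (time_tail T (wave y) t - time_tail T (wave y) T) - test_fun y 0 * (time_tail T flux t - time_tail T flux T)) {t..T}"
    using t by (intro has_integral_diff has_integral_mult_right time_tail_interval flux_integrable wave_integrable y) auto
  show ?thesis
    using has_integral_unique[OF 1 2] by (simp add: pairing_final[OF y] flux_tail_final wave_tail_final[OF y])
qed

text \<open>v is a primitive of \<psi>, and p is the momentum plus a double primitive of the
  boundary flux; the signs reflect that \<open>time_tail\<close> has minus its integrand as
  derivative. The equation v_x = \<alpha> p_t is \<open>pairing_eq\<close>, and p_x = \<rho> v_t is
  the definition of \<open>momentum\<close>.\<close>

lemma sidewise:
  "sidewise_system L T \<alpha> r (\<lambda>x t. - time_tail T (wave x) t) wave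
     (\<lambda>x t. momentum x t + time_tail T (time_tail T flux) t) (\<lambda>x t. momentum' x t - time_tail T flux t)"
proof -
  let ?v = "\<lambda>x t. - time_tail T (wave x) t"
  let ?p = "\<lambda>x t. momentum x t + time_tail T (time_tail T flux) t"
  let ?p' = "\<lambda>x t. momentum' x t - time_tail T flux t"
  have ct: "continuous_on {0..} (time_tail T flux)" by (intro continuous_time_tail flux_integrable)
  have "continuous_on ({0..L} \<times> {0..}) (\<lambda>z::real \<times> real. time_tail T flux (snd z))"
    by (rule continuous_on_compose2[OF ct]) (auto intro!: continuous_intros)
  then have cp': "continuous_on ({0..L} \<times> {0..}) (\<lambda>z. ?p' (fst z) (snd z))"
    by (intro continuous_on_diff momentum'_continuous)
  have dv: "(?v x has_real_derivative wave x t) (at t within {0..})" if "x \<in> {0..L}" "0 \<le> t" for x t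
    using DERIV_minus[OF time_tail_has_derivative[OF continuous_time[OF wave_continuous that(1)] that(2), of T]] by simp
  have dp: "(?p x has_real_derivative ?p' x t) (at t within {0..})" if "x \<in> {0..L}" "0 \<le> t" for x t
    using DERIV_add[OF momentum_derivative[OF that] time_tail_has_derivative[OF ct that(2), of T]] by simp
  have iv: "((\<lambda>\<xi>. \<alpha> \<xi> * ?p' \<xi> t) has_integral ?v y t) {0..y}" if y: "y \<in> {0..L}" and t: "0 \<le> t" for y t
  proof (cases "t \<le> T")
    case True
    have "\<alpha> integrable_on {0..y}"
      by (rule integrable_Ioo_subinterval[OF L2_fun_integrable[OF \<alpha>_L2]]) (use y in auto)
    then have "((\<lambda>\<xi>. \<alpha> \<xi> * time_tail T flux t) has_integral test_fun y 0 * time_tail T flux t) {0..y}"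
      using test_fun_0[OF y] by (intro has_integral_mult_left) (simp add: integrable_integral)
    from has_integral_diff[OF pairing_swap[OF y, of t] this] show ?thesis
      using True t pairing_eq[OF y, of t] by (simp add: right_diff_distrib)
  next
    case False
    have "((\<lambda>\<xi>. \<alpha> \<xi> * ?p' \<xi> t) has_integral 0) {0..y}"
      by (rule has_integral_is_0) (use False y in \<open>simp add: momentum'_final flux_tail_final\<close>)
    then show ?thesis using False y by (simp add: wave_tail_final)
  qed
  have ip: "((\<lambda>\<xi>. r \<xi> * wave \<xi> t) has_integral (?p y t - ?p 0 t)) {0..y}" if y: "y \<in> {0..L}" and t: "0 \<le> t" for y t
    using density_integrable[OF wave_L2[OF t], of 0 y] y
    by (simp add: momentum_def integrable_integral)
  \<comment> \<open>Continuity in x is read off from the integral equations themselves; the known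
    time derivatives then give joint continuity.\<close>
  have cont_of_int: "continuous_on {0..L} F"
    if "\<And>y. y \<in> {0..L} \<Longrightarrow> (f has_integral (F y - F 0)) {0..y}" for f F :: "real \<Rightarrow> real"
  proof -
    have "continuous_on {0..L} (\<lambda>y. F 0 + integral {0..y} f)"
      using that[of L] L by (intro continuous_intros indefinite_integral_continuous_1) (auto simp: has_integral_iff)
    then show ?thesis
      by (rule continuous_on_eq) (use that in \<open>auto simp: has_integral_iff\<close>)
  qed
  have v0: "?v 0 t = 0" if "0 \<le> t" for t
    using iv[of 0 t] L that by (simp add: has_integral_iff)
  have cv: "continuous_on ({0..L} \<times> {0..}) (\<lambda>z. ?v (fst z) (snd z))"
  proof (rule continuous_on_strip_antiderivative[OF _ wave_continuous dv])
    show "continuous_on {0..L} (\<lambda>x. ?v x t)" if "0 \<le> t" for t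
      using iv[OF _ that] v0[OF that] by (intro cont_of_int[of "\<lambda>\<xi>. \<alpha> \<xi> * ?p' \<xi> t"]) simp
  qed
  have cp: "continuous_on ({0..L} \<times> {0..}) (\<lambda>z. ?p (fst z) (snd z))"
  proof (rule continuous_on_strip_antiderivative[OF _ cp' dp])
    show "continuous_on {0..L} (\<lambda>x. ?p x t)" if "0 \<le> t" for t
      using ip[OF _ that] by (intro cont_of_int[of "\<lambda>\<xi>. r \<xi> * wave \<xi> t"]) simp
  qed
  have tail2: "time_tail T (time_tail T flux) t = 0" if "T \<le> t" for t
  proof (rule time_tail_eq_0)
    show "time_tail T flux integrable_on {0..u}" for u
      by (intro integrable_continuous_real continuous_on_subset[OF ct]) auto
  qed (use T that flux_tail_final in auto)
  show ?thesis
  proof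
    show "?v x t = 0" "?p x t = 0" if "x \<in> {0..L}" "T \<le> t" for x t
      using that by (simp_all add: wave_tail_final momentum_final tail2)
  qed (fact L T cv wave_continuous cp cp' | rule dv dp iv ip; assumption)+
qed

text \<open>\<open>momentum' 0\<close> is 0, so p_t at x = 0 is a primitive of the flux; the summand
  is written out to match the field of the system.\<close>

lemma flux_has_integral:
  assumes "0 \<le> t" "t \<le> u"
  shows "(flux has_integral ((momentum' 0 u - time_tail T flux u) - (momentum' 0 t - time_tail T flux t))) {t..u}"
  using time_tail_interval[of flux t u T] assms flux_integrable
  by (simp add: momentum'_def)

end

section \<open>Observability of the boundary datum\<close>

text \<open>An H1 function is an integral of its weak derivative, so Lebesgue differentiation
  applies to its forward quotients. Agreement of F and f on the open interval is enough, since t + 1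
  / (n + 1) < b for large n.\<close>

lemma weak_deriv_diff_quot_tendsto:
  assumes f: "H1_fun a b f" and Ff: "\<And>t. t \<in> {a<..<b} \<Longrightarrow> F t = f t"
  shows "AE t in lebesgue_on {a<..<b}. (\<lambda>n. diff_quot (1 / Suc n) F t) \<longlonglongrightarrow> weak_deriv a b f t"
proof -
  define G where "G t = (if t \<in> {a..b} then weak_deriv a b f t else 0)" for t
  have gi: "integrable (lebesgue_on {a<..<b}) (weak_deriv a b f)"
    by (rule L2_fun_integrable[OF H1_fun_weak_deriv(1)[OF f]])
  have "G integrable_on cbox c d" for c d
  proof -
    have "weak_deriv a b f integrable_on {max a c..min b d}"
      by (rule integrable_Ioo_subinterval[OF gi]) auto
    then have "weak_deriv a b f integrable_on ({a..b} \<inter> cbox c d)" by simp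
    then show ?thesis unfolding G_def[abs_def] by (subst integrable_restrict_Int) (simp add: Int_commute)
  qed
  from integrable_ccontinuous_explicit[OF this] obtain N where N: "negligible N"
    "\<And>x e. \<lbrakk>x \<notin> N; 0 < e\<rbrakk> \<Longrightarrow> \<exists>d>0. \<forall>t. 0 < t \<and> t < d \<longrightarrow>
       norm (integral (cbox x (x + t *\<^sub>R One)) G /\<^sub>R t ^ DIM(real) - G x) < e" by metis
  have lim: "(\<lambda>n. diff_quot (1 / Suc n) F t) \<longlonglongrightarrow> weak_deriv a b f t" if t: "t \<in> {a<..<b}" "t \<notin> N" for t
  proof (rule LIMSEQ_I)
    fix e :: real assume "0 < e"
    then obtain d where d: "d > 0"
      "\<And>h. 0 < h \<Longrightarrow> h < d \<Longrightarrow> norm (integral {t..t + h} G / h - G t) < e"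
      using N(2)[OF t(2), of e] by (auto simp: divide_inverse mult.commute)
    obtain m :: nat where m: "1 / Suc m < min d (b - t)"
      using nat_approx_posE[of "min d (b - t)"] d(1) t by auto
    show "\<exists>n0. \<forall>n\<ge>n0. norm (diff_quot (1 / Suc n) F t - weak_deriv a b f t) < e"
    proof (intro exI[of _ m] allI impI)
      fix n assume "m \<le> n"
      define h where "h = 1 / Suc n"
      have "h \<le> 1 / Suc m" using \<open>m \<le> n\<close> by (simp add: h_def frac_le)
      then have h: "0 < h" "h < d" "t + h < b" using m by (auto simp: h_def)
      have "integral {t..t + h} G = integral {t..t + h} (weak_deriv a b f)"
        using t h by (intro Henstock_Kurzweil_Integration.integral_cong) (auto simp: G_def)
      also have "\<dots> = f (t + h) - f t"
        using H1_fun_has_integral[OF f, of t "t + h"] t h by (simp add: has_integral_iff)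
      finally have "integral {t..t + h} G / h = diff_quot h F t"
        using t h by (simp add: diff_quot_def Ff)
      then show "norm (diff_quot (1 / Suc n) F t - weak_deriv a b f t) < e"
        using d(2)[OF h(1,2)] t by (simp add: G_def h_def)
    qed
  qed
  have "AE t in lebesgue. t \<notin> N" using N(1) by (intro AE_not_in) (simp add: negligible_iff_null_sets)
  then have "AE t in lebesgue. t \<in> {a<..<b} \<longrightarrow> (\<lambda>n. diff_quot (1 / Suc n) F t) \<longlonglongrightarrow> weak_deriv a b f t"
    by eventually_elim (use lim in blast)
  then show ?thesis by (simp add: AE_restrict_space_iff)
qed

text \<open>Second use of Fatou: the increment k left over in \<open>trace_estimate\<close> tends to
  0.\<close>

lemma weak_deriv_L2_bound:
  assumes f: "H1_fun a b f" and Ff: "\<And>t. t \<in> {a<..<b} \<Longrightarrow> F t = f t"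
    and a: "0 \<le> a" and F: "continuous_on {0..} F" and B: "0 \<le> B"
    and quot: "\<And>k. 0 < k \<Longrightarrow> (\<integral>\<^sup>+t. ennreal ((diff_quot k F t)\<^sup>2) \<partial>lebesgue_on {a..b}) \<le> ennreal B"
  shows "(L2_norm a b (weak_deriv a b f))\<^sup>2 \<le> B"
proof -
  have "(\<integral>\<^sup>+t. ennreal ((weak_deriv a b f t)\<^sup>2) \<partial>lebesgue_on {a<..<b}) \<le> ennreal B"
  proof (rule nn_integral_square_fatou[OF _ weak_deriv_diff_quot_tendsto[OF f Ff]])
    fix n
    have k: "0 < 1 / real (Suc n)" by simp
    have c: "continuous_on {a<..<b} (\<lambda>t. F (t + 1 / real (Suc n)))"
    proof (rule continuous_on_compose2[OF F])
      show "continuous_on {a<..<b} (\<lambda>t. t + 1 / real (Suc n))" by (intro continuous_intros)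
      show "(\<lambda>t. t + 1 / real (Suc n)) ` {a<..<b} \<subseteq> {0..}" using a k by force
    qed
    have "continuous_on {a<..<b} F" by (rule continuous_on_subset[OF F]) (use a in auto)
    then have "continuous_on {a<..<b} (diff_quot (1 / Suc n) F)"
      unfolding diff_quot_def[abs_def] using c by (intro continuous_intros) auto
    then show "diff_quot (1 / Suc n) F \<in> borel_measurable (lebesgue_on {a<..<b})"
      by (intro continuous_imp_measurable_on_sets_lebesgue) auto
    have "(\<integral>\<^sup>+t. ennreal ((diff_quot (1 / Suc n) F t)\<^sup>2) \<partial>lebesgue_on {a<..<b})
        \<le> (\<integral>\<^sup>+t. ennreal ((diff_quot (1 / Suc n) F t)\<^sup>2) \<partial>lebesgue_on {a..b})"
      by (simp add: nn_integral_restrict_space) (auto intro!: nn_integral_mono simp: indicator_def)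
    then show "(\<integral>\<^sup>+t. ennreal ((diff_quot (1 / Suc n) F t)\<^sup>2) \<partial>lebesgue_on {a<..<b}) \<le> ennreal B"
      using quot[OF k] by (rule order_trans)
  qed auto
  moreover have "integrable (lebesgue_on {a<..<b}) (\<lambda>t. (weak_deriv a b f t)\<^sup>2)"
    using H1_fun_weak_deriv(1)[OF f] by (simp add: L2_fun_def)
  ultimately have "ennreal (\<integral>t. (weak_deriv a b f t)\<^sup>2 \<partial>lebesgue_on {a<..<b}) \<le> ennreal B"
    by (subst (asm) nn_integral_eq_integral) auto
  then show ?thesis using B by (simp add: L2_norm_square)
qed

text \<open>From f a = 0 follows (f x)^2 \<le> (b - a) N^2. Integration over length b - a yields the
  constant (b - a)^2, and 1 accounts for the derivative itself.\<close>

lemma H1_norm_poincare: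
  assumes f: "H1_fun a b f" and ab: "a \<le> b" and fa: "f a = 0"
  shows "H1_norm a b f \<le> sqrt ((b - a)\<^sup>2 + 1) * L2_norm a b (weak_deriv a b f)"
proof -
  define N where "N = L2_norm a b (weak_deriv a b f)"
  have N0: "0 \<le> N" by (simp add: N_def L2_norm_nonneg)
  have pt: "(f x)\<^sup>2 \<le> (b - a) * N\<^sup>2" if x: "x \<in> {a..b}" for x
  proof -
    have "\<bar>f x\<bar> \<le> sqrt (x - a) * N"
      using L2_fun_integral_bound[OF H1_fun_weak_deriv(1)[OF f], of a x] H1_fun_has_integral[OF f, of a x] x fa
      by (simp add: has_integral_iff N_def)
    also have "\<dots> \<le> sqrt (b - a) * N" using x N0 by (intro mult_right_mono) auto
    finally have "(f x)\<^sup>2 \<le> (sqrt (b - a) * N)\<^sup>2" by (metis abs_ge_zero power2_abs power_mono)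
    then show ?thesis using ab by (simp add: power_mult_distrib)
  qed
  have "((\<lambda>x. (f x)\<^sup>2) has_integral (L2_norm a b f)\<^sup>2) {a..b}"
    using f integrable_Ioo_has_integral[of a b "\<lambda>x. (f x)\<^sup>2"] by (simp add: H1_fun_def L2_fun_def L2_norm_square)
  moreover have "((\<lambda>x. (b - a) * N\<^sup>2) has_integral (b - a) * ((b - a) * N\<^sup>2)) {a..b}"
    using has_integral_const_real[of "(b - a) * N\<^sup>2" a b] ab by simp
  ultimately have "(L2_norm a b f)\<^sup>2 \<le> (b - a) * ((b - a) * N\<^sup>2)"
    using pt by (rule has_integral_le)
  then have "(L2_norm a b f)\<^sup>2 + N\<^sup>2 \<le> ((b - a)\<^sup>2 + 1) * N\<^sup>2"
    by (simp add: power2_eq_square algebra_simps)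
  then have "H1_norm a b f \<le> sqrt (((b - a)\<^sup>2 + 1) * N\<^sup>2)"
    unfolding H1_norm_def N_def[symmetric] by (rule real_sqrt_le_mono)
  then show ?thesis using N0 by (simp add: real_sqrt_mult N_def)
qed

theorem proposition2p1:
  fixes L T \<rho>\<^sub>0 \<rho>\<^sub>1 a\<^sub>0 a\<^sub>1 \<beta> :: real and \<rho> a :: "real \<Rightarrow> real"
  assumes "L > 0"
    and "BV_fun 0 L \<rho>" and "BV_fun 0 L a"
    and "0 < \<rho>\<^sub>0" and "AE x in lebesgue_on {0<..<L}. \<rho>\<^sub>0 \<le> \<rho> x \<and> \<rho> x \<le> \<rho>\<^sub>1"
    and "0 < a\<^sub>0" and "AE x in lebesgue_on {0<..<L}. a\<^sub>0 \<le> a x \<and> a x \<le> a\<^sub>1"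
    and "\<beta> = max_slowness L \<rho> a"
    and "L * \<beta> < T"
  shows "\<exists>C\<^sub>1>0. \<forall>s\<^sub>0 \<psi> g.
           H1_fun (L * \<beta>) T s\<^sub>0 \<and> s\<^sub>0 (L * \<beta>) = 0 \<and>
           finite_energy_solution L T \<rho> a (\<lambda>t. if L * \<beta> \<le> t then s\<^sub>0 t else 0) \<psi> \<and>
           is_boundary_trace L T \<rho> a \<psi> g \<longrightarrow>
           H1_norm (L * \<beta>) T s\<^sub>0 \<le> C\<^sub>1 * L2_norm 0 T g"
proof -
  note L = \<open>L > 0\<close>
  obtain r0 W1 where r0: "mono W1" "\<And>x y. x \<le> y \<Longrightarrow> \<bar>r0 y - r0 x\<bar> \<le> W1 y - W1 x"
    "\<And>x. \<rho>\<^sub>0 \<le> r0 x" "\<And>x. r0 x \<le> \<rho>\<^sub>1" "AE x in lebesgue_on {0<..<L}. \<rho> x = r0 x"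
    by (rule BV_fun_representative[OF L assms(2,5)]) (rule that; assumption)
  obtain b W2 where b: "mono W2" "\<And>x y. x \<le> y \<Longrightarrow> \<bar>b y - b x\<bar> \<le> W2 y - W2 x"
    "\<And>x. a\<^sub>0 \<le> b x" "\<And>x. b x \<le> a\<^sub>1" "AE x in lebesgue_on {0<..<L}. a x = b x"
    by (rule BV_fun_representative[OF L assms(3,7)]) (rule that; assumption)
  have r0m: "r0 \<in> borel_measurable borel" by (rule BV_representative_measurable[OF r0(1,2)])
  have bm: "b \<in> borel_measurable borel" by (rule BV_representative_measurable[OF b(1,2)])
  have slow: "0 < \<beta>" "AE x in lebesgue_on {0<..<L}. \<rho> x \<le> \<beta>\<^sup>2 * a x"
    using max_slowness_bound[OF L assms(4,5,6,7) r0m r0(5) bm b(5)] assms(8) by auto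
  have T: "0 < T" using assms(9) mult_pos_pos[OF L slow(1)] by linarith
  have b0: "0 < b x" for x using b(3)[of x] assms(6) by linarith
  have a1: "0 < a\<^sub>1" using b0[of 0] b(4)[of 0] by linarith
  have \<rho>1: "0 < \<rho>\<^sub>1" using r0(3)[of 0] r0(4)[of 0] assms(4) by linarith
  obtain l where l: "(b \<longlongrightarrow> l) (at_right 0)"
    by (rule BV_representative_tendsto_at_right[OF b(1,2)])
  have lev: "left_endpoint_value 0 a = l" by (rule left_endpoint_value_eq[OF L b(5) l])
  have l0: "0 < l"
  proof -
    have "a\<^sub>0 \<le> l" by (rule tendsto_lowerbound[OF l]) (use b(3) in auto)
    then show ?thesis using assms(6) by linarith
  qed
  define \<alpha> where "\<alpha> x = 1 / b x" for x
  \<comment> \<open>The minimum enforces \<open>r x * \<alpha> x \<le> \<beta>\<^sup>2\<close> at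
    every point, as the energy estimate demands; by the definition of \<beta> it alters r0 only on a
    null set inside the interval.\<close>
  define r where "r x = min (r0 x) (\<beta>\<^sup>2 * b x)" for x
  \<comment> \<open>The truncation in \<open>r\<close> costs \<beta>^2 times the variation of b, the
    reciprocal in \<alpha> costs \<open>1 / a\<^sub>0\<^sup>2\<close> times it.\<close>
  define W where "W x = W1 x + (\<beta>\<^sup>2 + 1 / a\<^sub>0\<^sup>2) * W2 x" for x
  \<comment> \<open>Lower bounds of \<alpha>, r0 and \<beta>^2 b, in this order.\<close>
  define m where "m = min (1 / a\<^sub>1) (min \<rho>\<^sub>0 (\<beta>\<^sup>2 * a\<^sub>0))"
  define A where "A = max (1 / a\<^sub>0) \<rho>\<^sub>1"
  define K where "K = A / m * exp ((W L - W 0) / m)"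
  have m: "0 < m" using a1 assms(4,6) slow(1) by (simp add: m_def)
  have A: "0 < A" using \<rho>1 by (simp add: A_def)
  have K: "0 < K" using A m by (simp add: K_def)
  have dW: "W1 x \<le> W1 y" "W2 x \<le> W2 y" if "x \<le> y" for x y
    using that r0(1) b(1) by (auto simp: mono_def)
  have W: "mono W"
    unfolding W_def[abs_def] using dW by (intro monoI add_mono mult_left_mono) auto
  have bv\<alpha>: "\<bar>\<alpha> y - \<alpha> x\<bar> \<le> W y - W x" if "x \<le> y" for x y
  proof -
    have "\<bar>\<alpha> y - \<alpha> x\<bar> = \<bar>b y - b x\<bar> / (b x * b y)"
      using b0[of x] b0[of y] by (simp add: \<alpha>_def abs_mult diff_frac_eq abs_minus_commute mult.commute)
    also have "\<dots> \<le> (W2 y - W2 x) / (a\<^sub>0 * a\<^sub>0)"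
      using b(2)[OF that] b(3)[of x] b(3)[of y] assms(6) by (intro frac_le mult_mono) auto
    also have "\<dots> = 1 / a\<^sub>0\<^sup>2 * (W2 y - W2 x)" by (simp add: power2_eq_square)
    also have "\<dots> \<le> W y - W x"
    proof -
      have "0 \<le> \<beta>\<^sup>2 * (W2 y - W2 x)" using dW[OF that] by simp
      moreover have "W y - W x = (W1 y - W1 x) + \<beta>\<^sup>2 * (W2 y - W2 x) + 1 / a\<^sub>0\<^sup>2 * (W2 y - W2 x)"
        by (simp add: W_def algebra_simps diff_divide_distrib)
      ultimately show ?thesis using dW[OF that] by linarith
    qed
    finally show ?thesis .
  qed
  have bvr: "\<bar>r y - r x\<bar> \<le> W y - W x" if "x \<le> y" for x y
  proof -
    have "\<bar>\<beta>\<^sup>2 * b y - \<beta>\<^sup>2 * b x\<bar> = \<beta>\<^sup>2 * \<bar>b y - b x\<bar>" by (simp add: abs_mult flip: right_diff_distrib)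
    also have "\<dots> \<le> \<beta>\<^sup>2 * (W2 y - W2 x)" using b(2)[OF that] by (intro mult_left_mono) auto
    finally have 1: "\<bar>\<beta>\<^sup>2 * b y - \<beta>\<^sup>2 * b x\<bar> \<le> \<beta>\<^sup>2 * (W2 y - W2 x)" .
    have "\<bar>r y - r x\<bar> \<le> (W1 y - W1 x) + \<beta>\<^sup>2 * (W2 y - W2 x)"
      using 1 r0(2)[OF that] dW[OF that] unfolding r_def min_def by (auto split: if_splits)
    moreover have "0 \<le> 1 / a\<^sub>0\<^sup>2 * (W2 y - W2 x)" using dW[OF that] by simp
    moreover have "W y - W x = (W1 y - W1 x) + \<beta>\<^sup>2 * (W2 y - W2 x) + 1 / a\<^sub>0\<^sup>2 * (W2 y - W2 x)"
      by (simp add: W_def algebra_simps diff_divide_distrib)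
    ultimately show ?thesis by linarith
  qed
  have \<alpha>b: "m \<le> \<alpha> x" "\<alpha> x \<le> A" for x
  proof -
    have "1 / a\<^sub>1 \<le> \<alpha> x" unfolding \<alpha>_def using b(4)[of x] b0[of x] by (intro frac_le) auto
    then show "m \<le> \<alpha> x" by (simp add: m_def)
    have "\<alpha> x \<le> 1 / a\<^sub>0" unfolding \<alpha>_def using b(3)[of x] assms(6) by (intro frac_le) auto
    then show "\<alpha> x \<le> A" by (simp add: A_def)
  qed
  have rb: "m \<le> r x" "r x \<le> A" for x
  proof -
    have "\<beta>\<^sup>2 * a\<^sub>0 \<le> \<beta>\<^sup>2 * b x" using b(3) by (intro mult_left_mono) auto
    then show "m \<le> r x" using r0(3)[of x] by (auto simp: m_def r_def)
    show "r x \<le> A" using r0(4)[of x] by (auto simp: A_def r_def)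
  qed
  have r\<alpha>: "r x * \<alpha> x \<le> \<beta>\<^sup>2" for x
    using b0[of x] by (simp add: r_def \<alpha>_def field_simps)
  have \<rho>r: "AE x in lebesgue_on {0<..<L}. \<rho> x = r x"
    using r0(5) b(5) slow(2) by eventually_elim (simp add: r_def)
  have a\<alpha>: "AE x in lebesgue_on {0<..<L}. a x = 1 / \<alpha> x"
    using b(5) by eventually_elim (simp add: \<alpha>_def)
  \<comment> \<open>The Poincare constant, the sidewise constant, and the factor l = a(0+) that
    converts g = q / l back into the flux trace.\<close>
  define C\<^sub>1 where "C\<^sub>1 = sqrt ((T - L * \<beta>)\<^sup>2 + 1) * sqrt K * l"
  have "C\<^sub>1 > 0" using K l0 by (simp add: C\<^sub>1_def add_nonneg_pos)
  moreover have "H1_norm (L * \<beta>) T s\<^sub>0 \<le> C\<^sub>1 * L2_norm 0 T g"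
    if s0: "H1_fun (L * \<beta>) T s\<^sub>0" "s\<^sub>0 (L * \<beta>) = 0"
      and sol: "finite_energy_solution L T \<rho> a (\<lambda>t. if L * \<beta> \<le> t then s\<^sub>0 t else 0) \<psi>"
      and g: "is_boundary_trace L T \<rho> a \<psi> g" for s\<^sub>0 \<psi> g
  proof -
    obtain q where q: "is_flux_trace L T \<rho> a \<psi> q" "g = (\<lambda>t. q t / l)"
      using g unfolding is_boundary_trace_def lev by blast
    interpret wave_solution L T A \<rho> a \<alpha> r "\<lambda>t. if L * \<beta> \<le> t then s\<^sub>0 t else 0" q \<psi>
    proof
      have "r = (\<lambda>x. min (r0 x) (\<beta>\<^sup>2 * b x))" "\<alpha> = (\<lambda>x. 1 / b x)" by (auto simp: r_def \<alpha>_def)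
      then show "\<alpha> \<in> borel_measurable borel" "r \<in> borel_measurable borel"
        using r0m bm by simp_all
      show "\<bar>\<alpha> x\<bar> \<le> A" "\<bar>r x\<bar> \<le> A" "0 < \<alpha> x" for x
        using \<alpha>b[of x] rb[of x] m by auto
    qed (fact L T sol q(1) \<rho>r a\<alpha>)+
    interpret S: sidewise_system L T \<alpha> r "\<lambda>x t. - time_tail T (wave x) t" wave
      "\<lambda>x t. momentum x t + time_tail T (time_tail T flux) t" "\<lambda>x t. momentum' x t - time_tail T flux t"
      by (rule sidewise)
    have q2: "((\<lambda>t. (flux t)\<^sup>2) has_integral (L2_norm 0 T q)\<^sup>2) {0..T}"
    proof (rule has_integral_eq)
      show "((\<lambda>t. (q t)\<^sup>2) has_integral (L2_norm 0 T q)\<^sup>2) {0..T}"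
        using q_L2 integrable_Ioo_has_integral[of 0 T "\<lambda>t. (q t)\<^sup>2"] by (simp add: L2_fun_def L2_norm_square)
    qed (simp add: flux_def)
    have "(L2_norm (L * \<beta>) T (weak_deriv (L * \<beta>) T s\<^sub>0))\<^sup>2 \<le> K * (L2_norm 0 T q)\<^sup>2"
    \<comment> \<open>At x = L the field v_t is the wave itself, which is the boundary datum on the
      open time interval.\<close>
    proof (rule weak_deriv_L2_bound[OF s0(1), where F = "wave L"])
      show "wave L t = s\<^sub>0 t" if "t \<in> {L * \<beta><..<T}" for t
      proof -
        have "0 < t" using that mult_pos_pos[OF L slow(1)] by auto
        then show ?thesis using sol that by (simp add: finite_energy_solution_def wave_def)
      qed
      show "continuous_on {0..} (wave L)" using continuous_time[OF wave_continuous] L by simp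
      fix k :: real assume k: "0 < k"
      have "(\<integral>\<^sup>+t. ennreal ((diff_quot k (wave L) t)\<^sup>2) \<partial>lebesgue_on {\<beta> * L..T})
         \<le> ennreal (A / m * exp ((W L - W 0) / m) * integral {0..T} (\<lambda>t. (flux t)\<^sup>2))"
      proof (rule S.trace_estimate[OF W bv\<alpha> bvr m \<alpha>b rb less_imp_le[OF slow(1)] r\<alpha> k flux_has_integral])
        show "(\<lambda>t. (flux t)\<^sup>2) integrable_on {0..T}" using q2 by blast
        show "flux t = 0" if "T < t" for t using that by (simp add: flux_def)
        show "momentum' 0 t - time_tail T flux t = 0" if "T \<le> t" for t
          using that L by (simp add: momentum'_final flux_tail_final)
      qed
      then show "(\<integral>\<^sup>+t. ennreal ((diff_quot k (wave L) t)\<^sup>2) \<partial>lebesgue_on {L * \<beta>..T}) \<le> ennreal (K * (L2_norm 0 T q)\<^sup>2)"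
        using q2 by (simp add: K_def has_integral_iff mult.commute[of \<beta> L])
    qed (use L slow(1) K in auto)
    then have "L2_norm (L * \<beta>) T (weak_deriv (L * \<beta>) T s\<^sub>0) \<le> sqrt (K * (L2_norm 0 T q)\<^sup>2)"
      by (rule real_le_rsqrt)
    also have "\<dots> = sqrt K * L2_norm 0 T q" by (simp add: real_sqrt_mult L2_norm_nonneg)
    also have "L2_norm 0 T q = l * L2_norm 0 T g"
      using l0 unfolding q(2) by (simp add: L2_norm_def power_divide real_sqrt_divide)
    finally have 1: "L2_norm (L * \<beta>) T (weak_deriv (L * \<beta>) T s\<^sub>0) \<le> sqrt K * (l * L2_norm 0 T g)" .
    have "H1_norm (L * \<beta>) T s\<^sub>0 \<le> sqrt ((T - L * \<beta>)\<^sup>2 + 1) * L2_norm (L * \<beta>) T (weak_deriv (L * \<beta>) T s\<^sub>0)"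
      using assms(9) by (intro H1_norm_poincare s0) simp
    also have "\<dots> \<le> sqrt ((T - L * \<beta>)\<^sup>2 + 1) * (sqrt K * (l * L2_norm 0 T g))"
      using 1 by (intro mult_left_mono) auto
    also have "\<dots> = C\<^sub>1 * L2_norm 0 T g" by (simp add: C\<^sub>1_def)
    finally show ?thesis .
  qed
  ultimately show ?thesis by blast
qed

end
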